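(* Suppose that $H=K\ast L$ with $K$ and $L$ free groups, that $U\in K$ and $V\in L$ are nontrivial and not proper powers, and that $m$ and $n$ are positive integers. The equation $$[x,y]=[U^m,V^n]$$ has (exactly) $m+n-1$ distinct stabilizer classes of solutions in $H$, represented by the solutions $\phi_i$ with $x\phi_i=U^m$, $y\phi_i=U^{-i}V^n$ for $0\le i<m$, and by the solutions $\psi_j$ with $x\psi_j=V^jU^m$, $y\psi_j=V^n$ for $1\le j<n$.
   Context: $[x,y]=x^{-1}y^{-1}xy$. A solution to $[x,y]=T$ (with $T\in H$) is a homomorphism $\phi$ from the free group $\langle x,y\rangle$ on $x,y$ to $H$ with $[x\phi,y\phi]=T$. Maps are written on the right and composed left to right. Two solutions $\phi_1,\phi_2$ of the same equation $[x,y]=T$ are in the same stabilizer class if $\phi_2=\sigma\phi_1$ (apply $\sigma$ first) for some automorphism $\sigma$ of the free group $\langle x,y\rangle$ with $[x,y]\sigma=[x,y]$. *)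

theory Defs
  imports "HOL-Algebra.Generated_Groups" "HOL-Algebra.Bij"
begin

section \<open>Free groups\<close>

definition list_prod :: "('a, 'b) monoid_scheme \<Rightarrow> 'a list \<Rightarrow> 'a" where
  "list_prod G xs = foldr (\<otimes>\<^bsub>G\<^esub>) xs \<one>\<^bsub>G\<^esub>"

text \<open>
  A letter is a pair \<open>(s, b)\<close>, standing for \<open>s\<close> if \<open>b\<close> holds and for \<open>s\<^sup>-\<^sup>1\<close> otherwise.
\<close>

definition letter :: "('a, 'b) monoid_scheme \<Rightarrow> 'a \<times> bool \<Rightarrow> 'a" where
  "letter G p = (if snd p then fst p else inv\<^bsub>G\<^esub> (fst p))"

definition freely_reduced :: "('a \<times> bool) list \<Rightarrow> bool" where
  "freely_reduced w \<longleftrightarrow> successively (\<lambda>p q. \<not> (fst p = fst q \<and> snd p \<noteq> snd q)) w"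

definition free_basis :: "('a, 'b) monoid_scheme \<Rightarrow> 'a set \<Rightarrow> bool" where
  "free_basis G S \<longleftrightarrow>
     group G \<and> S \<subseteq> carrier G \<and> generate G S = carrier G \<and>
     (\<forall>w. w \<noteq> [] \<and> fst ` set w \<subseteq> S \<and> freely_reduced w \<longrightarrow>
            list_prod G (map (letter G) w) \<noteq> \<one>\<^bsub>G\<^esub>)"

definition free_group :: "('a, 'b) monoid_scheme \<Rightarrow> bool" where
  "free_group G \<longleftrightarrow> (\<exists>S. free_basis G S)"


section \<open>Free products\<close>

text \<open>
  \<open>G\<close> is the (internal) free product of its subgroups \<open>A\<close> and \<open>B\<close>. The Boolean tag of a syllable
  records the factor it is taken from; since tags and not elements are required to alternate,
  \<open>A\<close> and \<open>B\<close> are forced to intersect trivially.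
\<close>

definition free_product :: "('a, 'b) monoid_scheme \<Rightarrow> 'a set \<Rightarrow> 'a set \<Rightarrow> bool" where
  "free_product G A B \<longleftrightarrow>
     group G \<and> subgroup A G \<and> subgroup B G \<and> generate G (A \<union> B) = carrier G \<and>
     (\<forall>w. w \<noteq> [] \<and> (\<forall>(t, g) \<in> set w. g \<in> (if t then A else B) - {\<one>\<^bsub>G\<^esub>}) \<and>
            successively (\<lambda>p q. fst p \<noteq> fst q) w \<longrightarrow>
            list_prod G (map snd w) \<noteq> \<one>\<^bsub>G\<^esub>)"


section \<open>Universal properties\<close>

text \<open>
  The normal form conditions above yield the usual universal properties, so they determine
  \<open>G\<close> up to isomorphism.
\<close>

lemma list_prod_simps [simp]:
  "list_prod G [] = \<one>\<^bsub>G\<^esub>"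
  "list_prod G (x # xs) = x \<otimes>\<^bsub>G\<^esub> list_prod G xs"
  by (simp_all add: list_prod_def)

lemma (in group) list_prod_closed [simp]:
  "set xs \<subseteq> carrier G \<Longrightarrow> list_prod G xs \<in> carrier G"
  by (induction xs) auto

lemma (in group) list_prod_append:
  "set xs \<subseteq> carrier G \<Longrightarrow> set ys \<subseteq> carrier G \<Longrightarrow>
     list_prod G (xs @ ys) = list_prod G xs \<otimes> list_prod G ys"
  by (induction xs) (auto simp: m_assoc)

lemma hom_of_words:
  fixes G :: "('a, 'b) monoid_scheme" and H :: "('c, 'd) monoid_scheme" and D :: "'l set"
  assumes G: "group G" and H: "group H"
    and e: "e \<in> D \<rightarrow> carrier G" and f: "f \<in> D \<rightarrow> carrier H"
    and gen: "carrier G \<subseteq> generate G (e ` D)"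
    and neg: "\<And>a. a \<in> D \<Longrightarrow> n a \<in> D \<and> e (n a) = inv\<^bsub>G\<^esub> (e a) \<and> f (n a) = inv\<^bsub>H\<^esub> (f a)"
    and rel: "\<And>w. set w \<subseteq> D \<Longrightarrow> list_prod G (map e w) = \<one>\<^bsub>G\<^esub> \<Longrightarrow> list_prod H (map f w) = \<one>\<^bsub>H\<^esub>"
  shows "\<exists>h \<in> hom G H. \<forall>a\<in>D. h (e a) = f a"
proof -
  interpret G: group G by fact
  interpret H: group H by fact
  let ?E = "\<lambda>w. list_prod G (map e w)" and ?F = "\<lambda>w. list_prod H (map f w)"
  have cE: "set (map e w) \<subseteq> carrier G" and cF: "set (map f w) \<subseteq> carrier H"
    if "set w \<subseteq> D" for w using that e f by auto
  have ce: "e a \<in> carrier G" "f a \<in> carrier H" if "a \<in> D" for a using that e f by auto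
  have words: "\<exists>w. set w \<subseteq> D \<and> ?E w = g" if "g \<in> carrier G" for g
  proof -
    have "g \<in> generate G (e ` D)" using that gen by auto
    then show ?thesis
    proof induction
      case one show ?case by (intro exI[of _ "[]"]) simp
    next
      case (incl h) then obtain a where "a \<in> D" "h = e a" by auto
      then show ?case using ce by (intro exI[of _ "[a]"]) auto
    next
      case (inv h) then obtain a where a: "a \<in> D" "h = e a" by auto
      then have "n a \<in> D" "e (n a) = inv\<^bsub>G\<^esub> h" using neg by auto
      moreover have "inv\<^bsub>G\<^esub> h \<in> carrier G" using a ce by auto
      ultimately show ?case by (intro exI[of _ "[n a]"]) auto
    next
      case (eng h1 h2)
      then obtain v w where "set v \<subseteq> D" "?E v = h1" "set w \<subseteq> D" "?E w = h2" by auto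
      then show ?case using cE by (intro exI[of _ "v @ w"]) (simp add: G.list_prod_append)
    qed
  qed
  have inverse: "\<exists>v. set v \<subseteq> D \<and> ?E v = inv\<^bsub>G\<^esub> (?E w) \<and> ?F v = inv\<^bsub>H\<^esub> (?F w)"
    if "set w \<subseteq> D" for w using that
  proof (induction w)
    case Nil show ?case by (intro exI[of _ "[]"]) simp
  next
    case (Cons a w)
    then obtain v where v: "set v \<subseteq> D" "?E v = inv\<^bsub>G\<^esub> (?E w)" "?F v = inv\<^bsub>H\<^esub> (?F w)" by auto
    have a: "a \<in> D" "e a \<in> carrier G" "f a \<in> carrier H" "n a \<in> D"
        "e (n a) = inv\<^bsub>G\<^esub> (e a)" "f (n a) = inv\<^bsub>H\<^esub> (f a)"
      using Cons.prems neg[of a] e f by auto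
    have w: "?E w \<in> carrier G" "?F w \<in> carrier H" using Cons.prems cE cF by auto
    show ?case
      using v a w cE[OF v(1)] cF[OF v(1)]
      by (intro exI[of _ "v @ [n a]"])
         (simp add: G.list_prod_append H.list_prod_append G.inv_mult_group H.inv_mult_group)
  qed
  have eq: "?F v = ?F w" if vw: "set v \<subseteq> D" "set w \<subseteq> D" "?E v = ?E w" for v w
  proof -
    obtain u where u: "set u \<subseteq> D" "?E u = inv\<^bsub>G\<^esub> (?E w)" "?F u = inv\<^bsub>H\<^esub> (?F w)"
      using inverse vw by blast
    have c: "?E w \<in> carrier G" "?F w \<in> carrier H" "?F v \<in> carrier H" using vw cE cF by auto
    have "?E (v @ u) = \<one>\<^bsub>G\<^esub>"
      using u vw c cE[OF u(1)] cE[OF vw(1)] by (simp add: G.list_prod_append)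
    then have "?F (v @ u) = \<one>\<^bsub>H\<^esub>" using rel[of "v @ u"] u vw by simp
    then have "?F v \<otimes>\<^bsub>H\<^esub> inv\<^bsub>H\<^esub> (?F w) = \<one>\<^bsub>H\<^esub>"
      using u cF[OF u(1)] cF[OF vw(1)] by (simp add: H.list_prod_append)
    then show ?thesis using c by (metis H.inv_equality H.inv_closed H.inv_inv)
  qed
  obtain W where W: "\<And>g. g \<in> carrier G \<Longrightarrow> set (W g) \<subseteq> D \<and> ?E (W g) = g"
    using words by metis
  have h: "?F (W (?E w)) = ?F w" if "set w \<subseteq> D" for w
    using W[of "?E w"] that cE[OF that] by (intro eq) auto
  show ?thesis
  proof (intro bexI[of _ "\<lambda>g. ?F (W g)"] ballI)
    fix a assume a: "a \<in> D"
    then have "e a = ?E [a]" "f a = ?F [a]" using ce by auto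
    then show "?F (W (e a)) = f a" using h[of "[a]"] a by simp
  next
    show "(\<lambda>g. ?F (W g)) \<in> hom G H"
    proof (rule homI)
      fix g assume "g \<in> carrier G"
      then show "?F (W g) \<in> carrier H" using W cF by auto
    next
      fix g k assume "g \<in> carrier G" "k \<in> carrier G"
      then have *: "set (W g) \<subseteq> D" "?E (W g) = g" "set (W k) \<subseteq> D" "?E (W k) = k" using W by auto
      then have "?E (W g @ W k) = g \<otimes>\<^bsub>G\<^esub> k" using cE by (simp add: G.list_prod_append)
      then have "?F (W (g \<otimes>\<^bsub>G\<^esub> k)) = ?F (W g @ W k)" using h[of "W g @ W k"] * by simp
      then show "?F (W (g \<otimes>\<^bsub>G\<^esub> k)) = ?F (W g) \<otimes>\<^bsub>H\<^esub> ?F (W k)"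
        using * cF by (simp add: H.list_prod_append)
    qed
  qed
qed

lemma hom_eq_on_generate:
  assumes "group G" "group H" "h \<in> hom G H" "k \<in> hom G H" "S \<subseteq> carrier G"
    and "\<And>s. s \<in> S \<Longrightarrow> h s = k s" and "g \<in> generate G S"
  shows "h g = k g"
proof -
  interpret h: group_hom G H h using assms by (simp add: group_hom_def group_hom_axioms_def)
  interpret k: group_hom G H k using assms by (simp add: group_hom_def group_hom_axioms_def)
  show ?thesis using assms(7)
  proof induction
    case (inv s) then show ?case using assms(5,6) h.hom_inv k.hom_inv by (metis subsetD)
  next
    case (eng g1 g2)
    then show ?case using group.generate_in_carrier[OF assms(1,5)] by simp
  qed (use assms in auto)
qed

lemma not_successivelyD:
  "\<not> successively P w \<Longrightarrow> \<exists>u a b v. w = u @ a # b # v \<and> \<not> P a b"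
proof (induction P w rule: successively.induct)
  case (3 P x y xs)
  show ?case
  proof (cases "P x y")
    case True
    then obtain u a b v where "y # xs = u @ a # b # v" "\<not> P a b" using 3 by auto
    then show ?thesis by (intro exI[of _ "x # u"]) auto
  next
    case False then show ?thesis by (intro exI[of _ "[]"]) auto
  qed
qed auto

theorem free_basis_universal:
  assumes basis: "free_basis G S" and H: "group H" and f: "f \<in> S \<rightarrow> carrier H"
  shows "\<exists>!h. h \<in> hom G H \<inter> extensional (carrier G) \<and> (\<forall>s\<in>S. h s = f s)"
proof -
  interpret G: group G using basis by (simp add: free_basis_def)
  interpret H: group H by fact
  have S: "S \<subseteq> carrier G" and gen: "generate G S = carrier G"
    using basis by (auto simp: free_basis_def)
  let ?F = "\<lambda>p. if snd p then f (fst p) else inv\<^bsub>H\<^esub> (f (fst p))"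
  have cl: "letter G p \<in> carrier G" "?F p \<in> carrier H" if "fst p \<in> S" for p
    using that S f by (auto simp: letter_def)
  have "\<exists>h \<in> hom G H. \<forall>p \<in> S \<times> UNIV. h (letter G p) = ?F p"
  proof (rule hom_of_words[where n = "\<lambda>p. (fst p, \<not> snd p)"])
    have "S \<subseteq> letter G ` (S \<times> UNIV)" by (force simp: letter_def image_iff)
    then show "carrier G \<subseteq> generate G (letter G ` (S \<times> UNIV))"
      using gen G.mono_generate by blast
  next
    fix p :: "'a \<times> bool" assume "p \<in> S \<times> UNIV"
    then show "(fst p, \<not> snd p) \<in> S \<times> UNIV \<and>
        letter G (fst p, \<not> snd p) = inv\<^bsub>G\<^esub> (letter G p) \<and>
        ?F (fst p, \<not> snd p) = inv\<^bsub>H\<^esub> (?F p)"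
      using S f by (auto simp: letter_def Pi_iff)
  next
    fix w :: "('a \<times> bool) list"
    assume "set w \<subseteq> S \<times> UNIV" "list_prod G (map (letter G) w) = \<one>\<^bsub>G\<^esub>"
    then show "list_prod H (map ?F w) = \<one>\<^bsub>H\<^esub>"
    proof (induction w rule: length_induct)
      case (1 w)
      have IH: "list_prod H (map ?F v) = \<one>\<^bsub>H\<^esub>"
        if "length v < length w" "set v \<subseteq> S \<times> UNIV" "list_prod G (map (letter G) v) = \<one>\<^bsub>G\<^esub>" for v
        using 1(1) that by blast
      show ?case
      proof (cases "w = []")
        case False
        have "fst ` set w \<subseteq> S" using 1 by auto
        then have "\<not> freely_reduced w"
          using basis 1 False unfolding free_basis_def by blast
        then obtain u a b v where w: "w = u @ a # b # v" "fst a = fst b" "snd a \<noteq> snd b"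
          unfolding freely_reduced_def by (blast dest: not_successivelyD)
        have uv: "fst a \<in> S" "fst b \<in> S" "set u \<subseteq> S \<times> UNIV" "set v \<subseteq> S \<times> UNIV"
          using 1(2) w(1) by auto
        have "set (map (letter G) t) \<subseteq> carrier G" "set (map ?F t) \<subseteq> carrier H"
          if "set t \<subseteq> S \<times> UNIV" for t
        proof -
          have "fst p \<in> S" if "p \<in> set t" for p using that \<open>set t \<subseteq> S \<times> UNIV\<close> by auto
          then show "set (map (letter G) t) \<subseteq> carrier G" "set (map ?F t) \<subseteq> carrier H"
            using cl by (simp_all only: set_map image_subset_iff) blast+
        qed
        then have c: "set (map (letter G) u) \<subseteq> carrier G" "set (map (letter G) v) \<subseteq> carrier G"
          "set (map ?F u) \<subseteq> carrier H" "set (map ?F v) \<subseteq> carrier H"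
          using uv by blast+
        have G1: "letter G a \<otimes>\<^bsub>G\<^esub> (letter G b \<otimes>\<^bsub>G\<^esub> list_prod G (map (letter G) v))
            = list_prod G (map (letter G) v)"
        proof -
          have "letter G a \<otimes>\<^bsub>G\<^esub> letter G b = \<one>\<^bsub>G\<^esub>"
            using uv w S by (cases "snd a") (auto simp: letter_def)
          then show ?thesis using cl uv c by (simp flip: G.m_assoc)
        qed
        have H1: "?F a \<otimes>\<^bsub>H\<^esub> (?F b \<otimes>\<^bsub>H\<^esub> list_prod H (map ?F v)) = list_prod H (map ?F v)"
        proof -
          have "f (fst b) \<in> carrier H" using uv f by auto
          then have "?F a \<otimes>\<^bsub>H\<^esub> ?F b = \<one>\<^bsub>H\<^esub>" using w(2,3) by (cases "snd a") auto
          then show ?thesis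
            using cl(2)[OF uv(1)] cl(2)[OF uv(2)] H.list_prod_closed[OF c(4)] H.l_one
            by (simp only: H.m_assoc[symmetric])
        qed
        have ca: "set (map (letter G) (a # b # v)) \<subseteq> carrier G"
          "set (map ?F (a # b # v)) \<subseteq> carrier H"
          using c uv cl[of a] cl[of b] by (simp_all only: list.map list.set) blast+
        have "list_prod G (map (letter G) w) = list_prod G (map (letter G) (u @ v))"
          unfolding w(1) map_append G.list_prod_append[OF c(1) ca(1)] G.list_prod_append[OF c(1,2)]
          using G1 by (simp only: list.map list_prod_simps)
        moreover have "list_prod H (map ?F w) = list_prod H (map ?F (u @ v))"
          unfolding w(1) map_append H.list_prod_append[OF c(3) ca(2)] H.list_prod_append[OF c(3,4)]
          using H1 by (simp only: list.map list_prod_simps)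
        moreover have "set (u @ v) \<subseteq> S \<times> UNIV" "length (u @ v) < length w" using 1 w by auto
        ultimately show ?thesis using IH[of "u @ v"] 1(3) by argo
      qed simp
    qed
  qed (use H cl in \<open>auto simp: G.is_group\<close>)
  then obtain h where h: "h \<in> hom G H" "\<And>p. p \<in> S \<times> UNIV \<Longrightarrow> h (letter G p) = ?F p" by auto
  have hs: "h s = f s" if "s \<in> S" for s using h(2)[of "(s, True)"] that by (simp add: letter_def)
  show ?thesis
  proof (rule ex1I[of _ "restrict h (carrier G)"])
    show "restrict h (carrier G) \<in> hom G H \<inter> extensional (carrier G) \<and>
        (\<forall>s\<in>S. restrict h (carrier G) s = f s)"
      using h hs S by (auto simp: hom_def)
  next
    fix k assume k: "k \<in> hom G H \<inter> extensional (carrier G) \<and> (\<forall>s\<in>S. k s = f s)"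
    have "k g = h g" if "g \<in> carrier G" for g
      using hom_eq_on_generate[of G H k h S g] k h hs S gen that H G.is_group by auto
    with k show "k = restrict h (carrier G)"
      by (intro extensionalityI[of k "carrier G"]) auto
  qed
qed

theorem free_product_universal:
  assumes prod: "free_product G A B" and H: "group H"
    and f: "f \<in> hom (G\<lparr>carrier := A\<rparr>) H" and g: "g \<in> hom (G\<lparr>carrier := B\<rparr>) H"
  shows "\<exists>!h. h \<in> hom G H \<inter> extensional (carrier G) \<and> (\<forall>a\<in>A. h a = f a) \<and> (\<forall>b\<in>B. h b = g b)"
proof -
  interpret G: group G using prod by (simp add: free_product_def)
  interpret H: group H by fact
  have sub: "subgroup A G" "subgroup B G" and gen: "generate G (A \<union> B) = carrier G"
    using prod by (auto simp: free_product_def)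
  interpret f: group_hom "G\<lparr>carrier := A\<rparr>" H f
    using f H G.subgroup_imp_group[OF sub(1)] by (simp add: group_hom_def group_hom_axioms_def)
  interpret g: group_hom "G\<lparr>carrier := B\<rparr>" H g
    using g H G.subgroup_imp_group[OF sub(2)] by (simp add: group_hom_def group_hom_axioms_def)
  let ?C = "\<lambda>t. if t then A else B" and ?h = "\<lambda>t. if t then f else g"
  let ?F = "\<lambda>p. ?h (fst p) (snd p)"
  let ?D = "{p. snd p \<in> ?C (fst p)}"
  have subC: "subgroup (?C t) G" for t using sub by simp
  have Fone: "?h t \<one>\<^bsub>G\<^esub> = \<one>\<^bsub>H\<^esub>" for t using f.hom_one g.hom_one by simp
  have Fmult: "?h t (x \<otimes>\<^bsub>G\<^esub> y) = ?h t x \<otimes>\<^bsub>H\<^esub> ?h t y" if "x \<in> ?C t" "y \<in> ?C t" for t x y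
    using that f.hom_mult[of x y] g.hom_mult[of x y] by (cases t) auto
  have Finv: "?h t (inv\<^bsub>G\<^esub> x) = inv\<^bsub>H\<^esub> (?h t x)" if "x \<in> ?C t" for t x
    using that f.hom_inv[of x] g.hom_inv[of x] sub by (cases t) (auto simp: G.m_inv_consistent)
  have cl: "snd p \<in> carrier G" "?F p \<in> carrier H" if "p \<in> ?D" for p
    using that sub[THEN subgroup.subset] f.hom_closed g.hom_closed
    by (auto split: if_splits)
  have "\<exists>h \<in> hom G H. \<forall>p \<in> ?D. h (snd p) = ?F p"
  proof (rule hom_of_words[where n = "\<lambda>p. (fst p, inv\<^bsub>G\<^esub> (snd p))"])
    have "A \<union> B \<subseteq> snd ` ?D" by (force simp: image_iff)
    then show "carrier G \<subseteq> generate G (snd ` ?D)"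
      using gen G.mono_generate by blast
  next
    fix p assume "p \<in> ?D"
    then show "(fst p, inv\<^bsub>G\<^esub> snd p) \<in> ?D \<and> snd (fst p, inv\<^bsub>G\<^esub> snd p) = inv\<^bsub>G\<^esub> snd p \<and>
        ?F (fst p, inv\<^bsub>G\<^esub> snd p) = inv\<^bsub>H\<^esub> ?F p"
      using Finv[of "snd p" "fst p"] subgroup.m_inv_closed[OF subC, of "snd p" "fst p"] by auto
  next
    fix w assume "set w \<subseteq> ?D" "list_prod G (map snd w) = \<one>\<^bsub>G\<^esub>"
    then show "list_prod H (map ?F w) = \<one>\<^bsub>H\<^esub>"
    proof (induction w rule: length_induct)
      case (1 w)
      have IH: "list_prod H (map ?F v) = \<one>\<^bsub>H\<^esub>"
        if "length v < length w" "set v \<subseteq> ?D" "list_prod G (map snd v) = \<one>\<^bsub>G\<^esub>" for v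
        using 1(1) that by blast
      have c: "set (map snd u) \<subseteq> carrier G" "set (map ?F u) \<subseteq> carrier H" if "set u \<subseteq> ?D" for u
        using that cl by (simp_all only: set_map) blast+
      consider "w = []" | u t v where "w = u @ (t, \<one>\<^bsub>G\<^esub>) # v"
        | u t x y v where "w = u @ (t, x) # (t, y) # v"
      proof -
        have "\<not> (w \<noteq> [] \<and> (\<forall>(t, g) \<in> set w. g \<in> ?C t - {\<one>\<^bsub>G\<^esub>}) \<and>
            successively (\<lambda>p q. fst p \<noteq> fst q) w)"
          using prod 1 by (auto simp: free_product_def)
        then consider "w = []" | p where "p \<in> set w" "snd p = \<one>\<^bsub>G\<^esub>"
          | "\<not> successively (\<lambda>p q. fst p \<noteq> fst q) w"
          using 1 by fastforce
        then show thesis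
        proof cases
          case 2
          then obtain u v where "w = u @ p # v" by (meson split_list)
          then show thesis using 2 that(2)[of u "fst p" v] by (cases p) auto
        next
          case 3
          then obtain u a b v where "w = u @ a # b # v" "fst a = fst b"
            by (blast dest: not_successivelyD)
          then show thesis using that(3)[of u "fst a" "snd a" "snd b" v] by (cases a; cases b) auto
        qed (rule that(1))
      qed
      then show ?case
      proof cases
        case (2 u t v)
        then have "set u \<subseteq> ?D" "set v \<subseteq> ?D" using 1 by auto
        then have "list_prod G (map snd w) = list_prod G (map snd (u @ v))"
          "list_prod H (map ?F w) = list_prod H (map ?F (u @ v))"
          using 2 c[of u] c[of v] Fone[of t]
          by (simp_all add: G.list_prod_append H.list_prod_append)
        moreover have "set (u @ v) \<subseteq> ?D" "length (u @ v) < length w" using 1 2 by auto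
        ultimately show ?thesis using IH[of "u @ v"] 1(3) by argo
      next
        case (3 u t x y v)
        then have m: "set u \<subseteq> ?D" "set v \<subseteq> ?D" "x \<in> ?C t" "y \<in> ?C t" using 1 by auto
        let ?w = "u @ (t, x \<otimes>\<^bsub>G\<^esub> y) # v"
        have xy: "x \<otimes>\<^bsub>G\<^esub> y \<in> ?C t" using m subgroup.m_closed[OF subC] by blast
        have "x \<in> carrier G" "y \<in> carrier G" "?h t x \<in> carrier H" "?h t y \<in> carrier H"
          using m cl[of "(t, x)"] cl[of "(t, y)"] by auto
        then have "list_prod G (map snd w) = list_prod G (map snd ?w)"
          "list_prod H (map ?F w) = list_prod H (map ?F ?w)"
          using 3 m c[of u] c[of v] Fmult[of x t y]
          by (simp_all add: G.list_prod_append H.list_prod_append G.m_assoc H.m_assoc)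
        moreover have "set ?w \<subseteq> ?D" using m xy by auto
        moreover have "length ?w < length w" using 3 by simp
        ultimately show ?thesis using IH[of ?w] 1(3) by argo
      qed simp
    qed
  qed (use H cl in \<open>auto simp: G.is_group\<close>)
  then obtain h where h: "h \<in> hom G H" "\<And>p. p \<in> ?D \<Longrightarrow> h (snd p) = ?F p" by blast
  have hA: "h a = f a" if "a \<in> A" for a using h(2)[of "(True, a)"] that by simp
  have hB: "h b = g b" if "b \<in> B" for b using h(2)[of "(False, b)"] that by simp
  have AB: "A \<union> B \<subseteq> carrier G" using sub subgroup.subset by blast
  show ?thesis
  proof (rule ex1I[of _ "restrict h (carrier G)"])
    show "restrict h (carrier G) \<in> hom G H \<inter> extensional (carrier G) \<and>
        (\<forall>a\<in>A. restrict h (carrier G) a = f a) \<and> (\<forall>b\<in>B. restrict h (carrier G) b = g b)"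
      using h(1) hA hB AB by (auto simp: hom_def)
  next
    fix k assume k: "k \<in> hom G H \<inter> extensional (carrier G) \<and>
        (\<forall>a\<in>A. k a = f a) \<and> (\<forall>b\<in>B. k b = g b)"
    have "k x = h x" if "x \<in> carrier G" for x
    proof (rule hom_eq_on_generate[OF G.is_group H])
      show "k a = h a" if "a \<in> A \<union> B" for a using that k hA hB by auto
    qed (use k h(1) AB gen that in auto)
    with k show "k = restrict h (carrier G)"
      by (intro extensionalityI[of k "carrier G"]) auto
  qed
qed


section \<open>Proper powers and commutators\<close>

definition proper_power :: "('a, 'b) monoid_scheme \<Rightarrow> 'a \<Rightarrow> bool" where
  "proper_power G u \<longleftrightarrow> (\<exists>w\<in>carrier G. \<exists>k::nat. k \<ge> 2 \<and> u = w [^]\<^bsub>G\<^esub> k)"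

definition commutator :: "('a, 'b) monoid_scheme \<Rightarrow> 'a \<Rightarrow> 'a \<Rightarrow> 'a" where
  "commutator G x y = inv\<^bsub>G\<^esub> x \<otimes>\<^bsub>G\<^esub> inv\<^bsub>G\<^esub> y \<otimes>\<^bsub>G\<^esub> x \<otimes>\<^bsub>G\<^esub> y"


section \<open>Solutions and stabilizer classes\<close>

text \<open>
  \<open>F\<close> is meant to be free on \<open>x\<close> and \<open>y\<close>. Homomorphisms are taken to be extensional, so that
  distinct elements of \<^term>\<open>solutions F x y H T\<close> differ on \<^term>\<open>carrier F\<close>.
\<close>

definition solutions ::
  "('f, 'm) monoid_scheme \<Rightarrow> 'f \<Rightarrow> 'f \<Rightarrow> ('h, 'n) monoid_scheme \<Rightarrow> 'h \<Rightarrow> ('f \<Rightarrow> 'h) set" where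
  "solutions F x y H T =
     {\<phi> \<in> hom F H \<inter> extensional (carrier F). commutator H (\<phi> x) (\<phi> y) = T}"

text \<open>
  With maps written on the right, \<open>\<sigma>\<phi>\<close> (first \<open>\<sigma>\<close>, then \<open>\<phi>\<close>) is \<^term>\<open>compose (carrier F) \<phi> \<sigma>\<close>.
\<close>

definition stabilizer_rel ::
  "('f, 'm) monoid_scheme \<Rightarrow> 'f \<Rightarrow> 'f \<Rightarrow> ('h, 'n) monoid_scheme \<Rightarrow> 'h \<Rightarrow> (('f \<Rightarrow> 'h) \<times> ('f \<Rightarrow> 'h)) set"
where
  "stabilizer_rel F x y H T =
     {(\<phi>\<^sub>1, \<phi>\<^sub>2). \<phi>\<^sub>1 \<in> solutions F x y H T \<and> \<phi>\<^sub>2 \<in> solutions F x y H T \<and>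
        (\<exists>\<sigma> \<in> auto F. \<sigma> (commutator F x y) = commutator F x y \<and>
                      \<phi>\<^sub>2 = compose (carrier F) \<phi>\<^sub>1 \<sigma>)}"

definition stabilizer_class ::
  "('f, 'm) monoid_scheme \<Rightarrow> 'f \<Rightarrow> 'f \<Rightarrow> ('h, 'n) monoid_scheme \<Rightarrow> 'h \<Rightarrow> ('f \<Rightarrow> 'h) \<Rightarrow> ('f \<Rightarrow> 'h) set"
where
  "stabilizer_class F x y H T \<phi> = stabilizer_rel F x y H T `` {\<phi>}"

definition stabilizer_classes ::
  "('f, 'm) monoid_scheme \<Rightarrow> 'f \<Rightarrow> 'f \<Rightarrow> ('h, 'n) monoid_scheme \<Rightarrow> 'h \<Rightarrow> ('f \<Rightarrow> 'h) set set" where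
  "stabilizer_classes F x y H T = solutions F x y H T // stabilizer_rel F x y H T"

lemma equiv_stabilizer_rel:
  assumes "group F" "x \<in> carrier F" "y \<in> carrier F"
  shows "equiv (solutions F x y H T) (stabilizer_rel F x y H T)"
proof -
  interpret F: group F by fact
  let ?c = "commutator F x y"
  have c: "?c \<in> carrier F" using assms by (simp add: commutator_def)
  have ext: "\<phi> \<in> extensional (carrier F)" if "\<phi> \<in> solutions F x y H T" for \<phi>
    using that by (simp add: solutions_def)
  have aut: "bij_betw \<sigma> (carrier F) (carrier F)" "\<sigma> \<in> carrier F \<rightarrow> carrier F" if "\<sigma> \<in> auto F" for \<sigma>
    using that by (auto simp: auto_def Bij_def bij_betw_def)
  show ?thesis
  proof (rule equivI)
    show "stabilizer_rel F x y H T \<subseteq> solutions F x y H T \<times> solutions F x y H T"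
      by (auto simp: stabilizer_rel_def)
  next
    show "refl_on (solutions F x y H T) (stabilizer_rel F x y H T)"
    proof (rule refl_onI)
      fix \<phi> assume \<phi>: "\<phi> \<in> solutions F x y H T"
      have "\<phi> = compose (carrier F) \<phi> (\<lambda>g\<in>carrier F. g)"
        by (rule extensionalityI[OF ext[OF \<phi>] compose_extensional]) (simp add: compose_def)
      moreover have "(\<lambda>g\<in>carrier F. g) ?c = ?c" using c by simp
      ultimately show "(\<phi>, \<phi>) \<in> stabilizer_rel F x y H T"
        using \<phi> F.id_in_auto unfolding stabilizer_rel_def by blast
    qed
  next
    show "sym (stabilizer_rel F x y H T)"
    proof (rule symI)
      fix \<phi> \<psi> assume "(\<phi>, \<psi>) \<in> stabilizer_rel F x y H T"
      then obtain \<sigma> where s: "\<phi> \<in> solutions F x y H T" "\<psi> \<in> solutions F x y H T" "\<sigma> \<in> auto F"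
        "\<sigma> ?c = ?c" "\<psi> = compose (carrier F) \<phi> \<sigma>" by (auto simp: stabilizer_rel_def)
      define \<tau> where "\<tau> = restrict (inv_into (carrier F) \<sigma>) (carrier F)"
      have "\<tau> \<in> auto F"
        using s(3) by (simp add: \<tau>_def auto_def F.restrict_inv_into_hom restrict_inv_into_Bij)
      moreover have "\<tau> ?c = ?c"
        using bij_betw_inv_into_left[OF aut(1)[OF s(3)] c] c s(4) by (simp add: \<tau>_def)
      moreover have "\<phi> = compose (carrier F) \<psi> \<tau>"
      proof (rule extensionalityI[OF ext[OF s(1)] compose_extensional])
        fix z assume z: "z \<in> carrier F"
        then have "inv_into (carrier F) \<sigma> z \<in> carrier F" "\<sigma> (inv_into (carrier F) \<sigma> z) = z"
          using bij_betw_apply[OF bij_betw_inv_into[OF aut(1)[OF s(3)]] z]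
            bij_betw_inv_into_right[OF aut(1)[OF s(3)] z] by simp_all
        then show "\<phi> z = compose (carrier F) \<psi> \<tau> z"
          using z s(5) by (simp add: compose_def \<tau>_def)
      qed
      ultimately show "(\<psi>, \<phi>) \<in> stabilizer_rel F x y H T"
        using s(1,2) unfolding stabilizer_rel_def by blast
    qed
  next
    show "trans (stabilizer_rel F x y H T)"
    proof (rule transI)
      fix \<phi> \<psi> \<chi> assume "(\<phi>, \<psi>) \<in> stabilizer_rel F x y H T" "(\<psi>, \<chi>) \<in> stabilizer_rel F x y H T"
      then obtain \<sigma> \<tau> where s: "\<phi> \<in> solutions F x y H T" "\<chi> \<in> solutions F x y H T"
        "\<sigma> \<in> auto F" "\<sigma> ?c = ?c" "\<psi> = compose (carrier F) \<phi> \<sigma>"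
        "\<tau> \<in> auto F" "\<tau> ?c = ?c" "\<chi> = compose (carrier F) \<psi> \<tau>"
        by (auto simp: stabilizer_rel_def)
      have "compose (carrier F) \<sigma> \<tau> \<in> auto F"
        using s(3,6) F.hom_compose by (auto simp: auto_def compose_Bij)
      moreover have "compose (carrier F) \<sigma> \<tau> ?c = ?c" using s c by (simp add: compose_def)
      moreover have "\<chi> = compose (carrier F) \<phi> (compose (carrier F) \<sigma> \<tau>)"
        using compose_assoc[OF aut(2)[OF s(6)], of \<phi> \<sigma>] s(5,8) by simp
      ultimately show "(\<phi>, \<chi>) \<in> stabilizer_rel F x y H T"
        using s(1,2) unfolding stabilizer_rel_def by blast
    qed
  qed
qed

end

theory Submission
  imports Defs
begin

text \<open>
  Nielsen moves \<open>(x, y) \<mapsto> (x, x\<^sup>\<plusminus>\<^sup>1 y)\<close> and \<open>(x, y) \<mapsto> (y\<^sup>\<plusminus>\<^sup>1 x, y)\<close> preserve \<open>[x, y]\<close> and are induced by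
  automorphisms of the free group that fix the commutator. Consider the action of \<open>H = K * L\<close> on
  its Bass--Serre tree, and choose, among all pairs obtained from a solution by moves and
  simultaneous conjugation and all vertices of the tree, one with the least total displacement.
  If both entries were hyperbolic, the commutator would have translation length greater than that
  of \<open>[U\<^sup>m, V\<^sup>n]\<close>, which is a cyclically reduced word of length 4. So one entry is elliptic, say in
  \<open>K\<close>; comparing cyclic normal forms, the pair is conjugate to \<open>(U\<^sup>m, z V\<^sup>n)\<close> where \<open>z\<close> commutes with
  \<open>U\<^sup>m\<close>, hence is a power of \<open>U\<close>, and its exponent matters only modulo \<open>m\<close>. The conjugating element
  centralizes \<open>[U\<^sup>m, V\<^sup>n]\<close>, so it is a power of it, and conjugation by the commutator is itself
  a product of moves. Conversely, equivalent solutions have the same image, and the images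
  \<open>\<langle>U\<^sup>m, U\<^sup>-\<^sup>i V\<^sup>n\<rangle>\<close> and \<open>\<langle>V\<^sup>j U\<^sup>m, V\<^sup>n\<rangle>\<close> are pairwise distinct.
\<close>

text \<open>The two bounds use different information. For the upper bound, every chain of moves is
  realized by some automorphism fixing [x, y] (\<open>stabilizer_relI\<close>); for the lower bound,
  the image of a solution is unchanged by every automorphism, whatever its form. Freeness of K and L
  enters through two facts: U and V have infinite order, and whatever commutes with U^m in K (with
  V^n in L) is a power of U (of V). In between, u = U^m and v = V^n are elements of the factors of
  an arbitrary free product, with u^2 and v nontrivial. The obstacle is conjugation. Displacement
  can only be minimized modulo simultaneous conjugation, but stabilizer classes do not absorb
  arbitrary conjugations, so the centralizer of [u, v] has to be known exactly. Both this
  centralizer and that of U^m come from one principle, recorded in \<open>shifts\<close>: a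
  conjugator between cyclically reduced words is a power of the first word followed by one of its
  prefixes. The count: an elliptic entry in K leaves m residues for the exponent of U, one in L
  leaves n residues for that of V, and residue 0 gives the same pair (U^m, V^n) both times.\<close>

section \<open>Nielsen moves that preserve the commutator\<close>

context group
begin

lemma inv_mult_cancel [simp]:
  "a \<in> carrier G \<Longrightarrow> b \<in> carrier G \<Longrightarrow> inv a \<otimes> (a \<otimes> b) = b"
  "a \<in> carrier G \<Longrightarrow> b \<in> carrier G \<Longrightarrow> a \<otimes> (inv a \<otimes> b) = b"
  by (simp_all flip: m_assoc)

lemma commutator_closed [simp]:
  "a \<in> carrier G \<Longrightarrow> b \<in> carrier G \<Longrightarrow> commutator G a b \<in> carrier G"
  by (simp add: commutator_def)

definition conj_by :: "'a \<Rightarrow> 'a \<Rightarrow> 'a" where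
  "conj_by c g = c \<otimes> g \<otimes> inv c"

lemma conj_by_closed [simp]: "c \<in> carrier G \<Longrightarrow> g \<in> carrier G \<Longrightarrow> conj_by c g \<in> carrier G"
  by (simp add: conj_by_def)

lemma conj_by_mult:
  "c \<in> carrier G \<Longrightarrow> g \<in> carrier G \<Longrightarrow> h \<in> carrier G \<Longrightarrow> conj_by c (g \<otimes> h) = conj_by c g \<otimes> conj_by c h"
  by (simp add: conj_by_def m_assoc)

lemma conj_by_inv: "c \<in> carrier G \<Longrightarrow> g \<in> carrier G \<Longrightarrow> conj_by c (inv g) = inv (conj_by c g)"
  by (simp add: conj_by_def m_assoc inv_mult_group)

lemma conj_by_conj:
  "c \<in> carrier G \<Longrightarrow> d \<in> carrier G \<Longrightarrow> g \<in> carrier G \<Longrightarrow> conj_by c (conj_by d g) = conj_by (c \<otimes> d) g"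
  by (simp add: conj_by_def m_assoc inv_mult_group)

lemma conj_by_one [simp]: "g \<in> carrier G \<Longrightarrow> conj_by \<one> g = g"
  by (simp add: conj_by_def)

lemma conj_by_commutator:
  "c \<in> carrier G \<Longrightarrow> a \<in> carrier G \<Longrightarrow> b \<in> carrier G \<Longrightarrow>
     conj_by c (commutator G a b) = commutator G (conj_by c a) (conj_by c b)"
  by (simp add: commutator_def conj_by_mult conj_by_inv)

lemma conj_by_fix_iff:
  "c \<in> carrier G \<Longrightarrow> g \<in> carrier G \<Longrightarrow> conj_by c g = g \<longleftrightarrow> c \<otimes> g = g \<otimes> c"
  by (simp add: conj_by_def inv_solve_right')

text \<open>Factors are multiplied on the left because then [x, x y] = [x, y] exactly, while
  [x, y x] is only a conjugate of [x, y]. The source pair is a fixed parameter, so inductions peel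
  off the last move.\<close>

inductive nielsen :: "'a \<Rightarrow> 'a \<Rightarrow> 'a \<Rightarrow> 'a \<Rightarrow> bool" for a b where
  refl: "nielsen a b a b"
| right: "nielsen a b x y \<Longrightarrow> nielsen a b x (x \<otimes> y)"
| right_inv: "nielsen a b x y \<Longrightarrow> nielsen a b x (inv x \<otimes> y)"
| left: "nielsen a b x y \<Longrightarrow> nielsen a b (y \<otimes> x) y"
| left_inv: "nielsen a b x y \<Longrightarrow> nielsen a b (inv y \<otimes> x) y"

lemma nielsen_closed:
  assumes "nielsen a b x y" "a \<in> carrier G" "b \<in> carrier G"
  shows "x \<in> carrier G" "y \<in> carrier G"
  using assms by induction auto

lemma nielsen_trans:
  assumes "nielsen x y z w" "nielsen a b x y"
  shows "nielsen a b z w"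
  using assms by induction (auto intro: nielsen.intros)

lemma nielsen_sym:
  assumes "nielsen a b x y" "a \<in> carrier G" "b \<in> carrier G"
  shows "nielsen x y a b"
  using assms
proof induction
  case refl show ?case by (rule nielsen.refl)
next
  case (right x y)
  note c = nielsen_closed[OF right(1) right.prems]
  have "nielsen x (x \<otimes> y) x (inv x \<otimes> (x \<otimes> y))" by (intro nielsen.intros)
  then show ?case using nielsen_trans[OF right.IH[OF right.prems]] c by simp
next
  case (right_inv x y)
  note c = nielsen_closed[OF right_inv(1) right_inv.prems]
  have "nielsen x (inv x \<otimes> y) x (x \<otimes> (inv x \<otimes> y))" by (intro nielsen.intros)
  then show ?case using nielsen_trans[OF right_inv.IH[OF right_inv.prems]] c by simp
next
  case (left x y)
  note c = nielsen_closed[OF left(1) left.prems]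
  have "nielsen (y \<otimes> x) y (inv y \<otimes> (y \<otimes> x)) y" by (intro nielsen.intros)
  then show ?case using nielsen_trans[OF left.IH[OF left.prems]] c by simp
next
  case (left_inv x y)
  note c = nielsen_closed[OF left_inv(1) left_inv.prems]
  have "nielsen (inv y \<otimes> x) y (y \<otimes> (inv y \<otimes> x)) y" by (intro nielsen.intros)
  then show ?case using nielsen_trans[OF left_inv.IH[OF left_inv.prems]] c by simp
qed

lemma nielsen_commutator:
  assumes "nielsen a b x y" "a \<in> carrier G" "b \<in> carrier G"
  shows "commutator G x y = commutator G a b"
  using assms
proof induction
  case refl show ?case by simp
next
  case (right x y)
  then show ?case using nielsen_closed[OF right(1) right.prems]
    by (simp add: commutator_def m_assoc inv_mult_group)
next
  case (right_inv x y)
  then show ?case using nielsen_closed[OF right_inv(1) right_inv.prems]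
    by (simp add: commutator_def m_assoc inv_mult_group)
next
  case (left x y)
  then show ?case using nielsen_closed[OF left(1) left.prems]
    by (simp add: commutator_def m_assoc inv_mult_group)
next
  case (left_inv x y)
  then show ?case using nielsen_closed[OF left_inv(1) left_inv.prems]
    by (simp add: commutator_def m_assoc inv_mult_group)
qed

lemma nielsen_conj:
  assumes "nielsen a b x y" "a \<in> carrier G" "b \<in> carrier G" "c \<in> carrier G"
  shows "nielsen (conj_by c a) (conj_by c b) (conj_by c x) (conj_by c y)"
  using assms
proof induction
  case refl show ?case by (rule nielsen.refl)
next
  case (right x y)
  then show ?case using nielsen_closed[OF right(1) right.prems(1,2)]
    by (auto simp: conj_by_mult conj_by_inv intro: nielsen.intros)
next
  case (right_inv x y)
  then show ?case using nielsen_closed[OF right_inv(1) right_inv.prems(1,2)]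
    by (auto simp: conj_by_mult conj_by_inv intro: nielsen.intros)
next
  case (left x y)
  then show ?case using nielsen_closed[OF left(1) left.prems(1,2)]
    by (auto simp: conj_by_mult conj_by_inv intro: nielsen.intros)
next
  case (left_inv x y)
  then show ?case using nielsen_closed[OF left_inv(1) left_inv.prems(1,2)]
    by (auto simp: conj_by_mult conj_by_inv intro: nielsen.intros)
qed

text \<open>Three moves, through (y x, y) and (y x, x^-1). Modulo conjugation this is (x, y) -> (y,
  x^-1), a lift of the matrix of order four in SL_2(Z) and a quarter turn of the cyclic word x^-1
  y^-1 x y.\<close>

lemma nielsen_rotate:
  assumes "x \<in> carrier G" "y \<in> carrier G"
  shows "nielsen x y (inv x \<otimes> y \<otimes> x) (inv x)"
proof -
  have "nielsen x y (y \<otimes> x) (inv (y \<otimes> x) \<otimes> y)" by (intro nielsen.intros)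
  then have "nielsen x y (y \<otimes> x) (inv x)" using assms by (simp add: inv_mult_group m_assoc)
  then have "nielsen x y (inv x \<otimes> (y \<otimes> x)) (inv x)" by (rule nielsen.left)
  then show ?thesis using assms by (simp add: m_assoc)
qed

text \<open>Conjugation by the commutator arises by applying \<open>nielsen_rotate\<close> four times.\<close>

lemma nielsen_conj_commutator:
  assumes "x \<in> carrier G" "y \<in> carrier G"
  shows "nielsen x y (conj_by (commutator G x y) x) (conj_by (commutator G x y) y)"
proof -
  \<comment> \<open>Half a turn inverts both entries up to conjugation by a^-1 b^-1. Doing it twice
    composes the two conjugators to the commutator.\<close>
  have 2: "nielsen a b (conj_by (inv a \<otimes> inv b) (inv a)) (conj_by (inv a \<otimes> inv b) (inv b))"
    if "a \<in> carrier G" "b \<in> carrier G" for a b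
    using nielsen_trans[OF nielsen_rotate[of "inv a \<otimes> b \<otimes> a" "inv a"] nielsen_rotate[of a b]] that
    by (simp add: conj_by_def inv_mult_group m_assoc)
  let ?c = "inv x \<otimes> inv y"
  have "nielsen x y (conj_by ?c (inv x)) (conj_by ?c (inv y))" using 2 assms by blast
  from nielsen_trans[OF 2 this] assms show ?thesis
    by (simp add: conj_by_def commutator_def inv_mult_group m_assoc)
qed

section \<open>Moves up to simultaneous conjugation\<close>

definition nielsen_conj_rel :: "'a \<Rightarrow> 'a \<Rightarrow> 'a \<Rightarrow> 'a \<Rightarrow> bool" where
  "nielsen_conj_rel a b x y \<longleftrightarrow>
     x \<in> carrier G \<and> y \<in> carrier G \<and> (\<exists>c\<in>carrier G. nielsen a b (conj_by c x) (conj_by c y))"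

lemma nielsen_conj_relI:
  "a \<in> carrier G \<Longrightarrow> b \<in> carrier G \<Longrightarrow> nielsen a b x y \<Longrightarrow> nielsen_conj_rel a b x y"
  unfolding nielsen_conj_rel_def using nielsen_closed[of a b x y] by (metis conj_by_one one_closed)

lemma nielsen_conj_rel_conj:
  assumes "a \<in> carrier G" "b \<in> carrier G" "c \<in> carrier G"
  shows "nielsen_conj_rel a b (conj_by c a) (conj_by c b)"
proof -
  have "conj_by (inv c) (conj_by c a) = a" "conj_by (inv c) (conj_by c b) = b"
    using assms by (simp_all add: conj_by_conj)
  then show ?thesis unfolding nielsen_conj_rel_def using assms
    by (metis conj_by_closed inv_closed nielsen.refl)
qed

lemma nielsen_conj_rel_trans:
  assumes "nielsen_conj_rel a b x y" "nielsen_conj_rel x y z w" "a \<in> carrier G" "b \<in> carrier G"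
  shows "nielsen_conj_rel a b z w"
proof -
  obtain c d where cd: "c \<in> carrier G" "d \<in> carrier G" "x \<in> carrier G" "y \<in> carrier G"
    "z \<in> carrier G" "w \<in> carrier G" "nielsen a b (conj_by c x) (conj_by c y)" "nielsen x y (conj_by d z) (conj_by d w)"
    using assms(1,2) by (auto simp: nielsen_conj_rel_def)
  have "nielsen a b (conj_by (c \<otimes> d) z) (conj_by (c \<otimes> d) w)"
    using nielsen_trans[OF nielsen_conj[OF cd(8,3,4,1)] cd(7)] cd by (simp add: conj_by_conj)
  then show ?thesis unfolding nielsen_conj_rel_def using cd by blast
qed

lemma nielsen_conj_rel_commutator:
  assumes "nielsen_conj_rel a b x y" "a \<in> carrier G" "b \<in> carrier G"
  obtains c where "c \<in> carrier G" "commutator G a b = conj_by c (commutator G x y)"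
proof -
  obtain c where c: "c \<in> carrier G" "nielsen a b (conj_by c x) (conj_by c y)"
    "x \<in> carrier G" "y \<in> carrier G"
    using assms(1) by (auto simp: nielsen_conj_rel_def)
  then show ?thesis using that[of c] nielsen_commutator[OF c(2) assms(2,3)]
    by (simp add: conj_by_commutator)
qed

text \<open>These quarter turns bring any of the four corners of the cyclic word x^-1 y^-1 x y to
  the one place that \<open>minimal_junction\<close> treats.\<close>

lemma nielsen_conj_rel_rotate:
  assumes "x \<in> carrier G" "y \<in> carrier G"
  shows "nielsen_conj_rel x y y (inv x)"
proof -
  have "conj_by (inv x) y = inv x \<otimes> y \<otimes> x" "conj_by (inv x) (inv x) = inv x"
    using assms by (simp_all add: conj_by_def m_assoc)
  then show ?thesis unfolding nielsen_conj_rel_def using nielsen_rotate[OF assms] assms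
    by (metis inv_closed)
qed

lemma nielsen_conj_rel_invs:
  assumes "x \<in> carrier G" "y \<in> carrier G"
  shows "nielsen_conj_rel x y (inv x) (inv y)"
  using nielsen_conj_rel_trans[OF nielsen_conj_rel_rotate nielsen_conj_rel_rotate] assms by blast

lemma nielsen_conj_rel_rotate_inv:
  assumes "x \<in> carrier G" "y \<in> carrier G"
  shows "nielsen_conj_rel x y (inv y) x"
  using nielsen_conj_rel_trans[OF nielsen_conj_rel_invs nielsen_conj_rel_rotate] assms by fastforce

lemma nielsen_right_int_pow:
  assumes "x \<in> carrier G" "y \<in> carrier G"
  shows "nielsen x y x (x [^] (k::int) \<otimes> y)"
proof -
  have pos: "nielsen x y x (x [^] (j::nat) \<otimes> y)" for j
  proof (induction j)
    case 0 then show ?case using assms by (auto intro: nielsen.refl)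
  next
    case (Suc j)
    then have "nielsen x y x (x \<otimes> (x [^] j \<otimes> y))" by (rule nielsen.right)
    moreover have "x \<otimes> (x [^] j \<otimes> y) = x [^] Suc j \<otimes> y"
      using assms nat_pow_Suc2[of "x" j] by (simp add: m_assoc)
    ultimately show ?case by simp
  qed
  have neg: "nielsen x y x (inv x [^] (j::nat) \<otimes> y)" for j
  proof (induction j)
    case 0 then show ?case using assms by (auto intro: nielsen.refl)
  next
    case (Suc j)
    then have "nielsen x y x (inv x \<otimes> (inv x [^] j \<otimes> y))" by (rule nielsen.right_inv)
    moreover have "inv x \<otimes> (inv x [^] j \<otimes> y) = inv x [^] Suc j \<otimes> y"
      using assms nat_pow_Suc2[of "inv x" j] by (simp add: m_assoc)
    ultimately show ?case by simp
  qed
  show ?thesis using pos neg assms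
    by (cases k rule: int_cases2) (auto simp: int_pow_int int_pow_neg_int nat_pow_inv)
qed

lemma commute_inv:
  assumes "z \<otimes> u = u \<otimes> z" "z \<in> carrier G" "u \<in> carrier G"
  shows "inv z \<otimes> u = u \<otimes> inv z"
  using assms by (metis inv_closed inv_mult_cancel(1,2) m_assoc m_closed r_inv r_one)

lemma commutator_mult_right:
  assumes "z \<otimes> u = u \<otimes> z" "z \<in> carrier G" "u \<in> carrier G" "v \<in> carrier G"
  shows "commutator G u (z \<otimes> v) = commutator G u v"
proof -
  have "inv z \<otimes> (u \<otimes> z) = u" using assms by (metis inv_mult_cancel(1))
  then have "inv z \<otimes> (u \<otimes> (z \<otimes> v)) = u \<otimes> v" using assms(2-4) by (metis inv_closed m_assoc m_closed)
  then show ?thesis using assms(2-4) by (simp add: commutator_def inv_mult_group m_assoc)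
qed

lemma inv_commutator:
  "u \<in> carrier G \<Longrightarrow> v \<in> carrier G \<Longrightarrow> inv (commutator G u v) = commutator G v u"
  by (simp add: commutator_def inv_mult_group m_assoc)

lemma commutator_mult_left:
  assumes "z \<otimes> v = v \<otimes> z" "z \<in> carrier G" "u \<in> carrier G" "v \<in> carrier G"
  shows "commutator G (z \<otimes> u) v = commutator G u v"
  using commutator_mult_right[OF assms(1,2,4,3)] assms inv_commutator[of v "z \<otimes> u"]
    inv_commutator[of v u] by simp

lemma nielsen_left_int_pow:
  assumes "x \<in> carrier G" "y \<in> carrier G"
  shows "nielsen x y (y [^] (k::int) \<otimes> x) y"
proof -
  have pos: "nielsen x y (y [^] (j::nat) \<otimes> x) y" for j
  proof (induction j)
    case 0 then show ?case using assms by (auto intro: nielsen.refl)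
  next
    case (Suc j)
    then have "nielsen x y (y \<otimes> (y [^] j \<otimes> x)) y" by (rule nielsen.left)
    moreover have "y \<otimes> (y [^] j \<otimes> x) = y [^] Suc j \<otimes> x"
      using assms nat_pow_Suc2[of y j] by (simp add: m_assoc)
    ultimately show ?case by simp
  qed
  have neg: "nielsen x y (inv y [^] (j::nat) \<otimes> x) y" for j
  proof (induction j)
    case 0 then show ?case using assms by (auto intro: nielsen.refl)
  next
    case (Suc j)
    then have "nielsen x y (inv y \<otimes> (inv y [^] j \<otimes> x)) y" by (rule nielsen.left_inv)
    moreover have "inv y \<otimes> (inv y [^] j \<otimes> x) = inv y [^] Suc j \<otimes> x"
      using assms nat_pow_Suc2[of "inv y" j] by (simp add: m_assoc)
    ultimately show ?case by simp
  qed
  show ?thesis using pos neg assms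
    by (cases k rule: int_cases2) (auto simp: int_pow_int int_pow_neg_int nat_pow_inv)
qed

lemma nielsen_conj_commutator_int_pow:
  assumes xy: "x \<in> carrier G" "y \<in> carrier G"
  shows "nielsen x y (conj_by (commutator G x y [^] (k::int)) x) (conj_by (commutator G x y [^] k) y)"
proof -
  let ?T = "commutator G x y"
  have T: "?T \<in> carrier G" using xy by simp
  have pos: "nielsen x y (conj_by (?T [^] (j::nat)) x) (conj_by (?T [^] j) y)" for j
  proof (induction j)
    case 0 then show ?case using xy by (auto intro: nielsen.refl)
  next
    case (Suc j)
    let ?x = "conj_by (?T [^] j) x" and ?y = "conj_by (?T [^] j) y"
    \<comment> \<open>The moves made so far keep the commutator equal to \<open>?T\<close>, so one
      more round conjugates by the same element.\<close>
    have "nielsen ?x ?y (conj_by ?T ?x) (conj_by ?T ?y)"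
      using nielsen_conj_commutator[of ?x ?y] nielsen_commutator[OF Suc xy] T xy by simp
    then have "nielsen x y (conj_by ?T ?x) (conj_by ?T ?y)" using nielsen_trans Suc by blast
    then show ?case using T xy nat_pow_Suc2[of ?T j] by (simp add: conj_by_conj del: nat_pow_Suc)
  qed
  \<comment> \<open>For negative exponents the positive chain is conjugated by the inverse power and
    then reversed.\<close>
  have neg: "nielsen x y (conj_by (inv (?T [^] (j::nat))) x) (conj_by (inv (?T [^] j)) y)" for j
  proof -
    let ?c = "inv (?T [^] j)"
    have "nielsen (conj_by ?c x) (conj_by ?c y)
        (conj_by ?c (conj_by (?T [^] j) x)) (conj_by ?c (conj_by (?T [^] j) y))"
      using nielsen_conj[OF pos xy, of ?c] T by simp
    then have "nielsen (conj_by ?c x) (conj_by ?c y) x y" using T xy by (simp add: conj_by_conj)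
    from nielsen_sym[OF this] show ?thesis using T xy by simp
  qed
  show ?thesis using pos neg T
    by (cases k rule: int_cases2) (auto simp: int_pow_int int_pow_neg_int)
qed

text \<open>Removes the conjugation that the descent introduces. The chain realizing conjugation by
  a power of \<open>T\<close> starts at (p, q), so (p, q) must have commutator exactly
  \<open>T\<close>, not just a conjugate of it.\<close>

lemma nielsen_of_conj_rel:
  assumes "nielsen_conj_rel x y p q" "x \<in> carrier G" "y \<in> carrier G"
    and T: "commutator G x y = T" "commutator G p q = T"
    and cent: "\<And>c. c \<in> carrier G \<Longrightarrow> conj_by c T = T \<Longrightarrow> \<exists>k::int. c = T [^] k"
  shows "nielsen x y p q"
proof -
  obtain c where c: "c \<in> carrier G" "nielsen x y (conj_by c p) (conj_by c q)"
    and pq: "p \<in> carrier G" "q \<in> carrier G"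
    using assms(1) by (auto simp: nielsen_conj_rel_def)
  have "conj_by c T = T"
    using nielsen_commutator[OF c(2) assms(2,3)] T c pq by (simp flip: conj_by_commutator)
  then obtain k :: int where k: "c = T [^] k" using cent c by blast
  have "nielsen (conj_by c p) (conj_by c q) p q"
    using nielsen_sym[OF nielsen_conj_commutator_int_pow[OF pq] pq] T k by simp
  then show ?thesis using nielsen_trans c(2) by blast
qed

end

section \<open>Rotations of words\<close>

lemma (in group) int_pow_mult_self:
  "a \<in> carrier G \<Longrightarrow> a \<otimes> a [^] (k::int) = a [^] (k + 1)"
  "a \<in> carrier G \<Longrightarrow> a [^] (k::int) \<otimes> a = a [^] (k + 1)"
  using int_pow_mult[of a 1 k] int_pow_mult[of a k 1] by (simp_all add: add.commute)

lemma (in group) mult_swap: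
  assumes "a \<otimes> b = c \<otimes> a"
    and "a \<in> carrier G" "b \<in> carrier G" "c \<in> carrier G" "d \<in> carrier G"
  shows "a \<otimes> (b \<otimes> d) = c \<otimes> (a \<otimes> d)"
  using assms by (metis m_assoc)

lemma (in group) conj_by_int_pow:
  assumes "c \<in> carrier G" "g \<in> carrier G"
  shows "conj_by c (g [^] (k::int)) = conj_by c g [^] k"
proof -
  have "conj_by c \<in> hom G G" using assms by (auto simp: hom_def conj_by_mult)
  then interpret group_hom G G "conj_by c" by unfold_locales
  show ?thesis using hom_int_pow assms by blast
qed

text \<open>
  Every element that conjugates the value of a cyclically reduced word \<open>w\<close> into that of another
  such word \<open>w'\<close> is a power of the value of \<open>w\<close> followed by a prefix of \<open>w\<close>.
\<close>

definition shifts :: "('a, 'b) monoid_scheme \<Rightarrow> ('l \<Rightarrow> 'a) \<Rightarrow> 'l list \<Rightarrow> 'a \<Rightarrow> 'l list \<Rightarrow> bool" where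
  "shifts G e w h w' \<longleftrightarrow> (\<exists>(k::int) i. i < length w \<and> w' = rotate i w \<and>
     h = list_prod G (map e w) [^]\<^bsub>G\<^esub> k \<otimes>\<^bsub>G\<^esub> list_prod G (map e (take i w)))"

context group
begin

lemma shifts_one:
  assumes "w \<noteq> []" "e ` set w \<subseteq> carrier G"
  shows "shifts G e w \<one> w"
  unfolding shifts_def using assms by (intro exI[of _ 0] exI[of _ 0]) auto

text \<open>The case of a conjugator that begins with the first letter of the word: conjugation by
  \<open>e p\<close> carries the value of \<open>w @ [p]\<close> to that of \<open>p # w\<close>, so
  \<open>e p\<close> passes through the power and lengthens the prefix.\<close>

lemma shifts_fwd:
  assumes "shifts G e (w @ [p]) h w'" "e ` set w \<subseteq> carrier G" "e p \<in> carrier G"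
  shows "shifts G e (p # w) (e p \<otimes> h) w'"
proof -
  obtain k :: int and i where ki: "i < length (w @ [p])" "w' = rotate i (w @ [p])"
    "h = list_prod G (map e (w @ [p])) [^] k \<otimes> list_prod G (map e (take i (w @ [p])))"
    using assms(1) by (auto simp: shifts_def)
  let ?E = "\<lambda>w. list_prod G (map e w)"
  have cl: "?E v \<in> carrier G" if "set v \<subseteq> insert p (set w)" for v
    using assms that by (intro list_prod_closed) auto
  have wp: "list_prod G (map e w @ [e p]) = list_prod G (map e w) \<otimes> e p"
    using assms by (subst list_prod_append) auto
  have c: "e p \<otimes> ?E (w @ [p]) [^] k = ?E (p # w) [^] k \<otimes> e p"
  proof -
    have "conj_by (e p) (?E (w @ [p])) = ?E (p # w)"
      using assms cl[of w] by (simp add: wp conj_by_def m_assoc)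
    then have "conj_by (e p) (?E (w @ [p]) [^] k) = ?E (p # w) [^] k"
      using conj_by_int_pow assms cl[of "w @ [p]"] by simp
    then show ?thesis using assms cl[of "w @ [p]"] cl[of "p # w"] 
      by (simp add: conj_by_def inv_solve_right')
  qed
  have t: "set (take i (w @ [p])) \<subseteq> insert p (set w)" using set_take_subset[of i "w @ [p]"] by auto
  have "e p \<otimes> h = ?E (p # w) [^] k \<otimes> (e p \<otimes> ?E (take i (w @ [p])))"
    unfolding ki(3) using cl[of "w @ [p]"] cl[of "p # w"] cl[OF t] assms(3)
    by (intro mult_swap[OF c]) auto
  then have h: "e p \<otimes> h = ?E (p # w) [^] k \<otimes> ?E (p # take i (w @ [p]))" by simp
  show ?thesis
  proof (cases "i < length w")
    case True
    then have "p # take i (w @ [p]) = take (Suc i) (p # w)" by simp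
    moreover have "w' = rotate (Suc i) (p # w)"
      using ki(2) by (simp add: rotate1_rotate_swap)
    ultimately show ?thesis unfolding shifts_def using True h
      by (intro exI[of _ k] exI[of _ "Suc i"]) auto
  next
    case False
    \<comment> \<open>The lengthened prefix is now the whole word. Since \<open>shifts\<close>
      demands a proper prefix, it is absorbed into the power as exponent
      \<open>k + 1\<close>.\<close>
    then have i: "i = length w" using ki(1) by simp
    then have "p # take i (w @ [p]) = p # w" by simp
    then have "e p \<otimes> h = ?E (p # w) [^] (k + 1)"
      using h cl[of "p # w"] int_pow_mult_self(2)[of "?E (p # w)" k] by auto
    moreover have "w' = p # w" using ki(2) i rotate_append[of w "[p]"] by simp
    ultimately show ?thesis unfolding shifts_def using cl[of "p # w"]
      by (intro exI[of _ "k + 1"] exI[of _ 0]) simp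
  qed
qed

text \<open>The case of a conjugator that begins by undoing the last letter \<open>p\<close> of
  \<open>w @ [p]\<close>: the prefix loses its first letter.\<close>

lemma shifts_bwd:
  assumes "shifts G e (p # w) h w'" "e ` set w \<subseteq> carrier G" "e p \<in> carrier G"
  shows "shifts G e (w @ [p]) (inv (e p) \<otimes> h) w'"
proof -
  obtain k :: int and i where ki: "i < length (p # w)" "w' = rotate i (p # w)"
    "h = list_prod G (map e (p # w)) [^] k \<otimes> list_prod G (map e (take i (p # w)))"
    using assms(1) by (auto simp: shifts_def)
  let ?E = "\<lambda>w. list_prod G (map e w)"
  have cl: "?E v \<in> carrier G" if "set v \<subseteq> insert p (set w)" for v
    using assms that by (intro list_prod_closed) auto
  have wp: "list_prod G (map e w @ [e p]) = list_prod G (map e w) \<otimes> e p"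
    using assms by (subst list_prod_append) auto
  have c: "inv (e p) \<otimes> ?E (p # w) [^] k = ?E (w @ [p]) [^] k \<otimes> inv (e p)"
  proof -
    have "conj_by (inv (e p)) (?E (p # w)) = ?E (w @ [p])"
      using assms cl[of w] by (simp add: wp conj_by_def m_assoc)
    then have "conj_by (inv (e p)) (?E (p # w) [^] k) = ?E (w @ [p]) [^] k"
      using conj_by_int_pow[of "inv (e p)" "?E (p # w)" k] assms cl[of "p # w"] by simp
    then show ?thesis using assms cl[of "w @ [p]"] cl[of "p # w"] 
      by (simp add: conj_by_def inv_solve_right)
  qed
  have t: "set (take i (p # w)) \<subseteq> insert p (set w)" using set_take_subset[of i "p # w"] by auto
  have h: "inv (e p) \<otimes> h = ?E (w @ [p]) [^] k \<otimes> (inv (e p) \<otimes> ?E (take i (p # w)))"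
    unfolding ki(3) using cl[of "w @ [p]"] cl[of "p # w"] cl[OF t] assms(3)
    by (intro mult_swap[OF c]) auto
  show ?thesis
  proof (cases i)
    case (Suc j)
    have "set (take j w) \<subseteq> insert p (set w)" using set_take_subset[of j w] by auto
    then have "inv (e p) \<otimes> ?E (take i (p # w)) = ?E (take j (w @ [p]))"
      using Suc ki(1) cl assms by simp
    moreover have "w' = rotate j (w @ [p])" using ki(2) Suc by (simp add: rotate1_rotate_swap)
    ultimately show ?thesis unfolding shifts_def using Suc h ki(1)
      by (intro exI[of _ k] exI[of _ j]) auto
  next
    case 0
    \<comment> \<open>The empty prefix has no letter to lose. One full turn is borrowed from the
      power, and removing \<open>p\<close> from it leaves the prefix \<open>w\<close>.\<close>
    have "?E (w @ [p]) [^] k = ?E (w @ [p]) [^] (k - 1) \<otimes> ?E (w @ [p])"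
      using cl[of "w @ [p]"] int_pow_mult_self(2)[of "?E (w @ [p])" "k - 1"] by auto
    then have "inv (e p) \<otimes> h = ?E (w @ [p]) [^] (k - 1) \<otimes> ?E w"
      using h 0 cl[of w] cl[of "w @ [p]"] assms by (auto simp: wp m_assoc)
    moreover have "w' = rotate (length w) (w @ [p])" using ki(2) 0 rotate_append[of w "[p]"] by simp
    ultimately show ?thesis unfolding shifts_def
      by (intro exI[of _ "k - 1"] exI[of _ "length w"]) auto
  qed
qed

end

section \<open>Centralizers in free groups\<close>

lemma rotate_mult_fixed: "rotate r w = w \<Longrightarrow> rotate (r * q) w = w"
  by (induction q) (simp_all flip: rotate_rotate)

text \<open>The Euclidean step for rotations fixing a word; by it the least positive one divides all
  of them.\<close>

lemma rotate_mod_fixed: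
  assumes "rotate r w = w" "rotate i w = w"
  shows "rotate (i mod r) w = w"
proof -
  have "rotate (i mod r) w = rotate (i mod r) (rotate (r * (i div r)) w)"
    using rotate_mult_fixed[OF assms(1)] by simp
  also have "\<dots> = rotate i w" by (simp add: rotate_rotate)
  finally show ?thesis using assms(2) by simp
qed

text \<open>A word fixed by rotating \<open>r\<close> letters starts over after its first
  \<open>r\<close> letters. Iterating this splits prefixes into equal blocks.\<close>

lemma take_add_fixed:
  assumes "rotate r w = w" "r + i \<le> length w"
  shows "take (r + i) w = take r w @ take i w"
proof -
  have "drop r w @ take r w = w"
  proof (cases "r < length w")
    case True then show ?thesis using assms(1) by (simp add: rotate_drop_take)
  next
    case False then show ?thesis using assms(2) by simp
  qed
  then have "take i w = take i (drop r w @ take r w)" by simp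
  also have "\<dots> = take i (drop r w)" using assms(2) by simp
  finally show ?thesis by (simp add: take_add)
qed

definition flip :: "'a \<times> bool \<Rightarrow> 'a \<times> bool" where
  "flip p = (fst p, \<not> snd p)"

lemma flip_flip [simp]: "flip (flip p) = p"
  by (simp add: flip_def)

lemma flip_neq [simp]: "flip p \<noteq> p" "p \<noteq> flip p"
  by (auto simp: flip_def prod_eq_iff)

lemma fst_flip [simp]: "fst (flip p) = fst p"
  by (simp add: flip_def)

lemma flip_eq_iff: "flip p = q \<longleftrightarrow> p = flip q"
  by auto

definition word_inv :: "('a \<times> bool) list \<Rightarrow> ('a \<times> bool) list" where
  "word_inv w = rev (map flip w)"

lemma word_inv_simps [simp]:
  "word_inv [] = []" "word_inv (p # w) = word_inv w @ [flip p]"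
  "word_inv w = [] \<longleftrightarrow> w = []"
  by (simp_all add: word_inv_def)

lemma word_inv_ends [simp]:
  "w \<noteq> [] \<Longrightarrow> last (word_inv w) = flip (hd w)" "w \<noteq> [] \<Longrightarrow> hd (word_inv w) = flip (last w)"
  by (simp_all add: word_inv_def last_rev hd_rev hd_map last_map)

lemma freely_reduced_alt: "freely_reduced w \<longleftrightarrow> successively (\<lambda>p q. q \<noteq> flip p) w"
proof -
  have "(\<lambda>p q :: 'a \<times> bool. \<not> (fst p = fst q \<and> snd p \<noteq> snd q)) = (\<lambda>p q. q \<noteq> flip p)"
    by (auto simp: fun_eq_iff flip_def)
  then show ?thesis by (simp only: freely_reduced_def)
qed

lemma freely_reduced_append:
  "freely_reduced (v @ w) \<longleftrightarrow> freely_reduced v \<and> freely_reduced w \<and>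
     (v = [] \<or> w = [] \<or> hd w \<noteq> flip (last v))"
  by (auto simp: freely_reduced_alt successively_append_iff)

lemma freely_reduced_Cons:
  "freely_reduced (p # w) \<longleftrightarrow> freely_reduced w \<and> (w = [] \<or> hd w \<noteq> flip p)"
  by (auto simp: freely_reduced_alt successively_Cons)

lemma freely_reduced_word_inv [simp]: "freely_reduced (word_inv w) = freely_reduced w"
proof -
  have *: "(\<lambda>p q :: 'a \<times> bool. flip p \<noteq> q) = (\<lambda>p q. q \<noteq> flip p)" by auto
  show ?thesis
    by (simp add: freely_reduced_alt word_inv_def successively_rev successively_map flip_eq_iff)
       (metis (mono_tags, lifting) flip_flip successively_mono)
qed

lemma freely_reduced_Nil [simp]: "freely_reduced []"
  by (simp add: freely_reduced_def)

definition cyclically_reduced :: "('a \<times> bool) list \<Rightarrow> bool" where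
  "cyclically_reduced w \<longleftrightarrow> w \<noteq> [] \<and> freely_reduced w \<and> hd w \<noteq> flip (last w)"

locale free_group_on = group G for G :: "('a, 'b) monoid_scheme" (structure) +
  fixes S :: "'a set"
  assumes basis: "free_basis G S"
begin

lemma S_carrier: "S \<subseteq> carrier G"
  using basis by (simp add: free_basis_def)

definition ev :: "('a \<times> bool) list \<Rightarrow> 'a" where
  "ev w = list_prod G (map (letter G) w)"

lemma ev_simps [simp]: "ev [] = \<one>" "ev (p # w) = letter G p \<otimes> ev w"
  by (simp_all add: ev_def)

definition red :: "('a \<times> bool) list \<Rightarrow> bool" where
  "red w \<longleftrightarrow> fst ` set w \<subseteq> S \<and> freely_reduced w"

lemma letter_closed [simp]: "fst p \<in> S \<Longrightarrow> letter G p \<in> carrier G"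
  using S_carrier by (auto simp: letter_def)

lemma letter_flip [simp]: "fst p \<in> S \<Longrightarrow> letter G (flip p) = inv (letter G p)"
  using S_carrier by (auto simp: letter_def flip_def)

lemma letters_closed: "fst ` set w \<subseteq> S \<Longrightarrow> letter G ` set w \<subseteq> carrier G"
  by auto

lemma ev_closed [simp]: "fst ` set w \<subseteq> S \<Longrightarrow> ev w \<in> carrier G"
  unfolding ev_def by (intro list_prod_closed) auto

lemma ev_append [simp]:
  "fst ` set v \<subseteq> S \<Longrightarrow> fst ` set w \<subseteq> S \<Longrightarrow>
     ev (v @ w) = ev v \<otimes> ev w"
  unfolding ev_def map_append by (intro list_prod_append) auto

lemma fst_word_inv [simp]: "fst ` set (word_inv w) = fst ` set w"
  by (simp add: word_inv_def image_image)

lemma ev_word_inv [simp]: "fst ` set w \<subseteq> S \<Longrightarrow> ev (word_inv w) = inv (ev w)"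
proof (induction w)
  case (Cons p w)
  then show ?case by (simp add: inv_mult_group)
qed simp

lemma ev_neq_one: "red w \<Longrightarrow> w \<noteq> [] \<Longrightarrow> ev w \<noteq> \<one>"
  using basis by (auto simp: free_basis_def red_def ev_def)

text \<open>Uniqueness follows from the defining condition: at the first disagreement, the inverse
  of one word followed by the other is reduced, nonempty and of value one.\<close>

lemma ev_inj: "red v \<Longrightarrow> red w \<Longrightarrow> ev v = ev w \<Longrightarrow> v = w"
proof (induction v arbitrary: w)
  case Nil
  then show ?case using ev_neq_one[of w] by auto
next
  case (Cons p v)
  show ?case
  proof (cases w)
    case Nil then show ?thesis using ev_neq_one[of "p # v"] Cons.prems by auto
  next
    case (Cons q w')
    have c: "fst ` set (p # v) \<subseteq> S" "fst ` set (q # w') \<subseteq> S"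
      using Cons.prems local.Cons by (auto simp: red_def)
    show ?thesis
    proof (cases "p = q")
      case True
      then have "ev v = ev w'" using Cons.prems(3) local.Cons c by simp
      then show ?thesis using Cons.IH[of w'] Cons.prems True local.Cons
        by (auto simp: red_def freely_reduced_Cons)
    next
      case False
      have "red (word_inv w @ p # v)"
        using Cons.prems local.Cons False c fst_word_inv[of w]
        by (auto simp: red_def freely_reduced_append freely_reduced_Cons image_Un simp del: word_inv_simps(2) fst_word_inv)
      moreover have "ev (word_inv w @ p # v) = \<one>"
        using Cons.prems(3) local.Cons c ev_append[of "word_inv w" "p # v"] ev_closed[of w]
        by (simp del: word_inv_simps)
      ultimately show ?thesis using ev_neq_one by blast
    qed
  qed
qed

lemma red_word_exists:
  assumes "g \<in> carrier G"
  shows "\<exists>w. red w \<and> ev w = g"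
proof -
  have step: "\<exists>w'. red w' \<and> ev w' = letter G p \<otimes> ev w" if "fst p \<in> S" "red w" for p w
  proof (cases "w \<noteq> [] \<and> hd w = flip p")
    case True
    then obtain w' where "w = flip p # w'" by (cases w) auto
    then show ?thesis using that by (intro exI[of _ w']) (auto simp: red_def freely_reduced_Cons)
  next
    case False
    then show ?thesis using that
      by (intro exI[of _ "p # w"]) (auto simp: red_def freely_reduced_Cons)
  qed
  have mult: "\<exists>w'. red w' \<and> ev w' = ev v \<otimes> ev w" if "red w" "fst ` set v \<subseteq> S" for v w
    using that(2)
  proof (induction v)
    case Nil then show ?case using that(1) by (intro exI[of _ w]) (auto simp: red_def)
  next
    case (Cons p v)
    then obtain w' where "red w'" "ev w' = ev v \<otimes> ev w" by auto
    then show ?case using step[of p w'] Cons.prems that(1) by (auto simp: m_assoc red_def)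
  qed
  have "g \<in> generate G S" using assms basis by (simp add: free_basis_def)
  then show ?thesis
  proof induction
    case one show ?case by (intro exI[of _ "[]"]) (simp add: red_def freely_reduced_def)
  next
    case (incl h)
    then show ?case using S_carrier
      by (intro exI[of _ "[(h, True)]"]) (auto simp: red_def freely_reduced_def letter_def)
  next
    case (inv h)
    then show ?case using S_carrier
      by (intro exI[of _ "[(h, False)]"]) (auto simp: red_def freely_reduced_def letter_def)
  next
    case (eng g h)
    then show ?case using mult by (metis red_def)
  qed
qed

text \<open>Induction on the conjugator. If its first letter cancels against an end of
  \<open>w\<close>, then \<open>w\<close> is rotated by one letter and the conjugator shortened. If
  it cancels at neither end, v^-1 w v is reduced as it stands, begins with the inverse of its last
  letter, and so cannot be the cyclically reduced \<open>w'\<close>.\<close>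

lemma conj_cyclically_reduced:
  assumes "red w" "cyclically_reduced w" "red w'" "cyclically_reduced w'" "red v"
    and "ev w \<otimes> ev v = ev v \<otimes> ev w'"
  shows "shifts G (letter G) w (ev v) w'"
  using assms(1,2,5,6)
proof (induction v arbitrary: w)
  case Nil
  then have "w = w'" using ev_inj[of w w'] assms(3) by (auto simp: red_def)
  then show ?case using shifts_one[of w "letter G"] assms(3,4) letters_closed[of w']
    by (auto simp: red_def cyclically_reduced_def)
next
  case (Cons p v)
  have c: "fst p \<in> S" "fst ` set v \<subseteq> S" "fst ` set w \<subseteq> S" "red v" "fst ` set w' \<subseteq> S"
    using Cons.prems assms(3) by (auto simp: red_def freely_reduced_Cons)
  have cyc: "w \<noteq> []" "freely_reduced w" "hd w \<noteq> flip (last w)"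
    using Cons.prems(2) by (auto simp: cyclically_reduced_def)
  have eq: "ev w \<otimes> (letter G p \<otimes> ev v) = letter G p \<otimes> (ev v \<otimes> ev w')"
    using Cons.prems(4) c by (simp add: m_assoc)
  consider "p = hd w" | "p = flip (last w)" | "p \<noteq> hd w" "p \<noteq> flip (last w)" by blast
  then show ?case
  proof cases
    case 1
    then obtain u where w: "w = p # u" using cyc by (cases w) auto
    have u: "fst ` set u \<subseteq> S" using c w by auto
    have "red (u @ [p])" "cyclically_reduced (u @ [p])"
      using c cyc w by (auto simp: red_def cyclically_reduced_def freely_reduced_append
          freely_reduced_Cons flip_eq_iff hd_append split: if_splits)
    moreover have "ev (u @ [p]) \<otimes> ev v = ev v \<otimes> ev w'"
      using eq c u w by (simp add: m_assoc)
    ultimately have "shifts G (letter G) (u @ [p]) (ev v) w'" using Cons.IH c by blast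
    then show ?thesis using shifts_fwd[OF _ letters_closed[OF u]] w c by simp
  next
    case 2
    then obtain u where w: "w = u @ [flip p]" using cyc 2 by (metis append_butlast_last_id flip_flip)
    have u: "fst ` set u \<subseteq> S" using c w by auto
    have wp: "ev w = ev u \<otimes> inv (letter G p)"
      using u c w by simp
    have "red (flip p # u)" "cyclically_reduced (flip p # u)"
      using c cyc w by (auto simp: red_def cyclically_reduced_def freely_reduced_append
          freely_reduced_Cons flip_eq_iff hd_append split: if_splits)
    moreover have "ev (flip p # u) \<otimes> ev v = ev v \<otimes> ev w'"
    proof -
      have "ev u \<otimes> ev v = letter G p \<otimes> (ev v \<otimes> ev w')"
        using eq u c by (simp add: wp m_assoc)
      then show ?thesis using u c by (simp add: m_assoc)
    qed
    ultimately have "shifts G (letter G) (flip p # u) (ev v) w'" using Cons.IH c by blast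
    then show ?thesis using shifts_bwd[OF _ letters_closed[OF u], of "flip p"] w c by fastforce
  next
    case 3
    let ?v = "p # v"
    have "freely_reduced ?v" using Cons.prems by (simp add: red_def)
    then have "freely_reduced (word_inv ?v @ w @ ?v)"
      using 3 cyc unfolding freely_reduced_append
      by (auto simp: freely_reduced_append simp del: word_inv_simps(2))
    moreover have "fst ` set (word_inv ?v @ w @ ?v) \<subseteq> S"
      using c fst_word_inv[of ?v] by (simp del: word_inv_simps add: image_Un)
    ultimately have r: "red (word_inv ?v @ w @ ?v)" by (simp add: red_def)
    have "fst ` set ?v \<subseteq> S" using c by simp
    then have "ev (word_inv ?v @ w @ ?v) = inv (ev ?v) \<otimes> (ev w \<otimes> ev ?v)"
      using c by (simp del: word_inv_simps ev_simps set_simps add: image_Un)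
    also have "\<dots> = ev w'" using Cons.prems(4) c by simp
    finally have "w' = word_inv ?v @ w @ ?v" using ev_inj[OF r assms(3)] by simp
    then have "hd w' = flip (last ?v)" "last w' = last ?v"
      by (simp_all del: word_inv_simps(2))
    then show ?thesis using assms(4) by (auto simp: cyclically_reduced_def)
  qed
qed

lemma cyclically_reduced_exists:
  assumes "red w" "w \<noteq> []"
  shows "\<exists>h v. h \<in> carrier G \<and> red v \<and> cyclically_reduced v \<and> ev w = conj_by h (ev v)"
  using assms
proof (induction w rule: length_induct)
  case (1 w)
  have w: "fst ` set w \<subseteq> S" "freely_reduced w" using 1(2) by (auto simp: red_def)
  show ?case
  proof (cases "hd w = flip (last w)")
    case False
    then show ?thesis using 1 w by (intro exI[of _ \<one>] exI[of _ w]) (simp add: cyclically_reduced_def)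
  next
    case True
    obtain p u' where pu: "w = p # u'" using 1(3) by (cases w) auto
    then have "u' \<noteq> []" "last u' = flip p" using True by (auto split: if_splits simp: flip_eq_iff)
    then obtain u where u: "w = p # u @ [flip p]" using pu by (metis append_butlast_last_id)
    then have r: "red u" "u \<noteq> []" "fst p \<in> S" "fst ` set u \<subseteq> S"
      using w by (auto simp: red_def freely_reduced_Cons freely_reduced_append)
    then obtain h v where hv: "h \<in> carrier G" "red v" "cyclically_reduced v" "ev u = conj_by h (ev v)"
      using 1(1) u by (metis length_append_singleton length_Cons less_SucI lessI)
    have "ev w = conj_by (letter G p) (ev u)"
      using r u by (simp add: conj_by_def m_assoc)
    then have "ev w = conj_by (letter G p \<otimes> h) (ev v)" using hv r by (simp add: conj_by_conj red_def)
    then show ?thesis using hv r by (intro exI[of _ "letter G p \<otimes> h"] exI[of _ v]) simp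
  qed
qed

lemma concat_replicate_commute: "concat (replicate m w) @ w = w @ concat (replicate m w)"
  by (induction m) auto

lemma cyclically_reduced_power:
  assumes "red w" "cyclically_reduced w"
  shows "red (concat (replicate (Suc m) w)) \<and> cyclically_reduced (concat (replicate (Suc m) w)) \<and>
    hd (concat (replicate (Suc m) w)) = hd w \<and> ev (concat (replicate (Suc m) w)) = ev w [^] Suc m"
proof (induction m)
  case 0 then show ?case using assms by (simp add: red_def)
next
  case (Suc m)
  let ?W = "concat (replicate (Suc m) w)"
  have W: "concat (replicate (Suc (Suc m)) w) = w @ ?W" by simp
  have "ev (w @ ?W) = ev w \<otimes> ev w [^] Suc m"
    using Suc assms ev_append[of w ?W] by (simp only: red_def)
  then have "ev (w @ ?W) = ev w [^] Suc (Suc m)" using assms nat_pow_Suc2[of "ev w" "Suc m"]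
    by (simp add: red_def del: nat_pow_Suc)
  moreover have "last ?W = last w"
    using assms by (simp add: cyclically_reduced_def flip: concat_replicate_commute)
  ultimately show ?case unfolding W using Suc assms
    by (auto simp: red_def cyclically_reduced_def freely_reduced_append flip_eq_iff)
qed

lemma torsion_free:
  assumes "U \<in> carrier G" "U \<noteq> \<one>" "U [^] (m::nat) = \<one>"
  shows "m = 0"
proof (rule ccontr)
  assume "m \<noteq> 0"
  then obtain k where m: "m = Suc k" by (cases m) auto
  obtain w where w: "red w" "ev w = U" using red_word_exists assms by blast
  then have "w \<noteq> []" using assms by auto
  then obtain h v where hv: "h \<in> carrier G" "red v" "cyclically_reduced v" "U = conj_by h (ev v)"
    using cyclically_reduced_exists w by blast
  then have c: "ev v \<in> carrier G" by (simp add: red_def)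
  have "conj_by h (ev v [^] m) = \<one>"
    using conj_by_int_pow[OF hv(1) c, of "int m"] assms(3) hv by (simp add: int_pow_int)
  then have "ev v [^] m = \<one>" using hv(1) c
    by (metis conj_by_conj conj_by_def conj_by_one inv_closed l_inv nat_pow_closed r_inv r_one one_closed)
  moreover have "ev v [^] m \<noteq> \<one>"
    using cyclically_reduced_power[OF hv(2,3), of k] ev_neq_one m by (metis cyclically_reduced_def)
  ultimately show False by simp
qed

text \<open>
  After conjugation \<open>U\<close> is the value of a cyclically reduced word \<open>w\<close>. The rotations that fix
  the word \<open>w\<^sup>m\<close> are the multiples of its least period \<open>r\<close>; since \<open>w\<close> is not a proper power,
  \<open>r\<close> is the length of \<open>w\<close>.
\<close>

lemma centralizer_power:
  assumes U: "U \<in> carrier G" "U \<noteq> \<one>" "\<not> proper_power G U"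
    and z: "z \<in> carrier G" "z \<otimes> U [^] (m::nat) = U [^] m \<otimes> z" and "m > 0"
  shows "\<exists>r::int. z = U [^] r"
proof -
  obtain k where m: "m = Suc k" using \<open>m > 0\<close> by (cases m) auto
  obtain u where u: "red u" "ev u = U" using red_word_exists assms by blast
  then have "u \<noteq> []" using assms by auto
  then obtain h w where hw: "h \<in> carrier G" "red w" "cyclically_reduced w" "U = conj_by h (ev w)"
    using cyclically_reduced_exists u by blast
  have c: "fst ` set w \<subseteq> S" "ev w \<in> carrier G" using hw by (simp_all add: red_def)
  have cpow: "conj_by h (ev w [^] (j::int)) = U [^] j" for j
    using conj_by_int_pow[OF hw(1) c(2)] hw(4) by simp
  \<comment> \<open>\<open>z\<close> is only known to commute with U^m, so periods are studied in
    the word of the m-th power, which is again cyclically reduced.\<close>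
  define W where "W = concat (replicate m w)"
  have W: "red W" "cyclically_reduced W" "ev W = ev w [^] m"
    using cyclically_reduced_power[OF hw(2,3), of k] by (auto simp: W_def m)
  have Wc: "fst ` set W \<subseteq> S" "W \<noteq> []" using W by (auto simp: red_def cyclically_reduced_def)
  define z' where "z' = conj_by (inv h) z"
  have z': "z' \<in> carrier G" "z = conj_by h z'" using hw(1) z(1) by (simp_all add: z'_def conj_by_conj)
  have "conj_by h (z' \<otimes> ev W) = conj_by h (ev W \<otimes> z')"
    using z(2) cpow[of "int m"] hw(1) c z' W(3) by (simp add: conj_by_mult int_pow_int)
  then have "z' \<otimes> ev W = ev W \<otimes> z'"
    using hw(1) z' Wc by (simp add: conj_by_def)
  moreover obtain v where v: "red v" "ev v = z'" using red_word_exists z' by blast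
  ultimately have "shifts G (letter G) W z' W"
    using conj_cyclically_reduced[OF W(1,2) W(1,2), of v] by metis
  then obtain j :: int and i where ji: "i < length W" "rotate i W = W"
    "z' = ev W [^] j \<otimes> ev (take i W)" by (auto simp: shifts_def ev_def)
  define r where "r = (LEAST r. r > 0 \<and> rotate r W = W)"
  have r: "r > 0" "rotate r W = W"
  proof -
    have "length W > 0 \<and> rotate (length W) W = W" using Wc by simp
    then show "r > 0" "rotate r W = W" unfolding r_def by (metis (mono_tags, lifting) LeastI)+
  qed
  have dvd: "r dvd s" if "rotate s W = W" for s
  proof (rule ccontr)
    assume "\<not> r dvd s"
    then have "s mod r > 0" by (simp add: dvd_eq_mod_eq_0)
    moreover have "rotate (s mod r) W = W" using rotate_mod_fixed[OF r(2) that] .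
    ultimately have "r \<le> s mod r" unfolding r_def by (intro Least_le) simp
    then show False using r(1) by (metis mod_less_divisor not_le)
  qed
  define a where "a = ev (take r W)"
  have tc: "fst ` set (take s W) \<subseteq> S" for s using Wc set_take_subset[of s W] by auto
  then have a: "a \<in> carrier G" by (simp add: a_def)
  have pow: "ev (take (r * q) W) = a [^] q" if "r * q \<le> length W" for q
    using that
  proof (induction q)
    case (Suc q)
    then have "take (r * Suc q) W = take r W @ take (r * q) W"
      using take_add_fixed[OF r(2), of "r * q"] by simp
    then have "ev (take (r * Suc q) W) = a \<otimes> a [^] q"
      using Suc.IH Suc.prems tc[of r] tc[of "r * q"] by (simp add: a_def)
    then show ?case using nat_pow_Suc2[OF a] by simp
  qed simp
  \<comment> \<open>Rotation by one block fixes \<open>W\<close>, so the block length is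
    \<open>r * q\<close>, and \<open>w\<close> is the q-th power of the first \<open>r\<close>
    letters.\<close>
  have rw: "rotate (length w) W = W" and tw: "take (length w) W = w" and lw: "length w \<le> length W"
    using concat_replicate_commute[of k w] by (simp_all add: W_def m rotate_append)
  obtain q where q: "length w = r * q" using dvd[OF rw] by (auto simp: dvd_def)
  have "ev w = a [^] q" using pow[of q] q tw lw by simp
  then have "U = conj_by h a [^] q" using conj_by_int_pow[OF hw(1) a, of "int q"] hw(4)
    by (simp add: int_pow_int)
  then have "\<not> q \<ge> 2" using U(3) conj_by_closed[OF hw(1) a] unfolding proper_power_def by blast
  moreover have "q \<noteq> 0" using q hw(3) by (cases q) (auto simp: cyclically_reduced_def)
  ultimately have "q = 1" by simp
  then have aw: "a = ev w" using \<open>ev w = a [^] q\<close> a by simp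
  obtain q' where q': "i = r * q'" using dvd[OF ji(2)] by (auto simp: dvd_def)
  \<comment> \<open>Since \<open>a = ev w\<close>, the prefix consists of \<open>q'\<close> whole
    blocks, in addition to \<open>j\<close> full turns of \<open>m\<close> blocks each.\<close>
  have "z' = (ev w [^] int m) [^] j \<otimes> ev w [^] int q'"
    using ji(1,3) q' pow[of q'] aw W(3) by (simp add: int_pow_int)
  then have "z' = ev w [^] (int m * j + int q')"
    using c by (simp add: int_pow_pow int_pow_mult)
  then show ?thesis using z'(2) cpow by auto
qed

end

section \<open>Normal forms in free products\<close>

text \<open>Every other syllable has the tag in question, and the two end tags settle the parity.
  This converts displacement into word length in \<open>core_length\<close>.\<close>

lemma alternating_count:
  assumes "successively (\<lambda>p q. fst p \<noteq> fst q) w" "w \<noteq> []"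
  shows "2 * length (filter (\<lambda>p. fst p \<noteq> (t::bool)) w) + 1 =
    length w + of_bool (fst (hd w) \<noteq> t) + of_bool (fst (last w) \<noteq> t)"
  using assms
proof (induction w)
  case (Cons p w)
  show ?case
  proof (cases "w = []")
    case False
    then have "fst p \<noteq> fst (hd w)" using Cons.prems by (cases w) auto
    then show ?thesis using Cons.IH Cons.prems False
      by (cases w) (auto simp: successively_Cons)
  qed simp
qed simp

lemma (in group) inv_mult_one_iff:
  assumes "a \<in> carrier G" "b \<in> carrier G"
  shows "inv a \<otimes> b = \<one> \<longleftrightarrow> b = a" "a \<otimes> b = \<one> \<longleftrightarrow> b = inv a"
  using assms by (metis inv_mult_cancel r_one l_inv r_inv inv_closed)+

locale free_prod = group G for G :: "('a, 'b) monoid_scheme" (structure) +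
  fixes A B :: "'a set"
  assumes prod: "free_product G A B"
begin

text \<open>Indexing the factors by a Boolean lets each argument cover both at once, with
  \<open>\<not> t\<close> for the other factor.\<close>

definition C :: "bool \<Rightarrow> 'a set" where
  "C t = (if t then A else B)"

lemma C_subgroup: "subgroup (C t) G"
  using prod by (simp add: C_def free_product_def)

lemma C_carrier [simp]: "g \<in> C t \<Longrightarrow> g \<in> carrier G"
  using subgroup.subset[OF C_subgroup] by blast

lemma C_one [simp]: "\<one> \<in> C t"
  and C_mult [simp]: "g \<in> C t \<Longrightarrow> h \<in> C t \<Longrightarrow> g \<otimes> h \<in> C t"
  and C_inv [simp]: "g \<in> C t \<Longrightarrow> inv g \<in> C t"
  using subgroup.one_closed[OF C_subgroup] subgroup.m_closed[OF C_subgroup]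
    subgroup.m_inv_closed[OF C_subgroup] by blast+

definition ev :: "(bool \<times> 'a) list \<Rightarrow> 'a" where
  "ev w = list_prod G (map snd w)"

lemma ev_simps [simp]: "ev [] = \<one>" "ev (p # w) = snd p \<otimes> ev w"
  by (simp_all add: ev_def)

definition syl :: "bool \<times> 'a \<Rightarrow> bool" where
  "syl p \<longleftrightarrow> snd p \<in> C (fst p) \<and> snd p \<noteq> \<one>"

lemma syl_closed [simp]: "syl p \<Longrightarrow> snd p \<in> carrier G"
  by (auto simp: syl_def)

definition nform :: "(bool \<times> 'a) list \<Rightarrow> bool" where
  "nform w \<longleftrightarrow> list_all syl w \<and> successively (\<lambda>p q. fst p \<noteq> fst q) w"

lemma nform_Nil [simp]: "nform []"
  by (simp add: nform_def)

lemma nform_append: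
  "nform (v @ w) \<longleftrightarrow> nform v \<and> nform w \<and> (v = [] \<or> w = [] \<or> fst (last v) \<noteq> fst (hd w))"
  by (auto simp: nform_def successively_append_iff)

lemma nform_Cons:
  "nform (p # w) \<longleftrightarrow> syl p \<and> nform w \<and> (w = [] \<or> fst p \<noteq> fst (hd w))"
  by (auto simp: nform_def successively_Cons)

lemma snd_closed: "nform w \<Longrightarrow> snd ` set w \<subseteq> carrier G"
  unfolding nform_def list_all_iff using syl_closed by blast

lemma ev_closed [simp]: "nform w \<Longrightarrow> ev w \<in> carrier G"
  unfolding ev_def using snd_closed by (intro list_prod_closed) auto

lemma ev_append [simp]: "nform v \<Longrightarrow> nform w \<Longrightarrow> ev (v @ w) = ev v \<otimes> ev w"
  unfolding ev_def map_append using snd_closed[of v] snd_closed[of w] by (intro list_prod_append) auto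

definition word_inv :: "(bool \<times> 'a) list \<Rightarrow> (bool \<times> 'a) list" where
  "word_inv w = rev (map (\<lambda>p. (fst p, inv (snd p))) w)"

lemma word_inv_simps [simp]:
  "word_inv [] = []" "word_inv (p # w) = word_inv w @ [(fst p, inv (snd p))]"
  "word_inv w = [] \<longleftrightarrow> w = []" "length (word_inv w) = length w"
  by (simp_all add: word_inv_def)

lemma word_inv_ends:
  "w \<noteq> [] \<Longrightarrow> fst (last (word_inv w)) = fst (hd w)" "w \<noteq> [] \<Longrightarrow> fst (hd (word_inv w)) = fst (last w)"
  by (simp_all add: word_inv_def last_rev hd_rev hd_map last_map)

lemma syl_inv: "syl p \<Longrightarrow> syl (fst p, inv (snd p))"
  by (auto simp: syl_def inv_eq_1_iff)

lemma nform_word_inv: "nform w \<Longrightarrow> nform (word_inv w)"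
proof (induction w)
  case (Cons p w)
  then show ?case by (auto simp: nform_append nform_Cons syl_inv word_inv_ends)
qed simp

lemma ev_word_inv [simp]: "nform w \<Longrightarrow> ev (word_inv w) = inv (ev w)"
proof (induction w)
  case (Cons p w)
  then have "nform w" "syl p" by (simp_all add: nform_Cons)
  then show ?case using Cons.IH
    by (simp add: nform_word_inv nform_Cons syl_inv inv_mult_group)
qed simp

lemma filter_word_inv:
  "length (filter (\<lambda>p. Q (fst p)) (word_inv w)) = length (filter (\<lambda>p. Q (fst p)) w)"
  by (induction w) auto

lemma ev_neq_one:
  assumes "nform w" "w \<noteq> []"
  shows "ev w \<noteq> \<one>"
proof -
  have "\<forall>(t, g) \<in> set w. g \<in> (if t then A else B) - {\<one>}"
    using assms(1) by (auto simp: nform_def list_all_iff syl_def C_def)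
  then show ?thesis
    using prod assms unfolding free_product_def nform_def ev_def by blast
qed

lemma ev_inj: "nform v \<Longrightarrow> nform w \<Longrightarrow> ev v = ev w \<Longrightarrow> v = w"
proof (induction v arbitrary: w)
  case Nil
  then show ?case using ev_neq_one[of w] by auto
next
  case (Cons p v)
  show ?case
  proof (cases w)
    case Nil then show ?thesis using ev_neq_one[of "p # v"] Cons.prems by auto
  next
    case w: (Cons q u)
    have c: "syl p" "syl q" "nform v" "nform u" "v = [] \<or> fst p \<noteq> fst (hd v)" "u = [] \<or> fst q \<noteq> fst (hd u)"
      using Cons.prems w by (auto simp: nform_Cons)
    have eq: "snd p \<otimes> ev v = snd q \<otimes> ev u" using Cons.prems(3) w by simp
    show ?thesis
    proof (cases "p = q")
      case True
      then have "ev v = ev u" using eq c by simp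
      then show ?thesis using Cons.IH c True w by blast
    next
      case False
      have "ev u = inv (snd q) \<otimes> (snd p \<otimes> ev v)" using eq c by simp
      then have one: "inv (ev u) \<otimes> (inv (snd q) \<otimes> (snd p \<otimes> ev v)) = \<one>"
        using c by (metis ev_closed l_inv)
      show ?thesis
      proof (cases "fst p = fst q")
        case True
        \<comment> \<open>Unlike letters of a free group, different syllables of the same factor
          merge into one. It is nontrivial because they differ, so the joined word is still a normal
          form.\<close>
        let ?r = "(fst p, inv (snd q) \<otimes> snd p)"
        have "syl ?r" using c True False
          by (auto simp: syl_def prod_eq_iff inv_mult_one_iff)
        then have r: "nform (?r # v)" "syl ?r" using c by (auto simp: nform_Cons)
        then have "nform (word_inv u @ ?r # v)"
          using c True by (auto simp: nform_append nform_word_inv word_inv_ends)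
        moreover have "ev (word_inv u @ ?r # v) = \<one>"
          using r c one by (simp add: nform_word_inv m_assoc)
        ultimately show ?thesis using ev_neq_one by blast
      next
        case diff: False
        have "nform (word_inv w @ p # v)"
          using c diff w Cons.prems unfolding nform_append
          by (auto simp: nform_word_inv word_inv_ends simp del: word_inv_simps(2))
        moreover have "ev (word_inv w @ p # v) = \<one>"
          using Cons.prems ev_append[of "word_inv w" "p # v"] nform_word_inv[of w] ev_closed[of w]
          by simp
        ultimately show ?thesis using ev_neq_one by blast
      qed
    qed
  qed
qed

lemma nform_exists:
  assumes "g \<in> carrier G"
  shows "\<exists>w. nform w \<and> ev w = g"
proof -
  have step: "\<exists>w'. nform w' \<and> ev w' = a \<otimes> ev w" if "a \<in> C t" "nform w" for a t w
  proof (cases "a = \<one>")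
    case True then show ?thesis using that by (intro exI[of _ w]) auto
  next
    case a: False
    show ?thesis
    proof (cases "w = [] \<or> fst (hd w) \<noteq> t")
      case True
      then show ?thesis using that a
        by (intro exI[of _ "(t, a) # w"]) (auto simp: nform_Cons syl_def)
    next
      case False
      then obtain b u where w: "w = (t, b) # u" by (cases w) auto
      then have b: "b \<in> C t" "nform u" "u = [] \<or> t \<noteq> fst (hd u)"
        using that by (auto simp: nform_Cons syl_def)
      show ?thesis
      proof (cases "a \<otimes> b = \<one>")
        case True
        then have "a \<otimes> ev w = ev u" using b that(1) w by (simp flip: m_assoc)
        then show ?thesis using b by auto
      next
        case False
        then show ?thesis using b that(1) w
          by (intro exI[of _ "(t, a \<otimes> b) # u"]) (auto simp: nform_Cons syl_def m_assoc)
      qed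
    qed
  qed
  have mult: "\<exists>w'. nform w' \<and> ev w' = ev v \<otimes> ev w" if "nform w" "nform v" for v w
    using that(2)
  proof (induction v)
    case Nil then show ?case using that(1) by (intro exI[of _ w]) auto
  next
    case (Cons p v)
    then obtain w' where "nform w'" "ev w' = ev v \<otimes> ev w" "syl p" "nform v" by (auto simp: nform_Cons)
    then show ?case using step[of "snd p" "fst p" w'] that(1) by (auto simp: m_assoc syl_def)
  qed
  have single: "\<exists>w. nform w \<and> ev w = a" if "a \<in> C t" for a t
    using step[OF that, of "[]"] that by simp
  have "g \<in> generate G (C True \<union> C False)" using assms prod by (simp add: free_product_def C_def)
  then show ?thesis
  proof induction
    case one show ?case by (intro exI[of _ "[]"]) simp
  next
    case (incl h) then show ?case using single by blast
  next
    case (inv h) then show ?case using single C_inv by blast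
  next
    case (eng g h) then show ?case using mult by metis
  qed
qed

definition nf :: "'a \<Rightarrow> (bool \<times> 'a) list" where
  "nf g = (THE w. nform w \<and> ev w = g)"

lemma nf_ev [simp]: "nform w \<Longrightarrow> nf (ev w) = w"
  unfolding nf_def using ev_inj by (intro the_equality) auto

lemma nform_nf [simp]: "g \<in> carrier G \<Longrightarrow> nform (nf g)"
  and ev_nf [simp]: "g \<in> carrier G \<Longrightarrow> ev (nf g) = g"
  using nform_exists nf_ev by metis+

text \<open>Alternation with different end tags forces even length, so elements of the factors are
  excluded: in the tree these words represent hyperbolic elements.\<close>

definition cyclic_nform :: "(bool \<times> 'a) list \<Rightarrow> bool" where
  "cyclic_nform w \<longleftrightarrow> w \<noteq> [] \<and> nform w \<and> fst (hd w) \<noteq> fst (last w)"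

text \<open>The first syllable of the conjugator shares its factor with exactly one end of
  \<open>w\<close>. If it cancels there completely, \<open>w\<close> is rotated and the induction
  goes on. Otherwise it merges, and v^-1 w v is then a longer normal form with equal end tags.
  Keeping this second outcome, instead of assuming \<open>w'\<close> cyclic, also serves to show
  that conjugates avoid the factors.\<close>

lemma conj_cyclic_nform:
  assumes "cyclic_nform w" "nform w'" "nform v" "ev w \<otimes> ev v = ev v \<otimes> ev w'"
  shows "shifts G snd w (ev v) w' \<or>
    length w < length w' \<and> w' \<noteq> [] \<and> fst (hd w') = fst (last w')"
  using assms(1,3,4)
proof (induction v arbitrary: w)
  case Nil
  then have "w = w'" using ev_inj[of w w'] assms(2) by (auto simp: cyclic_nform_def)
  then show ?case using shifts_one[of w snd] assms(2) snd_closed[of w'] Nil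
    by (auto simp: cyclic_nform_def)
next
  case (Cons p v)
  have w: "w \<noteq> []" "nform w" "fst (hd w) \<noteq> fst (last w)" using Cons.prems(1) by (auto simp: cyclic_nform_def)
  have p: "syl p" "nform v" "v = [] \<or> fst p \<noteq> fst (hd v)" using Cons.prems(2) by (auto simp: nform_Cons)
  have eq: "ev w \<otimes> (snd p \<otimes> ev v) = snd p \<otimes> (ev v \<otimes> ev w')"
    using Cons.prems(3) assms(2) w p by (simp add: m_assoc)
  show ?case
  proof (cases "fst p = fst (hd w)")
    case True
    obtain q u where qu: "w = q # u" using w by (cases w) auto
    define a where "a = snd q"
    have wu: "w = (fst p, a) # u" using True qu by (simp add: a_def)
    moreover have "u \<noteq> []" using w wu by auto
    ultimately have u: "u \<noteq> []" "nform u" "syl (fst p, a)" "fst p \<noteq> fst (hd u)" "fst (last u) \<noteq> fst p"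
      using w by (auto simp: nform_Cons)
    have a: "a \<in> carrier G" using syl_closed[OF u(3)] by simp
    have uq: "nform (u @ [(fst p, a)])" using u by (simp add: nform_append nform_Cons)
    show ?thesis
    proof (cases "a = snd p")
      case True
      then have wp: "w = p # u" by (simp add: wu)
      have up: "nform (u @ [p])" using uq by (simp add: True)
      then have "cyclic_nform (u @ [p])" using u by (simp add: cyclic_nform_def hd_append)
      moreover have "ev (u @ [p]) \<otimes> ev v = ev v \<otimes> ev w'"
        using eq assms(2) p u by (simp add: wp m_assoc nform_Cons)
      ultimately have "shifts G snd (u @ [p]) (ev v) w' \<or>
          length (u @ [p]) < length w' \<and> w' \<noteq> [] \<and> fst (hd w') = fst (last w')"
        using p(2) by (intro Cons.IH)
      then show ?thesis
        using shifts_fwd[OF _ snd_closed[OF u(2)], of p "ev v" w'] p(1) by (simp add: wp) blast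
    next
      case False
      let ?r = "(fst p, inv (snd p) \<otimes> a)"
      have "inv (snd p) \<otimes> a \<noteq> \<one>" using False a p(1) by (simp add: inv_mult_one_iff)
      then have r: "syl ?r" using p(1) u(3) by (simp add: syl_def)
      have up: "nform (u @ p # v)" using u Cons.prems(2) by (auto simp: nform_append)
      then have r1: "nform (?r # u @ p # v)" using r u by (auto simp: nform_Cons)
      let ?W = "word_inv v @ ?r # u @ p # v"
      have W: "nform ?W" unfolding nform_append[of "word_inv v"] using r1 p
        by (auto simp: nform_word_inv word_inv_ends)
      have "ev ?W = inv (ev v) \<otimes> (inv (snd p) \<otimes> (ev w \<otimes> (snd p \<otimes> ev v)))"
        using ev_append[OF nform_word_inv[OF p(2)] r1] ev_append[OF u(2) Cons.prems(2)] p u a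
        by (simp add: wu m_assoc)
      also have "\<dots> = ev w'" unfolding eq using p assms(2) by simp
      finally have "w' = ?W" using ev_inj[OF W assms(2)] by simp
      then show ?thesis using p wu by (cases "v = []") (auto simp: word_inv_ends)
    qed
  next
    case False
    then have pl: "fst p = fst (last w)" using w by auto
    obtain u q where wuq: "w = u @ [q]" using w(1) by (cases w rule: rev_cases) auto
    define a where "a = snd q"
    have wu: "w = u @ [(fst p, a)]" using pl wuq by (simp add: a_def)
    have "u \<noteq> []" using w wu by auto
    then have u: "u \<noteq> []" "nform u" "syl (fst p, a)" "fst p \<noteq> fst (hd u)" "fst (last u) \<noteq> fst p"
      using w False wu by (auto simp: nform_append nform_Cons)
    have a: "a \<in> carrier G" using syl_closed[OF u(3)] by simp
    have evw: "ev w = ev u \<otimes> a" using u a by (simp add: wu nform_Cons)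
    show ?thesis
    proof (cases "a \<otimes> snd p = \<one>")
      case True
      then have pa: "snd p = inv a" using a p(1) by (simp add: inv_mult_one_iff)
      let ?q = "(fst p, a)"
      have "cyclic_nform (?q # u)" using u by (auto simp: cyclic_nform_def nform_Cons)
      moreover have "ev (?q # u) \<otimes> ev v = ev v \<otimes> ev w'"
      proof -
        have "ev u \<otimes> ev v = inv a \<otimes> (ev v \<otimes> ev w')"
          using eq a u p by (simp add: evw pa m_assoc)
        then show ?thesis using a u p assms(2) by (simp add: m_assoc)
      qed
      ultimately have "shifts G snd (?q # u) (ev v) w' \<or>
          length (?q # u) < length w' \<and> w' \<noteq> [] \<and> fst (hd w') = fst (last w')"
        using p(2) by (intro Cons.IH)
      then show ?thesis
        using shifts_bwd[OF _ snd_closed[OF u(2)], of ?q "ev v" w'] a by (simp add: wu pa) blast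
    next
      case False
      let ?r = "(fst p, a \<otimes> snd p)"
      have r: "syl ?r" using p(1) u(3) False by (simp add: syl_def)
      then have rv: "nform (?r # v)" using p by (auto simp: nform_Cons)
      then have uv: "nform (u @ ?r # v)" using u by (auto simp: nform_append)
      let ?W = "word_inv (p # v) @ u @ ?r # v"
      have W: "nform ?W"
        unfolding nform_append[of "word_inv (p # v)"] using uv u nform_word_inv[OF Cons.prems(2)]
        by (auto simp: word_inv_ends)
      have "ev ?W = inv (snd p \<otimes> ev v) \<otimes> (ev w \<otimes> (snd p \<otimes> ev v))"
        using ev_append[OF nform_word_inv[OF Cons.prems(2)] uv] ev_append[OF u(2) rv]
          ev_word_inv[OF Cons.prems(2)] p u a
        by (simp add: evw m_assoc)
      also have "\<dots> = ev w'" unfolding eq using p assms(2) by (simp add: inv_mult_group m_assoc)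
      finally have "w' = ?W" using ev_inj[OF W assms(2)] by simp
      then show ?thesis using p wu by (cases "v = []") (auto simp: word_inv_ends)
    qed
  qed
qed

end

section \<open>Descent to a pair with an elliptic entry\<close>

context free_prod
begin

text \<open>
  In the Bass--Serre tree of the free product, twice this number is the distance
  by which \<open>g\<close> moves the vertex fixed by \<open>C t\<close>.
\<close>

definition disp :: "bool \<Rightarrow> 'a \<Rightarrow> nat" where
  "disp t g = length (filter (\<lambda>p. fst p \<noteq> t) (nf g))"

text \<open>What remains of an element outside \<open>C t\<close> after its outer syllables from
  \<open>C t\<close> are stripped (\<open>core_decomp\<close>). Those fix the base vertex and do not
  contribute to \<open>disp t\<close>.\<close>

definition core :: "bool \<Rightarrow> (bool \<times> 'a) list \<Rightarrow> bool" where
  "core t w \<longleftrightarrow> nform w \<and> w \<noteq> [] \<and> fst (hd w) \<noteq> t \<and> fst (last w) \<noteq> t"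

lemma core_nform [simp]: "core t w \<Longrightarrow> nform w"
  by (simp add: core_def)

lemma core_word_inv: "core t w \<Longrightarrow> core t (word_inv w)"
  by (simp add: core_def nform_word_inv word_inv_ends del: core_nform)

text \<open>A normal form of at most one syllable for a factor element, so that trivial and
  nontrivial outer elements are handled uniformly.\<close>

definition pad :: "bool \<Rightarrow> 'a \<Rightarrow> (bool \<times> 'a) list" where
  "pad t k = (if k = \<one> then [] else [(t, k)])"

lemma ev_pad [simp]: "k \<in> C t \<Longrightarrow> ev (pad t k) = k"
  by (simp add: pad_def)

lemma nform_pad [simp]: "k \<in> C t \<Longrightarrow> nform (pad t k)"
  by (simp add: pad_def nform_Cons syl_def)

lemma nform_pad_core:
  "core t X \<Longrightarrow> k \<in> C t \<Longrightarrow> l \<in> C t \<Longrightarrow> nform (pad t k @ X @ pad t l)"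
  by (cases "k = \<one>"; cases "l = \<one>")
    (auto simp: core_def pad_def nform_append nform_Cons syl_def simp del: core_nform)

lemma disp_ev: "nform w \<Longrightarrow> disp t (ev w) = length (filter (\<lambda>p. fst p \<noteq> t) w)"
  by (simp add: disp_def)

lemma nf_pad_core:
  assumes "core t X" "k \<in> C t" "l \<in> C t"
  shows "nf (k \<otimes> ev X \<otimes> l) = pad t k @ X @ pad t l"
proof -
  have X: "nform (X @ pad t l)" using nform_pad_core[OF assms] by (simp add: nform_append)
  have "ev (pad t k @ X @ pad t l) = k \<otimes> ev X \<otimes> l"
    using assms X by (simp add: m_assoc)
  then show ?thesis using nf_ev[OF nform_pad_core[OF assms]] by simp
qed

lemma filter_pad: "length (filter (\<lambda>p. fst p \<noteq> t) (pad s k)) = (if k = \<one> \<or> s = t then 0 else 1)"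
  by (simp add: pad_def)

lemma filter_pad_same [simp]: "filter (\<lambda>p. fst p = (\<not> t)) (pad t k) = []"
  by (simp add: pad_def)

lemma disp_pad_core:
  assumes "core t X" "k \<in> C t" "l \<in> C t"
  shows "disp t (k \<otimes> ev X \<otimes> l) = disp t (ev X)"
  using nf_pad_core[OF assms] assms(1) by (simp add: disp_def)

lemma core_length:
  assumes "core t X"
  shows "2 * disp t (ev X) = length X + 1"
  using alternating_count[of X t] assms by (simp add: disp_ev core_def nform_def del: core_nform)

lemma core_disp_pos: "core t X \<Longrightarrow> disp t (ev X) \<ge> 1"
  using core_length[of t X] by (cases "disp t (ev X)") auto

text \<open>Compares two adjacent vertices. Inside \<open>X\<close> there is one syllable fewer from
  \<open>C t\<close> than from the other factor, and each nontrivial outer element adds one. So if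
  an outer element is trivial, the neighbouring vertex is moved no further.\<close>

lemma disp_other_core:
  assumes "core t X" "k \<in> C t" "l \<in> C t"
  shows "disp (\<not> t) (k \<otimes> ev X \<otimes> l) + 1 = disp t (ev X) + of_bool (k \<noteq> \<one>) + of_bool (l \<noteq> \<one>)"
proof -
  have "length (filter (\<lambda>p. fst p \<noteq> t) X) + length (filter (\<lambda>p. \<not> fst p \<noteq> t) X) = length X"
    by (rule sum_length_filter_compl)
  moreover have "(\<lambda>p :: bool \<times> 'a. fst p \<noteq> (\<not> t)) = (\<lambda>p. \<not> fst p \<noteq> t)" by auto
  ultimately have "length (filter (\<lambda>p. fst p \<noteq> (\<not> t)) X) + 1 = disp t (ev X)"
    using core_length[OF assms(1)] assms(1) by (simp add: disp_ev)
  then show ?thesis unfolding disp_def nf_pad_core[OF assms] filter_append length_append filter_pad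
    using assms(1) by (auto simp: disp_def)
qed

lemma nform_all_tag:
  assumes "nform w" "\<forall>p\<in>set w. fst p = t"
  shows "ev w \<in> C t"
proof (cases w)
  case (Cons p u)
  then have "u = []" using assms by (cases u) (auto simp: nform_Cons)
  then show ?thesis using Cons assms by (auto simp: nform_Cons syl_def)
qed simp

lemma disp_0_iff:
  assumes "g \<in> carrier G"
  shows "disp t g = 0 \<longleftrightarrow> g \<in> C t"
proof
  assume "disp t g = 0"
  then have "\<forall>p\<in>set (nf g). fst p = t" by (simp add: disp_def filter_empty_conv)
  then show "g \<in> C t" using nform_all_tag[OF nform_nf[OF assms]] ev_nf[OF assms] by metis
next
  assume "g \<in> C t"
  then have "disp t (ev (pad t g)) = 0" by (subst disp_ev) simp_all
  then show "disp t g = 0" using \<open>g \<in> C t\<close> by simp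
qed

lemma strip_hd:
  assumes "nform w"
  obtains k u where "k \<in> C t" "nform u" "u = [] \<or> fst (hd u) \<noteq> t" "ev w = k \<otimes> ev u"
    "u = [] \<or> w \<noteq> [] \<and> last u = last w"
proof (cases "w \<noteq> [] \<and> fst (hd w) = t")
  case True
  then obtain p u where w: "w = p # u" "fst p = t" by (cases w) auto
  show thesis
    by (rule that[of "snd p" u]) (use w assms in \<open>auto simp: nform_Cons syl_def\<close>)
next
  case False
  show thesis
    by (rule that[of \<one> w]) (use False assms in auto)
qed

lemma strip_last:
  assumes "nform w"
  obtains k u where "k \<in> C t" "nform u" "u = [] \<or> fst (last u) \<noteq> t" "ev w = ev u \<otimes> k"
    "u = [] \<or> w \<noteq> [] \<and> hd u = hd w"
proof (cases "w \<noteq> [] \<and> fst (last w) = t")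
  case True
  then obtain p u where w: "w = u @ [p]" "fst p = t" by (cases w rule: rev_cases) auto
  show thesis
    by (rule that[of "snd p" u]) (use w assms in \<open>auto simp: nform_append nform_Cons syl_def hd_append\<close>)
next
  case False
  show thesis
    by (rule that[of \<one> w]) (use False assms in auto)
qed

lemma core_decomp:
  assumes "g \<in> carrier G" "g \<notin> C t"
  obtains k X l where "k \<in> C t" "core t X" "l \<in> C t" "g = k \<otimes> ev X \<otimes> l"
proof -
  obtain k u where u: "k \<in> C t" "nform u" "u = [] \<or> fst (hd u) \<noteq> t" "ev (nf g) = k \<otimes> ev u"
    using strip_hd[OF nform_nf[OF assms(1)], of t] by metis
  obtain l X where X: "l \<in> C t" "nform X" "X = [] \<or> fst (last X) \<noteq> t" "ev u = ev X \<otimes> l"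
    "X = [] \<or> u \<noteq> [] \<and> hd X = hd u"
    using strip_last[OF u(2), of t] by metis
  have g: "g = k \<otimes> ev X \<otimes> l" using u X ev_nf[OF assms(1)] by (simp add: m_assoc)
  then have "X \<noteq> []" using u(1) X(1) assms(2) by auto
  then show thesis using that[of k X l] u X g by (auto simp: core_def simp del: core_nform)
qed

text \<open>\<open>C t\<close> fixes the base vertex, and the tree distance is invariant.\<close>

lemma disp_mult_C:
  assumes "g \<in> carrier G" "k \<in> C t" "l \<in> C t"
  shows "disp t (k \<otimes> g \<otimes> l) = disp t g"
proof (cases "g \<in> C t")
  case True
  then show ?thesis using assms disp_0_iff[of g t] disp_0_iff[of "k \<otimes> g \<otimes> l" t] by simp
next
  case False
  then obtain a X b where X: "a \<in> C t" "core t X" "b \<in> C t" "g = a \<otimes> ev X \<otimes> b"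
    using core_decomp assms(1) by blast
  then have "k \<otimes> g \<otimes> l = (k \<otimes> a) \<otimes> ev X \<otimes> (b \<otimes> l)" using assms by (simp add: m_assoc)
  then show ?thesis using disp_pad_core[OF X(2), of "k \<otimes> a" "b \<otimes> l"]
      disp_pad_core[OF X(2,1,3)] X assms by simp
qed

lemma disp_inv [simp]:
  assumes "g \<in> carrier G"
  shows "disp t (inv g) = disp t g"
proof -
  have "disp t (ev (word_inv (nf g))) = disp t (ev (nf g))"
    using assms filter_word_inv[of "\<lambda>s. s \<noteq> t"] by (simp only: disp_ev nform_word_inv nform_nf)
  then show ?thesis using assms by simp
qed

text \<open>After the common beginning of the two words is cancelled, either both have a remainder
  or merge, and the ends of the result are their last syllables, both outside \<open>C t\<close>; or
  one word is used up, which costs a syllable outside \<open>C t\<close> and lowers the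
  displacement. Only last syllables are constrained, so that the induction can strip first
  ones.\<close>

lemma quotient_of_cores:
  assumes "nform X" "X \<noteq> []" "fst (last X) \<noteq> t" "nform Y" "Y \<noteq> []" "fst (last Y) \<noteq> t"
  shows "(\<exists>Z. core t Z \<and> inv (ev Y) \<otimes> ev X = ev Z) \<or>
    disp t (inv (ev Y) \<otimes> ev X) < max (disp t (ev X)) (disp t (ev Y))"
  using assms
proof (induction X arbitrary: Y)
  case (Cons p X)
  obtain q Y' where Y: "Y = q # Y'" using Cons.prems by (cases Y) auto
  have c: "nform X" "nform Y'" "syl p" "syl q" "X = [] \<or> fst p \<noteq> fst (hd X)" "Y' = [] \<or> fst q \<noteq> fst (hd Y')"
    using Cons.prems Y by (auto simp: nform_Cons)
  show ?case
  proof (cases "p = q")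
    case True
    have eq: "inv (ev Y) \<otimes> ev (p # X) = inv (ev Y') \<otimes> ev X"
      using c by (simp add: Y True inv_mult_group m_assoc)
    have mono: "disp t (ev X) \<le> disp t (ev (p # X))" "disp t (ev Y') \<le> disp t (ev Y)"
      using Cons.prems c by (simp_all only: disp_ev Y) auto
    consider "X = []" | "Y' = []" "X \<noteq> []" | "X \<noteq> []" "Y' \<noteq> []" by blast
    then show ?thesis
    proof cases
      case 1
      then have p: "fst q \<noteq> t" using Cons.prems True by simp
      have "inv (ev Y) \<otimes> ev (p # X) = inv (ev Y')" using eq c 1 by simp
      moreover have "disp t (ev Y) = Suc (disp t (ev Y'))"
        using Cons.prems c p by (simp only: disp_ev Y) simp
      ultimately show ?thesis using c by (simp add: less_max_iff_disj)
    next
      case 2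
      then have p: "fst p \<noteq> t" using Cons.prems True Y by simp
      have "inv (ev Y) \<otimes> ev (p # X) = ev X" using eq c 2 by simp
      moreover have "disp t (ev (p # X)) = Suc (disp t (ev X))"
        using Cons.prems c p by (simp only: disp_ev) simp
      ultimately show ?thesis using c by (simp add: less_max_iff_disj)
    next
      case 3
      then have "(\<exists>Z. core t Z \<and> inv (ev Y') \<otimes> ev X = ev Z) \<or>
          disp t (inv (ev Y') \<otimes> ev X) < max (disp t (ev X)) (disp t (ev Y'))"
        using Cons.prems Y c by (intro Cons.IH) auto
      then show ?thesis unfolding eq using mono by fastforce
    qed
  next
    case False
    show ?thesis
    proof (cases "fst p = fst q")
      case True
      let ?r = "(fst p, inv (snd q) \<otimes> snd p)"
      have "syl ?r" using c True False by (auto simp: syl_def prod_eq_iff inv_mult_one_iff)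
      then have r: "nform (?r # X)" "syl ?r" using c by (auto simp: nform_Cons)
      then have Z: "nform (word_inv Y' @ ?r # X)"
        using c True by (auto simp: nform_append nform_word_inv word_inv_ends)
      have "inv (ev Y) \<otimes> ev (p # X) = ev (word_inv Y' @ ?r # X)"
        using r c by (simp add: Y nform_word_inv m_assoc inv_mult_group)
      moreover have "fst (hd (word_inv Y' @ ?r # X)) \<noteq> t"
      proof (cases "Y' = []")
        case Y': True
        then have "fst q \<noteq> t" using Cons.prems(6) Y by simp
        then show ?thesis using Y' True by simp
      next
        case False
        then have "fst (last Y') \<noteq> t" using Cons.prems(6) Y by simp
        then show ?thesis using False by (simp add: hd_append word_inv_ends)
      qed
      moreover have "fst (last (word_inv Y' @ ?r # X)) \<noteq> t"
        using Cons.prems(3) by (cases "X = []") simp_all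
      ultimately have "inv (ev Y) \<otimes> ev (p # X) = ev (word_inv Y' @ ?r # X) \<and>
          core t (word_inv Y' @ ?r # X)"
        using Z unfolding core_def by blast
      then show ?thesis by blast
    next
      case diff: False
      have Z: "nform (word_inv Y @ p # X)"
        using diff Y Cons.prems(1,4) unfolding nform_append
        by (simp add: nform_word_inv word_inv_ends del: word_inv_simps(2))
      have "inv (ev Y) \<otimes> ev (p # X) = ev (word_inv Y @ p # X)"
        using ev_append[OF nform_word_inv Cons.prems(1)] ev_word_inv Cons.prems(4) by simp
      moreover have "core t (word_inv Y @ p # X)"
        using Z Cons.prems(3,5,6) unfolding core_def
        by (simp add: hd_append word_inv_ends)
      ultimately show ?thesis by blast
    qed
  qed
qed simp

text \<open>The displacement bounds, which minimality will supply, exclude the second outcome of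
  \<open>quotient_of_cores\<close>. A nontrivial \<open>J\<close> blocks all cancellation, so the
  result contains it and at least one syllable on either side.\<close>

lemma quotient_of_cores_with:
  assumes X: "core t X" and Y: "core t Y" and J: "J \<in> C t"
    and d: "disp t (ev X) \<le> disp t (inv (ev Y) \<otimes> J \<otimes> ev X)"
      "disp t (ev Y) \<le> disp t (inv (ev Y) \<otimes> J \<otimes> ev X)"
  obtains Z where "core t Z" "inv (ev Y) \<otimes> J \<otimes> ev X = ev Z" "J \<noteq> \<one> \<Longrightarrow> length Z \<ge> 3"
proof (cases "J = \<one>")
  case True
  then show thesis
    using quotient_of_cores[of X t Y] X Y d that by (force simp: core_def simp del: core_nform)
next
  case False
  let ?Z = "word_inv Y @ (t, J) # X"
  have JX: "nform ((t, J) # X)" using X J False by (auto simp: nform_Cons core_def syl_def simp del: core_nform)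
  then have "nform ?Z" using Y by (auto simp: nform_append nform_word_inv core_def word_inv_ends simp del: core_nform)
  then have "core t ?Z" using X Y by (auto simp: core_def hd_append word_inv_ends simp del: core_nform)
  moreover have "inv (ev Y) \<otimes> J \<otimes> ev X = ev ?Z"
    using JX X Y J ev_append[OF nform_word_inv JX, of Y] by (simp add: m_assoc)
  moreover have "length Y > 0" "length X > 0" using X Y by (auto simp: core_def simp del: core_nform)
  then have "length Y + Suc (length X) \<ge> 3" by linarith
  then have "length ?Z \<ge> 3" by simp
  ultimately show thesis using that by blast
qed

text \<open>The ends of \<open>w'\<close> have different tags, which leaves only the rotation
  outcome of \<open>conj_cyclic_nform\<close>.\<close>

lemma conj_by_length:
  assumes "cyclic_nform w" "cyclic_nform w'" "c \<in> carrier G" "d \<in> carrier G"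
    and "conj_by c (ev w) = conj_by d (ev w')"
  obtains i where "i < length w" "w' = rotate i w"
proof -
  let ?h = "inv c \<otimes> d"
  have w: "ev w \<in> carrier G" "ev w' \<in> carrier G" using assms by (auto simp: cyclic_nform_def)
  have "conj_by (inv c) (conj_by c (ev w)) = conj_by (inv c) (conj_by d (ev w'))" using assms by simp
  then have "ev w = conj_by ?h (ev w')" using assms(3,4) w by (simp add: conj_by_conj)
  then have "ev w \<otimes> ?h = ?h \<otimes> ev w'" using assms w by (simp add: conj_by_def m_assoc)
  then have "shifts G snd w (ev (nf ?h)) w'"
    using conj_cyclic_nform[OF assms(1), of w' "nf ?h"] assms by (auto simp: cyclic_nform_def)
  then show thesis using that by (auto simp: shifts_def)
qed

text \<open>The only property of [u, v] that the descent uses. It survives moves and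
  conjugation.\<close>

definition short_commutator :: "'a \<Rightarrow> 'a \<Rightarrow> bool" where
  "short_commutator x y \<longleftrightarrow>
     (\<exists>w c. cyclic_nform w \<and> length w = 4 \<and> c \<in> carrier G \<and> commutator G x y = conj_by c (ev w))"

lemma short_commutator_rel:
  assumes "nielsen_conj_rel x y a b" "short_commutator x y" "x \<in> carrier G" "y \<in> carrier G"
  shows "short_commutator a b"
proof -
  obtain w c where w: "cyclic_nform w" "length w = 4" "c \<in> carrier G" "commutator G x y = conj_by c (ev w)"
    using assms(2) by (auto simp: short_commutator_def)
  obtain d where d: "d \<in> carrier G" "commutator G x y = conj_by d (commutator G a b)"
    using nielsen_conj_rel_commutator[OF assms(1,3,4)] by blast
  have ab: "a \<in> carrier G" "b \<in> carrier G" using assms(1) by (auto simp: nielsen_conj_rel_def)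
  have "conj_by (inv d) (conj_by c (ev w)) = conj_by (inv d) (conj_by d (commutator G a b))"
    using w d by simp
  then have "commutator G a b = conj_by (inv d \<otimes> c) (ev w)"
    using w d ab by (simp add: conj_by_conj cyclic_nform_def)
  then show ?thesis unfolding short_commutator_def using w d by blast
qed

text \<open>Every vertex is a translate of one of the two base vertices. Conjugation in
  \<open>nielsen_conj_rel\<close> accounts for the translates and \<open>s\<close> for the two
  types, so the comparison is with all vertices.\<close>

definition minimal :: "bool \<Rightarrow> 'a \<Rightarrow> 'a \<Rightarrow> bool" where
  "minimal t x y \<longleftrightarrow> (\<forall>a b s. nielsen_conj_rel x y a b \<longrightarrow> disp t x + disp t y \<le> disp s a + disp s b)"

lemma minimal_rel:
  assumes "minimal t x y" "nielsen_conj_rel x y a b" "x \<in> carrier G" "y \<in> carrier G"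
    "disp t a + disp t b = disp t x + disp t y"
  shows "minimal t a b"
  using assms nielsen_conj_rel_trans unfolding minimal_def by metis

text \<open>
  The paths in the tree that start at the vertex of \<open>C t\<close> and lead to its images under \<open>x\<close>
  and \<open>y\<close> begin with the same edge here. Minimality under conjugation excludes cancellation at
  the junctions adjacent to this one in the cyclic word \<open>x\<^sup>-\<^sup>1 y\<^sup>-\<^sup>1 x y\<close>, and minimality under
  Nielsen moves bounds the cancellation at this and the opposite junction. A cyclic length
  of 4 then forces all displacements to be 1, and \<open>x y\<^sup>-\<^sup>1\<close> fixes a vertex, which is smaller still.
\<close>

lemma minimal_junction:
  assumes min: "minimal t x y" and short: "short_commutator x y"
    and X: "core t X" and Y: "core t Y" and k: "k0 \<in> C t" "k1 \<in> C t" "k2 \<in> C t"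
    and x: "x = k0 \<otimes> ev X \<otimes> k1" and y: "y = k0 \<otimes> ev Y \<otimes> k2"
  shows False
proof -
  have c: "ev X \<in> carrier G" "ev Y \<in> carrier G" "k0 \<in> carrier G" "k1 \<in> carrier G" "k2 \<in> carrier G"
    using X Y k by auto
  have xy: "x \<in> carrier G" "y \<in> carrier G" using c by (simp_all add: x y)
  have d: "disp t x = disp t (ev X)" "disp t y = disp t (ev Y)"
    using disp_pad_core X Y k by (simp_all add: x y)
  have pos: "disp t (ev X) \<ge> 1" "disp t (ev Y) \<ge> 1" using core_disp_pos X Y by blast+
  have min': "disp t (ev X) + disp t (ev Y) \<le> disp s a + disp s b" if "nielsen_conj_rel x y a b" for s a b
    using min that d by (simp add: minimal_def)
  have other: "disp (\<not> t) (ev Z \<otimes> l) + 1 = disp t (ev Z) + of_bool (l \<noteq> \<one>)" if "core t Z" "l \<in> C t" for Z l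
    using disp_other_core[OF that(1) C_one that(2)] that by simp
  have "nielsen_conj_rel x y (conj_by (inv k0) x) (conj_by (inv k0) y)"
    using nielsen_conj_rel_conj[OF xy] c by simp
  then have shift: "nielsen_conj_rel x y (ev X \<otimes> (k1 \<otimes> k0)) (ev Y \<otimes> (k2 \<otimes> k0))"
    using c by (simp add: conj_by_def x y m_assoc)
  \<comment> \<open>If one of these were trivial, the adjacent vertex of the other type, after
    conjugation by \<open>inv k0\<close>, would have smaller total displacement.\<close>
  have J: "k1 \<otimes> k0 \<noteq> \<one>" "k2 \<otimes> k0 \<noteq> \<one>"
    using min'[OF shift, of "\<not> t"] other[OF X, of "k1 \<otimes> k0"] other[OF Y, of "k2 \<otimes> k0"] k
    by (auto simp: of_bool_def split: if_splits)
  let ?J4 = "k2 \<otimes> inv k1"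
  have lr: "nielsen_conj_rel x y (inv y \<otimes> x) y" "nielsen_conj_rel x y x (inv x \<otimes> y)"
    using nielsen_conj_relI[OF xy] nielsen.left_inv nielsen.right_inv nielsen.refl by metis+
  have "nielsen_conj_rel x y (conj_by y (inv y \<otimes> x)) (conj_by y y)"
    "nielsen_conj_rel x y (conj_by x x) (conj_by x (inv x \<otimes> y))"
    using nielsen_conj_rel_trans[OF lr(1) nielsen_conj_rel_conj] nielsen_conj_rel_trans[OF lr(2) nielsen_conj_rel_conj] xy
    by simp_all
  then have rl: "nielsen_conj_rel x y (x \<otimes> inv y) y" "nielsen_conj_rel x y x (y \<otimes> inv x)"
    using xy by (simp_all add: conj_by_def m_assoc)
  have B: "disp t (inv y \<otimes> x) = disp t (inv (ev Y) \<otimes> \<one> \<otimes> ev X)"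
  proof -
    have "inv y \<otimes> x = inv k2 \<otimes> (inv (ev Y) \<otimes> \<one> \<otimes> ev X) \<otimes> k1"
      using c by (simp add: x y m_assoc inv_mult_group)
    then show ?thesis using disp_mult_C k c by simp
  qed
  have "disp t (inv x \<otimes> y) = disp t (inv y \<otimes> x)"
    using disp_inv[of "inv y \<otimes> x" t] xy by (simp add: inv_mult_group)
  then have "disp t (ev X) \<le> disp t (inv (ev Y) \<otimes> \<one> \<otimes> ev X)"
      "disp t (ev Y) \<le> disp t (inv (ev Y) \<otimes> \<one> \<otimes> ev X)"
    using min'[OF lr(1), of t] min'[OF lr(2), of t] d B by simp_all
  then obtain ZB where ZB: "core t ZB" "inv (ev Y) \<otimes> \<one> \<otimes> ev X = ev ZB"
    "disp t (ev X) \<le> disp t (ev ZB)" "disp t (ev Y) \<le> disp t (ev ZB)"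
    using quotient_of_cores_with[OF X Y C_one] by metis
  \<comment> \<open>The junction in y x^-1 is read through the inverse words, so that the same
    quotient lemma applies. Here the middle element \<open>?J4\<close> may be trivial.\<close>
  let ?Aexp = "inv (ev (word_inv Y)) \<otimes> ?J4 \<otimes> ev (word_inv X)"
  have Aexp: "?Aexp = ev Y \<otimes> ?J4 \<otimes> inv (ev X)" using X Y by simp
  have A: "disp t (y \<otimes> inv x) = disp t ?Aexp"
  proof -
    have "y \<otimes> inv x = k0 \<otimes> ?Aexp \<otimes> inv k0"
      unfolding Aexp using c by (simp add: x y m_assoc inv_mult_group)
    then show ?thesis using disp_mult_C[of ?Aexp k0 t "inv k0"] k c Aexp by simp
  qed
  have "disp t (x \<otimes> inv y) = disp t (y \<otimes> inv x)"
    using disp_inv[of "y \<otimes> inv x" t] xy by (simp add: inv_mult_group)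
  then have "disp t (ev (word_inv X)) \<le> disp t ?Aexp" "disp t (ev (word_inv Y)) \<le> disp t ?Aexp"
    using min'[OF rl(1), of t] min'[OF rl(2), of t] d A X Y by simp_all
  then obtain ZA where ZA: "core t ZA" "?Aexp = ev ZA" "?J4 \<noteq> \<one> \<Longrightarrow> length ZA \<ge> 3"
    using quotient_of_cores_with[OF core_word_inv[OF X] core_word_inv[OF Y], of ?J4] k by auto
  let ?J1 = "inv (k2 \<otimes> k0)" and ?J3 = "k1 \<otimes> k0"
  \<comment> \<open>Reading x^-1 y^-1 x y cyclically from the last \<open>Y\<close>:
    \<open>ZA\<close> replaces Y J4 X^-1, and \<open>ZB\<close> replaces Y^-1 X, where the common
    \<open>k0\<close> has cancelled.\<close>
  let ?W = "ZA @ (t, ?J1) # ZB @ [(t, ?J3)]"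
  have W1: "nform (ZB @ [(t, ?J3)])" using ZB(1) J k by (auto simp: nform_append nform_Cons core_def syl_def simp del: core_nform)
  have W2: "nform ((t, ?J1) # ZB @ [(t, ?J3)])"
    using W1 ZB(1) J k c by (auto simp: nform_Cons core_def syl_def hd_append inv_eq_1_iff simp del: core_nform)
  have "cyclic_nform ?W" unfolding cyclic_nform_def nform_append[of ZA]
    using W2 ZA(1) by (auto simp: core_def simp del: core_nform)
  moreover have "commutator G x y = conj_by (inv (ev Y \<otimes> k2)) (ev ?W)"
  proof -
    have "ev ?W = ev ZA \<otimes> (?J1 \<otimes> (ev ZB \<otimes> ?J3))"
      using ev_append[of ZA, OF _ W2] ev_append[of ZB "[(t, ?J3)]"] W1 ZA(1) ZB(1) c
      by (simp add: nform_append)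
    then have eW: "ev ?W = ev Y \<otimes> ?J4 \<otimes> inv (ev X) \<otimes> (?J1 \<otimes> (inv (ev Y) \<otimes> \<one> \<otimes> ev X \<otimes> ?J3))"
      using ZA(2) ZB(2) Aexp by simp
    show ?thesis unfolding eW
      using c by (simp add: conj_by_def commutator_def x y m_assoc inv_mult_group)
  qed
  moreover have "inv (ev Y \<otimes> k2) \<in> carrier G" using c by simp
  ultimately have "length ?W = 4"
    using short conj_by_length unfolding short_commutator_def by (metis length_rotate)
  then have "length ZA + length ZB = 2" by simp
  moreover have "length ZA > 0" "length ZB > 0" using ZA ZB by (auto simp: core_def simp del: core_nform)
  ultimately have len: "length ZA = 1" "length ZB = 1" by linarith+
  have "disp t (ev ZB) = 1" using core_length[OF ZB(1)] len by simp
  then have dXY: "disp t (ev X) = 1" "disp t (ev Y) = 1" using ZB(3,4) pos by simp_all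
  then have "length X = 1" "length Y = 1" using core_length X Y by force+
  then obtain p q where pq: "X = [p]" "Y = [q]" by (metis One_nat_def length_0_conv length_Suc_conv)
  have "?J4 = \<one>" using ZA(3) len by fastforce
  then have k12: "k2 = k1" using c by (metis inv_closed inv_inv inv_mult_one_iff(2))
  \<comment> \<open>As k2 = k1, conjugation by \<open>inv k0\<close> takes (x y^-1, y) to (X Y^-1, Y
    k2 k0). At the vertex of \<open>C (\<not> t)\<close> the first entry moves nothing and the
    second counts at most 1, against a minimum of 2.\<close>
  have "nielsen_conj_rel x y (conj_by (inv k0) (x \<otimes> inv y)) (conj_by (inv k0) y)"
    using nielsen_conj_rel_trans[OF rl(1) nielsen_conj_rel_conj] xy c by simp
  then have "nielsen_conj_rel x y (ev X \<otimes> inv (ev Y)) (ev Y \<otimes> (k2 \<otimes> k0))"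
    using c k12 by (simp add: conj_by_def x y m_assoc inv_mult_group)
  from min'[OF this, of "\<not> t"] have "2 \<le> disp (\<not> t) (ev X \<otimes> inv (ev Y)) + disp (\<not> t) (ev Y \<otimes> (k2 \<otimes> k0))"
    using dXY by simp
  moreover have "disp (\<not> t) (ev Y \<otimes> (k2 \<otimes> k0)) \<le> 1"
    using other[OF Y, of "k2 \<otimes> k0"] k dXY by simp
  moreover have "ev X \<otimes> inv (ev Y) \<in> C (\<not> t)"
  proof -
    have "fst p = (\<not> t)" "fst q = (\<not> t)" "syl p" "syl q"
      using X Y pq by (auto simp: core_def nform_Cons simp del: core_nform)
    then show ?thesis using pq by (simp add: syl_def)
  qed
  ultimately show False using disp_0_iff[of "ev X \<otimes> inv (ev Y)" "\<not> t"] c by simp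
qed

text \<open>If both entries moved the base vertex, the four elements between consecutive cores in
  the cyclic commutator word would be nontrivial, each by \<open>minimal_junction\<close> applied to
  a rotated pair. No cancellation is then left, and the word is too long.\<close>

lemma minimal_elliptic:
  assumes xy: "x \<in> carrier G" "y \<in> carrier G" and min: "minimal t x y" and short: "short_commutator x y"
  shows "x \<in> C t \<or> y \<in> C t"
proof (rule ccontr)
  assume "\<not> (x \<in> C t \<or> y \<in> C t)"
  then obtain k0 X k1 l0 Y l1 where k: "k0 \<in> C t" "k1 \<in> C t" "l0 \<in> C t" "l1 \<in> C t"
    and X: "core t X" and Y: "core t Y" and x: "x = k0 \<otimes> ev X \<otimes> k1" and y: "y = l0 \<otimes> ev Y \<otimes> l1"
    using core_decomp xy by metis
  have c: "ev X \<in> carrier G" "ev Y \<in> carrier G" "k0 \<in> carrier G" "k1 \<in> carrier G"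
    "l0 \<in> carrier G" "l1 \<in> carrier G" using X Y k by auto
  have ix: "inv x = inv k1 \<otimes> ev (word_inv X) \<otimes> inv k0" and iy: "inv y = inv l1 \<otimes> ev (word_inv Y) \<otimes> inv l0"
    using c X Y by (simp_all add: x y inv_mult_group m_assoc)
  have rel: "minimal t a b \<and> short_commutator a b"
    if "nielsen_conj_rel x y a b" "disp t a + disp t b = disp t x + disp t y" for a b
    using minimal_rel[OF min that(1) xy that(2)] short_commutator_rel[OF that(1) short xy] by blast
  have rot: "minimal t (inv y) x \<and> short_commutator (inv y) x" "minimal t y (inv x) \<and> short_commutator y (inv x)"
    "minimal t (inv x) (inv y) \<and> short_commutator (inv x) (inv y)"
    using rel[OF nielsen_conj_rel_rotate_inv[OF xy]] rel[OF nielsen_conj_rel_rotate[OF xy]]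
      rel[OF nielsen_conj_rel_invs[OF xy]] xy by simp_all
  note iX = core_word_inv[OF X] and iY = core_word_inv[OF Y]
  have 1: "inv l1 \<noteq> k0"
  proof
    assume e: "inv l1 = k0"
    show False by (rule minimal_junction[OF rot(1)[THEN conjunct1] rot(1)[THEN conjunct2]
          iY X k(1) C_inv[OF k(3)] k(2) iy[unfolded e] x])
  qed
  have 2: "l0 \<noteq> k0"
  proof
    assume e: "l0 = k0"
    show False by (rule minimal_junction[OF min short X Y k(1,2,4) x y[unfolded e]])
  qed
  have 3: "inv k1 \<noteq> l0"
  proof
    assume e: "inv k1 = l0"
    show False by (rule minimal_junction[OF rot(2)[THEN conjunct1] rot(2)[THEN conjunct2]
          Y iX k(3,4) C_inv[OF k(1)] y ix[unfolded e]])
  qed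
  have 4: "inv k1 \<noteq> inv l1"
  proof
    assume e: "inv k1 = inv l1"
    show False by (rule minimal_junction[OF rot(3)[THEN conjunct1] rot(3)[THEN conjunct2]
          iX iY C_inv[OF k(4)] C_inv[OF k(1)] C_inv[OF k(3)] ix[unfolded e] iy])
  qed
  \<comment> \<open>Four junction syllables and four nonempty cores give cyclic length at least 8,
    not 4.\<close>
  let ?J1 = "inv (l1 \<otimes> k0)" and ?J2 = "inv l0 \<otimes> k0" and ?J3 = "k1 \<otimes> l0" and ?J4 = "l1 \<otimes> inv k1"
  have J: "?J1 \<noteq> \<one>" "?J2 \<noteq> \<one>" "?J3 \<noteq> \<one>" "?J4 \<noteq> \<one>"
    using 1 2 3 4 c by (auto simp: inv_mult_one_iff inv_eq_1_iff)
  have s: "syl (t, ?J1)" "syl (t, ?J2)" "syl (t, ?J3)" "syl (t, ?J4)"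
    using J k unfolding syl_def fst_conv snd_conv by (intro conjI C_inv C_mult; simp)+
  let ?W4 = "(t, ?J3) # Y @ [(t, ?J4)]"
  let ?W3 = "(t, ?J2) # X @ ?W4"
  let ?W2 = "(t, ?J1) # word_inv Y @ ?W3"
  let ?W = "word_inv X @ ?W2"
  have W4: "nform (Y @ [(t, ?J4)])" "nform ?W4" using s Y by (auto simp: nform_Cons nform_append core_def simp del: core_nform)
  have W3: "nform (X @ ?W4)" "nform ?W3" using s X W4 by (auto simp: nform_Cons nform_append core_def simp del: core_nform)
  have W2: "nform (word_inv Y @ ?W3)" "nform ?W2" using s iY W3 by (auto simp: nform_Cons nform_append core_def simp del: core_nform)
  have W: "cyclic_nform ?W"
    using s iX W2 by (auto simp: cyclic_nform_def nform_append core_def hd_append simp del: core_nform)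
  have "ev ?W = inv (ev X) \<otimes> (?J1 \<otimes> (inv (ev Y) \<otimes> (?J2 \<otimes> (ev X \<otimes> (?J3 \<otimes> (ev Y \<otimes> ?J4))))))"
    using ev_append[OF core_nform[OF iX] W2(2)] ev_append[OF core_nform[OF iY] W3(2)]
      ev_append[OF core_nform[OF X] W4(2)] ev_append[of Y "[(t, ?J4)]"] W4(1) X Y c
    by (simp add: nform_append)
  then have "commutator G x y = conj_by (inv k1) (ev ?W)"
    using c by (simp add: commutator_def conj_by_def x y m_assoc inv_mult_group)
  then have "length ?W = 4"
    using short W conj_by_length c unfolding short_commutator_def by (metis inv_closed length_rotate)
  moreover have "length X > 0" "length Y > 0" using X Y by (auto simp: core_def simp del: core_nform)
  ultimately show False by simp
qed

theorem short_commutator_elliptic: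
  assumes xy: "x \<in> carrier G" "y \<in> carrier G" and short: "short_commutator x y"
  obtains t a b where "nielsen_conj_rel x y a b" "a \<in> C t"
proof -
  have refl: "nielsen_conj_rel x y x y" using nielsen_conj_relI[OF xy] nielsen.refl by blast
  define P where "P n \<longleftrightarrow> (\<exists>a b t. nielsen_conj_rel x y a b \<and> n = disp t a + disp t b)" for n
  have "P (disp True x + disp True y)" unfolding P_def using refl by blast
  then have "P (LEAST n. P n)" by (rule LeastI)
  then obtain a b t where ab: "nielsen_conj_rel x y a b" "(LEAST n. P n) = disp t a + disp t b"
    unfolding P_def by blast
  then have cab: "a \<in> carrier G" "b \<in> carrier G" by (auto simp: nielsen_conj_rel_def)
  have "minimal t a b" unfolding minimal_def
  proof (intro allI impI)
    fix a' b' s assume "nielsen_conj_rel a b a' b'"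
    then have "nielsen_conj_rel x y a' b'" using nielsen_conj_rel_trans[OF ab(1) _ xy] by simp
    then have "P (disp s a' + disp s b')" unfolding P_def by blast
    then show "disp t a + disp t b \<le> disp s a' + disp s b'" unfolding ab(2)[symmetric] by (rule Least_le)
  qed
  then consider "a \<in> C t" | "b \<in> C t"
    using minimal_elliptic[OF cab] short_commutator_rel[OF ab(1) short xy] by blast
  then show thesis
    using that[OF ab(1)] that[OF nielsen_conj_rel_trans[OF ab(1) nielsen_conj_rel_rotate[OF cab] xy]]
    by cases
qed

end

section \<open>Pairs with an elliptic entry\<close>

context free_prod
begin

definition commutator_word :: "bool \<Rightarrow> 'a \<Rightarrow> 'a \<Rightarrow> (bool \<times> 'a) list" where
  "commutator_word t a b = [(t, inv a), (\<not> t, inv b), (t, a), (\<not> t, b)]"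

lemma ev_commutator_word:
  "a \<in> C t \<Longrightarrow> b \<in> C (\<not> t) \<Longrightarrow> ev (commutator_word t a b) = commutator G a b"
  using C_carrier[of a t] C_carrier[of b "\<not> t"]
  by (simp add: commutator_word_def commutator_def m_assoc)

lemma cyclic_nform_commutator_word:
  "a \<in> C t \<Longrightarrow> a \<noteq> \<one> \<Longrightarrow> b \<in> C (\<not> t) \<Longrightarrow> b \<noteq> \<one> \<Longrightarrow> cyclic_nform (commutator_word t a b)"
  using C_carrier[of a t] C_carrier[of b "\<not> t"]
  by (simp add: commutator_word_def cyclic_nform_def nform_Cons syl_def inv_eq_1_iff)

lemma less_4_cases: "(i::nat) < 4 \<Longrightarrow> i = 0 \<or> i = 1 \<or> i = 2 \<or> i = 3"
  by linarith

text \<open>Rotation by an odd number exchanges the tags. Of the even ones, rotation by 2 replaces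
  both entries by their inverses.\<close>

lemma rotate_commutator_word:
  assumes "i < 4" "[(t, a'), (\<not> t, b'), (t, a''), (\<not> t, b'')] = rotate i (commutator_word t a b)"
  shows "a' = inv a \<and> b' = inv b \<and> a'' = a \<and> b'' = b \<or>
    a' = a \<and> b' = b \<and> a'' = inv a \<and> b'' = inv b"
  using less_4_cases[OF assms(1)] assms(2)
  by (elim disjE) (simp_all add: commutator_word_def numeral_2_eq_2 numeral_3_eq_3)

lemma conj_not_in_C:
  assumes a: "a \<in> C t" "a \<noteq> \<one>" and b: "b \<in> C (\<not> t)" "b \<noteq> \<one>" and c: "c \<in> carrier G"
  shows "conj_by c (commutator G a b) \<notin> C s"
proof
  let ?w = "commutator_word t a b" and ?g = "conj_by c (commutator G a b)"
  assume g: "?g \<in> C s"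
  have w: "cyclic_nform ?w" "ev ?w = commutator G a b" "length ?w = 4"
    using a b by (simp_all add: cyclic_nform_commutator_word ev_commutator_word)
      (simp add: commutator_word_def)
  have ab: "a \<in> carrier G" "b \<in> carrier G" using a b by (auto intro: C_carrier)
  have "ev ?w \<otimes> inv c = inv c \<otimes> ?g" using w c ab by (simp add: conj_by_def m_assoc)
  then have "ev ?w \<otimes> ev (nf (inv c)) = ev (nf (inv c)) \<otimes> ev (pad s ?g)" using c g by simp
  then have "length (pad s ?g) \<ge> 4"
    using conj_cyclic_nform[OF w(1) nform_pad[OF g] nform_nf[of "inv c"]] c w(3)
    by (auto simp: shifts_def)
  then show False by (simp add: pad_def split: if_splits)
qed

text \<open>Conjugating by \<open>k1\<close> gathers the outer elements of \<open>y\<close> into one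
  factor \<open>k\<close> in front of \<open>Y\<close>. The commutator then has a cyclic normal form
  of length 2 |Y| + 2, so \<open>Y\<close> is a single syllable. Matching with a rotation of the
  commutator word of (a, b) identifies both entries up to common inversion and shows that
  \<open>k\<close> commutes with \<open>a\<close>.\<close>

lemma elliptic_form:
  assumes x: "x \<in> C t" and y: "y \<in> carrier G"
    and a: "a \<in> C t" "a \<noteq> \<one>" and b: "b \<in> C (\<not> t)" "b \<noteq> \<one>" and c: "c \<in> carrier G"
    and eq: "commutator G x y = conj_by c (commutator G a b)"
  shows "\<exists>z\<in>C t. z \<otimes> a = a \<otimes> z \<and> nielsen_conj_rel x y a (z \<otimes> b)"
proof -
  have carr: "x \<in> carrier G" "a \<in> carrier G" "b \<in> carrier G" using x a b by (auto intro: C_carrier)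
  have nC: "commutator G x y \<notin> C s" for s
    using conj_not_in_C[OF a b c] eq by simp
  have "y \<notin> C t" using nC[of t] x by (auto simp: commutator_def)
  then obtain k0 Y k1 where Y: "k0 \<in> C t" "core t Y" "k1 \<in> C t" "y = k0 \<otimes> ev Y \<otimes> k1"
    using core_decomp y by blast
  define k where "k = k1 \<otimes> k0"
  define x1 where "x1 = conj_by k1 x"
  have k: "k \<in> C t" "k \<in> carrier G" "k0 \<in> carrier G" "k1 \<in> carrier G" "ev Y \<in> carrier G"
    using Y by (auto simp: k_def)
  have x1: "x1 \<in> C t" "x1 \<in> carrier G" using x Y by (auto simp: x1_def conj_by_def)
  have y1: "conj_by k1 y = k \<otimes> ev Y" using k by (simp add: Y(4) k_def conj_by_def m_assoc)
  have rel: "nielsen_conj_rel x y x1 (k \<otimes> ev Y)"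
    using nielsen_conj_rel_conj[OF carr(1) y k(4)] y1 by (simp add: x1_def)
  have "x \<noteq> \<one>" using nC[of t] y by (auto simp: commutator_def)
  then have x1n: "x1 \<noteq> \<one>" using k carr by (auto simp: x1_def conj_by_def inv_solve_right')
  let ?x2 = "inv k \<otimes> x1 \<otimes> k"
  have x2: "?x2 \<in> C t" "?x2 \<noteq> \<one>"
    using k x1 x1n by (auto simp: m_assoc inv_mult_one_iff)
  let ?W = "(t, inv x1) # word_inv Y @ (t, ?x2) # Y"
  have W1: "nform ((t, ?x2) # Y)" using x2 Y(2) by (auto simp: nform_Cons core_def syl_def simp del: core_nform)
  have W2: "nform (word_inv Y @ (t, ?x2) # Y)"
    using W1 core_word_inv[OF Y(2)] by (auto simp: nform_append core_def simp del: core_nform)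
  have W: "cyclic_nform ?W"
    using W2 x1 x1n core_word_inv[OF Y(2)] Y(2)
    by (auto simp: nform_Cons core_def cyclic_nform_def syl_def inv_eq_1_iff hd_append simp del: core_nform)
  have "commutator G x1 (k \<otimes> ev Y) = ev ?W"
    using W1 core_word_inv[OF Y(2)] ev_append[OF core_nform[OF core_word_inv[OF Y(2)]] W1] x1 k Y(2)
    by (simp add: commutator_def m_assoc inv_mult_group)
  moreover have "commutator G x1 (k \<otimes> ev Y) = conj_by k1 (commutator G x y)"
    using conj_by_commutator[OF k(4) carr(1) y] y1 by (simp add: x1_def)
  ultimately have eW: "conj_by (k1 \<otimes> c) (commutator G a b) = conj_by \<one> (ev ?W)"
    using eq c carr k W by (simp add: conj_by_conj cyclic_nform_def del: ev_simps)
  obtain i where i: "i < length (commutator_word t a b)" "?W = rotate i (commutator_word t a b)"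
    using conj_by_length[OF cyclic_nform_commutator_word[OF a b] W _ one_closed,
        unfolded ev_commutator_word[OF a(1) b(1)], OF _ eW] c k by blast
  then have "length ?W = 4" by (simp only: length_rotate) (simp add: commutator_word_def)
  then have "length Y = 1" by simp
  then obtain p where "Y = [p]" by (metis One_nat_def length_0_conv length_Suc_conv)
  then have p: "Y = [(\<not> t, snd p)]" "snd p \<in> C (\<not> t)" "snd p \<in> carrier G" using Y(2)
    by (cases p; auto simp: core_def nform_Cons syl_def simp del: core_nform)+
  have "[(t, inv x1), (\<not> t, inv (snd p)), (t, ?x2), (\<not> t, snd p)] = rotate i (commutator_word t a b)"
    using i(2) by (subst (asm) (1 2) p(1)) simp
  then consider "inv x1 = inv a" "?x2 = a" "snd p = b" | "inv x1 = a" "?x2 = inv a" "snd p = inv b"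
    using rotate_commutator_word[of i t "inv x1" "inv (snd p)" ?x2 "snd p" a b] i(1) p(3) carr
    by (auto simp: commutator_word_def)
  then show ?thesis
  proof cases
    case 1
    then have "x1 = a" using x1 carr by (metis inv_inv)
    moreover have "k \<otimes> a = a \<otimes> k" using 1(2) \<open>x1 = a\<close> k carr
      by (metis inv_mult_cancel(2) m_assoc m_closed inv_closed)
    moreover have "ev Y = b" using p 1 by (subst p(1)) simp
    ultimately show ?thesis using rel k by blast
  next
    case 2
    then have x1a: "x1 = inv a" using x1 carr by (metis inv_inv)
    have "inv k \<otimes> inv a \<otimes> k = inv a" using 2(2) x1a by simp
    then have "inv a \<otimes> k = k \<otimes> inv a" using k carr by (metis inv_mult_cancel(2) m_assoc m_closed inv_closed)
    then have com: "k \<otimes> a = a \<otimes> k" using k carr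
      by (metis inv_closed inv_mult_cancel(1,2) m_assoc m_closed r_inv r_one)
    have com': "inv k \<otimes> a = a \<otimes> inv k" using commute_inv com k carr by simp
    have "ev Y = inv b" using p 2 by (subst p(1)) simp
    then have "nielsen_conj_rel x y (inv a) (k \<otimes> inv b)" using rel x1a by simp
    \<comment> \<open>Inverting both entries puts \<open>inv k\<close> on the right of
      \<open>b\<close>. Conjugation by \<open>inv k\<close>, which fixes \<open>a\<close>, moves it
      to the left.\<close>
    then have "nielsen_conj_rel x y a (b \<otimes> inv k)"
      using nielsen_conj_rel_trans[OF _ nielsen_conj_rel_invs, of x y "inv a" "k \<otimes> inv b"] carr y k
      by (simp add: inv_mult_group)
    then have "nielsen_conj_rel x y (conj_by (inv k) a) (conj_by (inv k) (b \<otimes> inv k))"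
      using nielsen_conj_rel_trans[OF _ nielsen_conj_rel_conj] carr y k by simp
    moreover have "conj_by (inv k) a = a" using com k carr by (simp add: conj_by_def com' m_assoc)
    moreover have "conj_by (inv k) (b \<otimes> inv k) = inv k \<otimes> b" using k carr by (simp add: conj_by_def m_assoc)
    ultimately show ?thesis using com' k by (intro bexI[of _ "inv k"]) simp_all
  qed
qed

text \<open>A conjugator fixing the commutator word is a power times a prefix of length
  \<open>i\<close>, where rotation by \<open>i\<close> fixes the word. Tags exclude odd
  \<open>i\<close>, and \<open>i = 2\<close> would make \<open>a\<close> its own inverse.\<close>

lemma centralizer_commutator:
  assumes a: "a \<in> C t" "a \<otimes> a \<noteq> \<one>" and b: "b \<in> C (\<not> t)" "b \<noteq> \<one>"
    and c: "c \<in> carrier G" "conj_by c (commutator G a b) = commutator G a b"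
  shows "\<exists>k::int. c = commutator G a b [^] k"
proof -
  let ?w = "commutator_word t a b"
  have carr: "a \<in> carrier G" "b \<in> carrier G" using a b by (auto intro: C_carrier)
  have "a \<noteq> \<one>" using a by auto
  then have w: "cyclic_nform ?w" "ev ?w = commutator G a b" "length ?w = 4"
    using a b by (simp_all add: cyclic_nform_commutator_word ev_commutator_word)
      (simp add: commutator_word_def)
  have "ev ?w \<otimes> ev (nf c) = ev (nf c) \<otimes> ev ?w"
    using c carr w by (simp add: conj_by_fix_iff)
  then have "shifts G snd ?w (ev (nf c)) ?w"
    using conj_cyclic_nform[OF w(1) _ nform_nf[OF c(1)]] w(1) by (auto simp: cyclic_nform_def)
  then have "shifts G snd ?w c ?w" using c(1) by simp
  then obtain k :: int and i where ki: "i < 4" "rotate i ?w = ?w"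
    "c = ev ?w [^] k \<otimes> ev (take i ?w)"
    using w(3) by (auto simp: shifts_def ev_def)
  have "inv a \<noteq> a" using a carr by (metis r_inv)
  then have "i = 0" using less_4_cases[OF ki(1)] ki(2)
    by (elim disjE) (simp_all add: commutator_word_def numeral_2_eq_2 numeral_3_eq_3)
  then show ?thesis using ki(3) w carr by auto
qed

lemma solutions_nielsen:
  assumes u: "u \<in> A" "u \<otimes> u \<noteq> \<one>" and v: "v \<in> B" "v \<noteq> \<one>"
    and xy: "x \<in> carrier G" "y \<in> carrier G" "commutator G x y = commutator G u v"
  shows "(\<exists>z\<in>A. z \<otimes> u = u \<otimes> z \<and> nielsen x y u (z \<otimes> v)) \<or>
    (\<exists>z\<in>B. z \<otimes> v = v \<otimes> z \<and> nielsen x y (z \<otimes> u) v)"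
proof -
  have uC: "u \<in> C True" "u \<noteq> \<one>" "inv u \<noteq> \<one>" and vC: "v \<in> C (\<not> True)" using u v
    by (auto simp: C_def) (metis C_carrier C_def inv_eq_1_iff l_one)
  have carr: "u \<in> carrier G" "v \<in> carrier G" using uC vC by (auto intro: C_carrier)
  let ?T = "commutator G u v"
  have cent: "\<exists>k::int. c = ?T [^] k" if "c \<in> carrier G" "conj_by c ?T = ?T" for c
    using centralizer_commutator[OF uC(1) u(2) vC v(2) that] .
  let ?w = "commutator_word True u v"
  have w: "cyclic_nform ?w" "ev ?w = ?T"
    using cyclic_nform_commutator_word[OF uC(1,2) vC v(2)] ev_commutator_word[OF uC(1) vC] by auto
  have "commutator G x y = conj_by \<one> (ev ?w)" using xy w carr by simp
  then have "short_commutator x y" unfolding short_commutator_def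
    using w(1) by (intro exI[of _ ?w] exI[of _ \<one>]) (simp add: commutator_word_def)
  then obtain t p q where pq: "nielsen_conj_rel x y p q" "p \<in> C t"
    using short_commutator_elliptic xy by blast
  then have q: "p \<in> carrier G" "q \<in> carrier G" by (auto simp: nielsen_conj_rel_def)
  obtain d where d: "d \<in> carrier G" "?T = conj_by d (commutator G p q)"
    using nielsen_conj_rel_commutator[OF pq(1) xy(1,2)] xy(3) by metis
  have "conj_by (inv d) ?T = conj_by (inv d) (conj_by d (commutator G p q))" using d by simp
  then have pqT: "commutator G p q = conj_by (inv d) ?T" using d q by (simp add: conj_by_conj)
  show ?thesis
  proof (cases t)
    case True
    then have t: "t = True" by simp
    obtain z where "z \<in> C True" and z: "z \<otimes> u = u \<otimes> z" "nielsen_conj_rel p q u (z \<otimes> v)"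
      using elliptic_form[OF pq(2)[unfolded t] q(2) uC(1,2) vC v(2) inv_closed[OF d(1)] pqT] by blast
    then have z: "z \<in> A" "z \<otimes> u = u \<otimes> z" "nielsen_conj_rel p q u (z \<otimes> v)" by (simp_all add: C_def)
    have zc: "z \<in> carrier G" using z(1) C_carrier[of z True] by (simp add: C_def)
    have "nielsen_conj_rel x y u (z \<otimes> v)" using nielsen_conj_rel_trans[OF pq(1) z(3) xy(1,2)] .
    moreover have "commutator G u (z \<otimes> v) = ?T" using commutator_mult_right z(2) zc carr by simp
    ultimately have "nielsen x y u (z \<otimes> v)" using nielsen_of_conj_rel[OF _ xy(1,2) xy(3)] cent by blast
    then show ?thesis using z by blast
  next
    case False
    have t: "t = False" using False by simp
    have ui: "inv u \<in> C (\<not> False)" and vF: "v \<in> C False" using uC vC by simp_all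
    \<comment> \<open>[u, v] is conjugate to [v, u^-1] by a quarter turn, which lets
      \<open>elliptic_form\<close> serve the second factor with (v, u^-1) in the role of (a,
      b).\<close>
    have "commutator G p q = conj_by (inv d \<otimes> inv u) (commutator G v (inv u))"
    proof -
      have "?T = conj_by (inv u) (commutator G v (inv u))"
        using carr by (simp add: conj_by_def commutator_def m_assoc)
      then show ?thesis using pqT d(1) carr by (simp add: conj_by_conj)
    qed
    then obtain z where "z \<in> C False" and z: "z \<otimes> v = v \<otimes> z" "nielsen_conj_rel p q v (z \<otimes> inv u)"
      using elliptic_form[OF pq(2)[unfolded t] q(2) vF v(2) ui uC(3), of "inv d \<otimes> inv u"] d(1) carr by blast
    then have z: "z \<in> B" "z \<otimes> v = v \<otimes> z" "nielsen_conj_rel p q v (z \<otimes> inv u)" by (simp_all add: C_def)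
    have zc: "z \<in> carrier G" "inv z \<in> B" using z(1) C_carrier[of z False] C_inv[of z False]
      by (simp_all add: C_def)
    have com: "inv z \<otimes> v = v \<otimes> inv z" using commute_inv z(2) zc carr by simp
    have "nielsen_conj_rel x y v (z \<otimes> inv u)" using nielsen_conj_rel_trans[OF pq(1) z(3) xy(1,2)] .
    then have "nielsen_conj_rel x y (u \<otimes> inv z) v"
      using nielsen_conj_rel_trans[OF _ nielsen_conj_rel_rotate_inv, of x y v "z \<otimes> inv u"] xy zc carr
      by (simp add: inv_mult_group)
    \<comment> \<open>Conjugation by \<open>inv z\<close> fixes \<open>v\<close> and brings
      \<open>inv z\<close> to the left of \<open>u\<close>, giving the witness
      \<open>inv z\<close>.\<close>
    then have "nielsen_conj_rel x y (conj_by (inv z) (u \<otimes> inv z)) (conj_by (inv z) v)"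
      using nielsen_conj_rel_trans[OF _ nielsen_conj_rel_conj] xy zc carr by simp
    moreover have "conj_by (inv z) v = v" using zc carr by (simp add: conj_by_def com m_assoc)
    moreover have "conj_by (inv z) (u \<otimes> inv z) = inv z \<otimes> u" using zc carr by (simp add: conj_by_def m_assoc)
    ultimately have rel: "nielsen_conj_rel x y (inv z \<otimes> u) v" by simp
    have "commutator G (inv z \<otimes> u) v = ?T" using commutator_mult_left com zc carr by simp
    then have "nielsen x y (inv z \<otimes> u) v" using nielsen_of_conj_rel[OF rel xy(1,2) xy(3)] cent by blast
    then show ?thesis using zc com by blast
  qed
qed

end

section \<open>Separating the solutions\<close>

lemma free_product_swap:
  assumes "free_product G A B"
  shows "free_product G B A"
  unfolding free_product_def
proof (intro conjI allI impI)
  show "group G" "subgroup A G" "subgroup B G" "generate G (B \<union> A) = carrier G"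
    using assms by (simp_all add: free_product_def Un_commute)
  fix w :: "(bool \<times> 'a) list"
  let ?v = "map (\<lambda>p. (\<not> fst p, snd p)) w"
  assume w: "w \<noteq> [] \<and> (\<forall>(t, g)\<in>set w. g \<in> (if t then B else A) - {\<one>\<^bsub>G\<^esub>}) \<and>
    successively (\<lambda>p q. fst p \<noteq> fst q) w"
  then have "?v \<noteq> []" "\<forall>(t, g)\<in>set ?v. g \<in> (if t then A else B) - {\<one>\<^bsub>G\<^esub>}"
    "successively (\<lambda>p q. fst p \<noteq> fst q) ?v"
    by (auto simp: successively_map split: if_splits)
  then have "list_prod G (map snd ?v) \<noteq> \<one>\<^bsub>G\<^esub>" using assms unfolding free_product_def by blast
  then show "list_prod G (map snd w) \<noteq> \<one>\<^bsub>G\<^esub>" by (simp add: comp_def)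
qed

lemma hom_BijGroup_of_action:
  fixes G :: "('a, 'b) monoid_scheme" (structure)
  assumes "group G"
    and closed: "\<And>g w. g \<in> carrier G \<Longrightarrow> w \<in> \<Omega> \<Longrightarrow> act g w \<in> \<Omega>"
    and mult: "\<And>g h w. g \<in> carrier G \<Longrightarrow> h \<in> carrier G \<Longrightarrow> w \<in> \<Omega> \<Longrightarrow>
      act (g \<otimes>\<^bsub>G\<^esub> h) w = act g (act h w)"
    and one: "\<And>w. w \<in> \<Omega> \<Longrightarrow> act \<one>\<^bsub>G\<^esub> w = w"
  shows "(\<lambda>g. \<lambda>w\<in>\<Omega>. act g w) \<in> hom G (BijGroup \<Omega>)"
proof -
  interpret group G by fact
  have bij: "(\<lambda>w\<in>\<Omega>. act g w) \<in> Bij \<Omega>" if g: "g \<in> carrier G" for g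
  proof -
    have "act (inv g) (act g w) = w" "act g (act (inv g) w) = w" if "w \<in> \<Omega>" for w
      using mult[of "inv g" g w] mult[of g "inv g" w] g that one by simp_all
    then have "bij_betw (act g) \<Omega> \<Omega>"
      using closed g by (intro bij_betw_byWitness[where f' = "act (inv g)"]) auto
    then show ?thesis by (simp add: Bij_def bij_betw_restrict_eq)
  qed
  show ?thesis
  proof (rule homI)
    fix g h assume gh: "g \<in> carrier G" "h \<in> carrier G"
    have "(\<lambda>w\<in>\<Omega>. act (g \<otimes> h) w) = compose \<Omega> (\<lambda>w\<in>\<Omega>. act g w) (\<lambda>w\<in>\<Omega>. act h w)"
      using gh mult closed by (auto simp: compose_def fun_eq_iff)
    then show "(\<lambda>w\<in>\<Omega>. act (g \<otimes> h) w) =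
        (\<lambda>w\<in>\<Omega>. act g w) \<otimes>\<^bsub>BijGroup \<Omega>\<^esub> (\<lambda>w\<in>\<Omega>. act h w)"
      using bij gh by (simp add: BijGroup_def)
  qed (use bij in \<open>simp add: BijGroup_def\<close>)
qed

lemma generate_fixes_point:
  fixes G :: "('a, 'b) monoid_scheme" (structure)
  assumes "group G" and h: "h \<in> hom G (BijGroup \<Omega>)" and "p \<in> \<Omega>" and "X \<subseteq> carrier G"
    and fix_p: "\<And>x. x \<in> X \<Longrightarrow> h x p = p" and "z \<in> generate G X"
  shows "h z p = p"
proof -
  interpret group G by fact
  interpret h: group_hom G "BijGroup \<Omega>" h
    using h by (simp add: group_hom_def group_hom_axioms_def group_BijGroup is_group)
  have mult: "h (a \<otimes> b) p = h a (h b p)" if "a \<in> carrier G" "b \<in> carrier G" for a b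
  proof -
    have "h a \<in> Bij \<Omega>" "h b \<in> Bij \<Omega>" using that h.hom_closed by (auto simp: BijGroup_def)
    then show ?thesis using h.hom_mult[OF that] \<open>p \<in> \<Omega>\<close> by (simp add: BijGroup_def compose_def)
  qed
  have one: "h \<one> p = p" using h.hom_one \<open>p \<in> \<Omega>\<close> by (simp add: BijGroup_def)
  show ?thesis using assms(6)
  proof induction
    case one show ?case by (fact \<open>h \<one> p = p\<close>)
  next
    case (incl x) then show ?case using fix_p by simp
  next
    case (inv x)
    then have "x \<in> carrier G" using \<open>X \<subseteq> carrier G\<close> by auto
    then show ?case using mult[of "inv x" x] one fix_p[OF inv] by simp
  next
    case (eng a b)
    then show ?case using mult generate_in_carrier[OF \<open>X \<subseteq> carrier G\<close>] by simp
  qed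
qed

text \<open>
  The group acts on \<open>(A / \<langle>U\<^sup>m\<rangle>) \<times> B\<close>: \<open>A\<close> by translating the first entry and \<open>B\<close> by translating
  the second one, twisted by a transposition chosen such that \<open>V\<^sup>n\<close> moves the base point to
  its image under \<open>U\<^sup>i\<close>. Then both generators fix the base point, while \<open>U\<^sup>d\<close> fixes it only
  if \<open>m\<close> divides \<open>d\<close>. If \<open>m\<close> divides \<open>i\<close>, a trivial action of \<open>B\<close> suffices.
\<close>

lemma power_in_generate:
  fixes G :: "('a, 'b) monoid_scheme" (structure) and m n :: nat and i d :: int
  assumes prod: "free_product G A B" and U: "U \<in> A" and V: "V \<in> B"
    and U_inf: "\<And>j::int. U [^] j = \<one> \<Longrightarrow> j = 0" and Vn: "V [^] n \<noteq> \<one>"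
    and gen: "U [^] d \<in> generate G {U [^] m, U [^] (- i) \<otimes> V [^] n}"
  shows "int m dvd d"
proof -
  interpret group G using prod by (simp add: free_product_def)
  have sub: "subgroup A G" "subgroup B G" using prod by (simp_all add: free_product_def)
  interpret A: subgroup A G by (fact sub(1))
  interpret B: subgroup B G by (fact sub(2))
  have grp: "group (G\<lparr>carrier := A\<rparr>)" "group (G\<lparr>carrier := B\<rparr>)"
    using sub subgroup_imp_group by blast+
  have Uc: "U \<in> carrier G" and Vc: "V \<in> carrier G" using U V by auto
  have UA: "U [^] (j::int) \<in> A" for j using U by (rule subgroup_int_pow_closed[OF sub(1)])
  have Uinj: "j = k" if "U [^] (j::int) = U [^] k" for j k
  proof -
    have "U [^] (j - k) = \<one>" using that Uc by (simp add: int_pow_diff)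
    then show ?thesis using U_inf by fastforce
  qed
  define D where "D = range (\<lambda>k::int. U [^] (int m * k))"
  define tr where "tr = (\<lambda>k (S, l :: 'a). ((\<otimes>) k ` S, l))"
  define Q where "Q = {(\<otimes>) k ` D | k. k \<in> A}"
  define \<Omega> where "\<Omega> = Q \<times> B"
  have D_carrier: "D \<subseteq> carrier G" using Uc by (auto simp: D_def)
  have img_mult: "(\<otimes>) (g \<otimes> h) ` S = (\<otimes>) g ` (\<otimes>) h ` S"
    if "g \<in> carrier G" "h \<in> carrier G" "S \<subseteq> carrier G" for g h S
    using that by (auto simp: image_image m_assoc intro!: image_cong)
  have img_one: "(\<otimes>) \<one> ` S = S" if "S \<subseteq> carrier G" for S
  proof -
    have "(\<otimes>) \<one> ` S = (\<lambda>x. x) ` S" using that by (intro image_cong) auto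
    then show ?thesis by simp
  qed
  have Q_carrier: "S \<subseteq> carrier G" if "S \<in> Q" for S
    using that D_carrier by (auto simp: Q_def)
  have D_Q: "D \<in> Q" using img_one[OF D_carrier] A.one_closed unfolding Q_def by blast
  have trans: "(\<otimes>) (U [^] (j::int)) ` D = D \<longleftrightarrow> int m dvd j" for j
  proof
    assume "(\<otimes>) (U [^] j) ` D = D"
    moreover have "\<one> \<in> D" unfolding D_def by (rule range_eqI[of _ _ 0]) simp
    ultimately have "U [^] j \<otimes> \<one> \<in> D" by blast
    then obtain k where "U [^] j = U [^] (int m * k)" using Uc by (auto simp: D_def)
    then show "int m dvd j" using Uinj by fastforce
  next
    assume "int m dvd j"
    then obtain q where q: "j = int m * q" by (auto simp: dvd_def)
    have 1: "U [^] j \<otimes> U [^] (int m * k) = U [^] (int m * (q + k))" for k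
      using Uc by (simp add: q int_pow_mult distrib_left)
    have "U [^] (int m * k) \<in> (\<otimes>) (U [^] j) ` D" for k
      using 1[of "k - q"] unfolding D_def by (intro image_eqI[of _ _ "U [^] (int m * (k - q))"]) auto
    then show "(\<otimes>) (U [^] j) ` D = D" using 1 by (auto simp: D_def)
  qed
  have trA: "(\<lambda>g. \<lambda>w\<in>\<Omega>. tr g w) \<in> hom (G\<lparr>carrier := A\<rparr>) (BijGroup \<Omega>)"
  proof (rule hom_BijGroup_of_action[OF grp(1)])
    fix g w assume g: "g \<in> carrier (G\<lparr>carrier := A\<rparr>)" and w: "w \<in> \<Omega>"
    then obtain k l where k: "w = ((\<otimes>) k ` D, l)" "k \<in> A" "l \<in> B" by (auto simp: \<Omega>_def Q_def)
    then have "(\<otimes>) g ` (\<otimes>) k ` D = (\<otimes>) (g \<otimes> k) ` D" using g D_carrier by (intro img_mult[symmetric]) auto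
    moreover have "g \<otimes> k \<in> A" using g k by simp
    ultimately show "tr g w \<in> \<Omega>" using k by (auto simp: tr_def \<Omega>_def Q_def)
  next
    fix g h w assume "g \<in> carrier (G\<lparr>carrier := A\<rparr>)" "h \<in> carrier (G\<lparr>carrier := A\<rparr>)" "w \<in> \<Omega>"
    then show "tr (g \<otimes>\<^bsub>G\<lparr>carrier := A\<rparr>\<^esub> h) w = tr g (tr h w)"
      using Q_carrier by (cases w) (simp add: tr_def \<Omega>_def img_mult)
  next
    fix w assume "w \<in> \<Omega>"
    then show "tr \<one>\<^bsub>G\<lparr>carrier := A\<rparr>\<^esub> w = w" using Q_carrier by (cases w) (simp add: tr_def \<Omega>_def img_one)
  qed
  let ?p = "(D, \<one>)" and ?P = "((\<otimes>) (U [^] i) ` D, \<one>)" and ?R = "(D, V [^] n)"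
  have VB: "V [^] n \<in> B" using subgroup_int_pow_closed[OF sub(2) V, of "int n"] by (simp add: int_pow_int)
  have points: "?p \<in> \<Omega>" "?P \<in> \<Omega>" "?R \<in> \<Omega>" using D_Q UA[of i] VB by (auto simp: \<Omega>_def Q_def)
  have "\<exists>g \<in> hom (G\<lparr>carrier := B\<rparr>) (BijGroup \<Omega>). g (V [^] n) ?p = ?P"
  proof (cases "int m dvd i")
    case True
    have "(\<lambda>g. \<lambda>w\<in>\<Omega>. w) \<in> hom (G\<lparr>carrier := B\<rparr>) (BijGroup \<Omega>)"
      using hom_BijGroup_of_action[OF grp(2), of \<Omega> "\<lambda>g w. w"] by simp
    moreover have "(\<lambda>w\<in>\<Omega>. w) ?p = ?P" using points trans[of i] True by simp
    ultimately show ?thesis by (intro bexI[of _ "\<lambda>g. \<lambda>w\<in>\<Omega>. w"])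
  next
    case False
    then have neq: "?p \<noteq> ?P" "?p \<noteq> ?R" "?P \<noteq> ?R" using trans[of i] Vn by auto
    \<comment> \<open>Translation by V^n takes the base point \<open>?p\<close> to
      \<open>?R\<close>, and \<open>?P\<close> is the point wanted instead. Exchanging the two while
      fixing \<open>?p\<close> is possible because the three points are distinct; the translations
      conjugated by \<open>\<tau>\<close> still form an action.\<close>
    define \<tau> where "\<tau> w = (if w = ?P then ?R else if w = ?R then ?P else w)" for w
    have \<tau>: "\<tau> (\<tau> w) = w" "w \<in> \<Omega> \<Longrightarrow> \<tau> w \<in> \<Omega>" for w using neq points by (auto simp: \<tau>_def)
    define act where "act l w = \<tau> (fst (\<tau> w), l \<otimes> snd (\<tau> w))" for l w
    have mem: "(fst w, l \<otimes> snd w) \<in> \<Omega>" "snd w \<in> carrier G" if "w \<in> \<Omega>" "l \<in> B" for w l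
      using that by (auto simp: \<Omega>_def)
    have "(\<lambda>g. \<lambda>w\<in>\<Omega>. act g w) \<in> hom (G\<lparr>carrier := B\<rparr>) (BijGroup \<Omega>)"
    proof (rule hom_BijGroup_of_action[OF grp(2)])
      fix l w assume "l \<in> carrier (G\<lparr>carrier := B\<rparr>)" "w \<in> \<Omega>"
      then show "act l w \<in> \<Omega>" unfolding act_def using \<tau>(2) mem by simp
    next
      fix l k w assume "l \<in> carrier (G\<lparr>carrier := B\<rparr>)" "k \<in> carrier (G\<lparr>carrier := B\<rparr>)" "w \<in> \<Omega>"
      then show "act (l \<otimes>\<^bsub>G\<lparr>carrier := B\<rparr>\<^esub> k) w = act l (act k w)"
        unfolding act_def using \<tau> mem[of "\<tau> w" \<one>] by (simp add: m_assoc)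
    next
      fix w assume "w \<in> \<Omega>"
      then show "act \<one>\<^bsub>G\<lparr>carrier := B\<rparr>\<^esub> w = w" unfolding act_def using \<tau> mem[of "\<tau> w" \<one>] by simp
    qed
    moreover have "act (V [^] n) ?p = ?P"
      using neq Vc by (simp add: act_def \<tau>_def)
    ultimately show ?thesis using points(1) by (metis restrict_apply')
  qed
  then obtain g where g: "g \<in> hom (G\<lparr>carrier := B\<rparr>) (BijGroup \<Omega>)" "g (V [^] n) ?p = ?P" by blast
  obtain h where h: "h \<in> hom G (BijGroup \<Omega>)" "\<And>a. a \<in> A \<Longrightarrow> h a = (\<lambda>w\<in>\<Omega>. tr a w)" "\<And>b. b \<in> B \<Longrightarrow> h b = g b"
    using free_product_universal[OF prod group_BijGroup trA g(1)] by auto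
  interpret h: group_hom G "BijGroup \<Omega>" h
    using h(1) by (simp add: group_hom_def group_hom_axioms_def group_BijGroup is_group)
  have hU: "h (U [^] (j::int)) w = tr (U [^] j) w" if "w \<in> \<Omega>" for j w using h(2)[OF UA] that by simp
  have "h (U [^] d) ?p = ?p"
  proof (rule generate_fixes_point[OF is_group h(1) points(1) _ _ gen])
    show "{U [^] m, U [^] (- i) \<otimes> V [^] n} \<subseteq> carrier G" using Uc Vc by simp
    fix x assume "x \<in> {U [^] m, U [^] (- i) \<otimes> V [^] n}"
    then consider "x = U [^] int m" | "x = U [^] (- i) \<otimes> V [^] n" by (auto simp: int_pow_int)
    then show "h x ?p = ?p"
    proof cases
      case 1 then show ?thesis using hU[OF points(1), of "int m"] trans[of "int m"] by (simp add: tr_def)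
    next
      case 2
      have "h (U [^] (- i)) \<in> Bij \<Omega>" "h (V [^] n) \<in> Bij \<Omega>"
        using h.hom_closed Uc Vc by (auto simp: BijGroup_def)
      then have "h x ?p = h (U [^] (- i)) (h (V [^] n) ?p)"
        using 2 Uc Vc points(1) by (simp add: h.hom_mult BijGroup_def compose_def)
      also have "\<dots> = tr (U [^] (- i)) ?P" using hU[OF points(2)] h(3)[OF VB] g(2) by simp
      also have "\<dots> = ?p"
        using img_mult[of "U [^] (- i)" "U [^] i" D] img_one[OF D_carrier] D_carrier Uc
        by (simp add: tr_def int_pow_neg)
      finally show ?thesis .
    qed
  qed
  then have "(\<otimes>) (U [^] d) ` D = D" using hU[OF points(1), of d] by (simp add: tr_def)
  then show ?thesis using trans by blast
qed

section \<open>Nielsen moves and automorphisms of the free group\<close>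

text \<open>A chain of moves is a recipe valid in every group. The same recipe is carried out in the
  source and mapped forward.\<close>

lemma (in group_hom) nielsen_pullback:
  assumes "H.nielsen (h x) (h y) p q" "x \<in> carrier G" "y \<in> carrier G"
  shows "\<exists>a b. G.nielsen x y a b \<and> h a = p \<and> h b = q"
  using assms
proof induction
  case refl show ?case using G.nielsen.refl by blast
next
  case (right p q)
  then obtain a b where ab: "G.nielsen x y a b" "h a = p" "h b = q" by blast
  note c = G.nielsen_closed[OF ab(1) right.prems]
  show ?case using G.nielsen.right[OF ab(1)] ab c by (intro exI conjI) auto
next
  case (right_inv p q)
  then obtain a b where ab: "G.nielsen x y a b" "h a = p" "h b = q" by blast
  note c = G.nielsen_closed[OF ab(1) right_inv.prems]
  show ?case using G.nielsen.right_inv[OF ab(1)] ab c by (intro exI conjI) auto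
next
  case (left p q)
  then obtain a b where ab: "G.nielsen x y a b" "h a = p" "h b = q" by blast
  note c = G.nielsen_closed[OF ab(1) left.prems]
  show ?case using G.nielsen.left[OF ab(1)] ab c by (intro exI conjI) auto
next
  case (left_inv p q)
  then obtain a b where ab: "G.nielsen x y a b" "h a = p" "h b = q" by blast
  note c = G.nielsen_closed[OF ab(1) left_inv.prems]
  show ?case using G.nielsen.left_inv[OF ab(1)] ab c by (intro exI conjI) auto
qed

locale free_pair =
  fixes F :: "('f, 'p) monoid_scheme" and x y :: 'f
  assumes basis: "free_basis F {x, y}" and neq: "x \<noteq> y"

sublocale free_pair \<subseteq> F: group F
  using basis by (simp add: free_basis_def)

context free_pair
begin

lemma xy: "x \<in> carrier F" "y \<in> carrier F"
  and generate_xy: "generate F {x, y} = carrier F"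
  using basis by (simp_all add: free_basis_def)

lemma hom_exists:
  assumes "group H" "p \<in> carrier H" "q \<in> carrier H"
  shows "\<exists>\<phi> \<in> hom F H \<inter> extensional (carrier F). \<phi> x = p \<and> \<phi> y = q"
proof -
  have "(\<lambda>s. if s = x then p else q) \<in> {x, y} \<rightarrow> carrier H" using assms by auto
  from free_basis_universal[OF basis assms(1) this] obtain \<phi>
    where "\<phi> \<in> hom F H \<inter> extensional (carrier F)" "\<forall>s\<in>{x, y}. \<phi> s = (if s = x then p else q)"
    by blast
  then show ?thesis using neq by (intro bexI[of _ \<phi>]) auto
qed

lemma hom_eqI:
  assumes "group H" "\<phi> \<in> hom F H" "\<psi> \<in> hom F H" "\<phi> x = \<psi> x" "\<phi> y = \<psi> y" "g \<in> carrier F"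
  shows "\<phi> g = \<psi> g"
  using hom_eq_on_generate[of F H \<phi> \<psi> "{x, y}" g] assms xy generate_xy F.is_group by auto

lemma group_homI: "group H \<Longrightarrow> \<phi> \<in> hom F H \<Longrightarrow> group_hom F H \<phi>"
  by (simp add: group_hom_def group_hom_axioms_def F.is_group)

lemma image_eq_generate:
  assumes "group H" "\<phi> \<in> hom F H"
  shows "\<phi> ` carrier F = generate H {\<phi> x, \<phi> y}"
  using group_hom.generate_img[OF group_homI[OF assms], of "{x, y}"] xy generate_xy by simp

text \<open>The reversed chain, pulled back along \<open>\<sigma>\<close>, yields preimages of
  \<open>x\<close> and \<open>y\<close> that are again reached by moves. They define a right inverse
  of the same kind.\<close>

lemma nielsen_endomorphism_inverse:
  assumes "F.nielsen x y a b" "\<sigma> \<in> hom F F" "\<sigma> x = a" "\<sigma> y = b"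
  obtains \<tau> where "\<tau> \<in> hom F F" "F.nielsen x y (\<tau> x) (\<tau> y)" "\<And>g. g \<in> carrier F \<Longrightarrow> \<sigma> (\<tau> g) = g"
proof -
  interpret \<sigma>: group_hom F F \<sigma> by (rule group_homI[OF F.is_group assms(2)])
  have "F.nielsen (\<sigma> x) (\<sigma> y) x y" using F.nielsen_sym[OF assms(1) xy] assms(3,4) by simp
  then obtain c d where cd: "F.nielsen x y c d" "\<sigma> c = x" "\<sigma> d = y"
    using \<sigma>.nielsen_pullback xy by blast
  then have "c \<in> carrier F" "d \<in> carrier F" using F.nielsen_closed xy by blast+
  then obtain \<tau> where \<tau>: "\<tau> \<in> hom F F" "\<tau> x = c" "\<tau> y = d" using hom_exists[OF F.is_group] by blast
  have "\<sigma> (\<tau> g) = g" if "g \<in> carrier F" for g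
  proof -
    have "\<sigma> \<circ> \<tau> \<in> hom F F" using hom_compose[OF \<tau>(1) assms(2)] .
    moreover have "id \<in> hom F F" by (simp add: hom_def)
    ultimately show ?thesis using hom_eqI[OF F.is_group, of "\<sigma> \<circ> \<tau>" id] cd \<tau> that by simp
  qed
  then show thesis using that \<tau> cd by blast
qed

text \<open>Applied twice, \<open>nielsen_endomorphism_inverse\<close> gives a right inverse
  \<open>\<tau>\<close> of \<open>\<sigma>\<close> and a right inverse \<open>\<rho>\<close> of
  \<open>\<tau>\<close>. Then \<open>\<sigma>\<close> agrees with \<open>\<rho>\<close>, so
  \<open>\<tau>\<close> is a two-sided inverse.\<close>

lemma nielsen_automorphism:
  assumes "F.nielsen x y a b"
  obtains \<sigma> where "\<sigma> \<in> auto F" "\<sigma> x = a" "\<sigma> y = b"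
proof -
  have ab: "a \<in> carrier F" "b \<in> carrier F" using F.nielsen_closed[OF assms xy] .
  obtain \<sigma> where \<sigma>: "\<sigma> \<in> hom F F" "\<sigma> \<in> extensional (carrier F)" "\<sigma> x = a" "\<sigma> y = b"
    using hom_exists[OF F.is_group ab] by blast
  obtain \<tau> where \<tau>: "\<tau> \<in> hom F F" "F.nielsen x y (\<tau> x) (\<tau> y)" "\<And>g. g \<in> carrier F \<Longrightarrow> \<sigma> (\<tau> g) = g"
    using nielsen_endomorphism_inverse[OF assms \<sigma>(1,3,4)] by blast
  obtain \<rho> where \<rho>: "\<rho> \<in> hom F F" "\<And>g. g \<in> carrier F \<Longrightarrow> \<tau> (\<rho> g) = g"
    using nielsen_endomorphism_inverse[OF \<tau>(2,1) refl refl] by blast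
  have closed: "h g \<in> carrier F" if "h \<in> hom F F" "g \<in> carrier F" for h g
    using that by (auto simp: hom_def)
  have "\<tau> (\<sigma> g) = g" if "g \<in> carrier F" for g
  proof -
    have "\<sigma> g = \<rho> g" using \<tau>(3)[of "\<rho> g"] \<rho> that closed by metis
    then show ?thesis using \<rho> that by simp
  qed
  then have "bij_betw \<sigma> (carrier F) (carrier F)"
    using \<tau> closed \<sigma>(1) by (intro bij_betw_byWitness[where f' = \<tau>]) auto
  then show thesis using that \<sigma> by (simp add: auto_def Bij_def)
qed

lemma stabilizer_relI:
  assumes H: "group H" and \<phi>: "\<phi> \<in> solutions F x y H T" and \<psi>: "\<psi> \<in> solutions F x y H T"
    and moves: "group.nielsen H (\<phi> x) (\<phi> y) (\<psi> x) (\<psi> y)"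
  shows "(\<phi>, \<psi>) \<in> stabilizer_rel F x y H T"
proof -
  have hom: "\<phi> \<in> hom F H" "\<psi> \<in> hom F H" "\<psi> \<in> extensional (carrier F)"
    using \<phi> \<psi> by (auto simp: solutions_def)
  interpret \<phi>: group_hom F H \<phi> by (rule group_homI[OF H hom(1)])
  obtain a b where ab: "F.nielsen x y a b" "\<phi> a = \<psi> x" "\<phi> b = \<psi> y"
    using \<phi>.nielsen_pullback[OF moves xy] by blast
  obtain \<sigma> where \<sigma>: "\<sigma> \<in> auto F" "\<sigma> x = a" "\<sigma> y = b" using nielsen_automorphism[OF ab(1)] .
  have \<sigma>h: "\<sigma> \<in> hom F F" using \<sigma>(1) by (simp add: auto_def)
  interpret \<sigma>: group_hom F F \<sigma> by (rule group_homI[OF F.is_group \<sigma>h])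
  have "\<sigma> (commutator F x y) = commutator F a b"
    using xy \<sigma> by (simp add: commutator_def)
  then have c: "\<sigma> (commutator F x y) = commutator F x y"
    using F.nielsen_commutator[OF ab(1) xy] by simp
  have "\<psi> = compose (carrier F) \<phi> \<sigma>"
  proof (rule extensionalityI[OF hom(3) compose_extensional])
    fix g assume g: "g \<in> carrier F"
    have "\<phi> \<circ> \<sigma> \<in> hom F H" using hom_compose[OF \<sigma>h hom(1)] .
    then have "\<psi> g = (\<phi> \<circ> \<sigma>) g" using hom_eqI[OF H hom(2) _ _ _ g] ab \<sigma> by simp
    then show "\<psi> g = compose (carrier F) \<phi> \<sigma> g" using g by (simp add: compose_def)
  qed
  then show ?thesis using \<phi> \<psi> \<sigma>(1) c unfolding stabilizer_rel_def by blast
qed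

lemma stabilizer_rel_generate:
  assumes H: "group H" and rel: "(\<phi>, \<psi>) \<in> stabilizer_rel F x y H T"
  shows "generate H {\<phi> x, \<phi> y} = generate H {\<psi> x, \<psi> y}"
proof -
  obtain \<sigma> where \<sigma>: "\<sigma> \<in> auto F" "\<psi> = compose (carrier F) \<phi> \<sigma>"
    and hom: "\<phi> \<in> hom F H" "\<psi> \<in> hom F H"
    using rel by (auto simp: stabilizer_rel_def solutions_def)
  have "\<sigma> ` carrier F = carrier F" using \<sigma>(1) by (auto simp: auto_def Bij_def bij_betw_def)
  moreover have "\<psi> ` carrier F = \<phi> ` \<sigma> ` carrier F"
    unfolding \<sigma>(2) by (auto simp: compose_def image_image)
  ultimately show ?thesis using image_eq_generate[OF H] hom by simp
qed

end

section \<open>The solutions of the equation\<close>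

text \<open>Carries torsion-freeness and the centralizer of a power from the factor, as a group of
  its own, to computations in \<open>H\<close>.\<close>

lemma free_subgroup_powers:
  fixes H :: "('h, 'q) monoid_scheme" (structure)
  assumes "group H" "subgroup K H" "free_group (H\<lparr>carrier := K\<rparr>)" "U \<in> K" "U \<noteq> \<one>"
    and "\<not> proper_power (H\<lparr>carrier := K\<rparr>) U"
  shows "\<And>j::int. U [^] j = \<one> \<Longrightarrow> j = 0"
    and "\<And>z m. z \<in> K \<Longrightarrow> z \<otimes> U [^] (m::nat) = U [^] m \<otimes> z \<Longrightarrow> m > 0 \<Longrightarrow> \<exists>r::int. z = U [^] r"
proof -
  interpret group H by fact
  let ?K = "H\<lparr>carrier := K\<rparr>"
  obtain S where "free_basis ?K S" using assms(3) by (auto simp: free_group_def)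
  then interpret K: free_group_on ?K S
    by (simp add: free_group_on_def free_group_on_axioms_def free_basis_def)
  have Uc: "U \<in> carrier H" using assms(2,4) subgroup.mem_carrier by metis
  have npow: "U [^]\<^bsub>?K\<^esub> (j::nat) = U [^] j" for j using nat_pow_consistent[of U j K] by simp
  have ipow: "U [^]\<^bsub>?K\<^esub> (j::int) = U [^] j" for j using int_pow_consistent[OF assms(2,4)] by simp
  have nat: "j = 0" if "U [^] (j::nat) = \<one>" for j
    using K.torsion_free[of U j] that assms(4,5) npow by simp
  show "j = 0" if "U [^] (j::int) = \<one>" for j
    using that nat Uc by (cases j rule: int_cases2) (auto simp: int_pow_int int_pow_neg_int inv_eq_1_iff)
  show "\<exists>r::int. z = U [^] r" if "z \<in> K" "z \<otimes> U [^] (m::nat) = U [^] m \<otimes> z" "m > 0" for z m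
    using K.centralizer_power[of U z m] that assms(4-6) npow ipow by simp
qed

lemma (in group) nielsen_reduce_exponent:
  fixes m n :: nat
  assumes U: "U \<in> carrier G" and V: "V \<in> carrier G" and "m > 0" "n > 0"
  shows "\<exists>i<m. nielsen (U [^] m) (U [^] (r::int) \<otimes> V [^] n) (U [^] m) (U [^] (- int i) \<otimes> V [^] n)"
    and "\<exists>j<n. nielsen (V [^] (r::int) \<otimes> U [^] m) (V [^] n) (V [^] j \<otimes> U [^] m) (V [^] n)"
proof -
  have pow: "(g [^] (k::nat)) [^] (q::int) \<otimes> (g [^] (s::int) \<otimes> h) = g [^] (int k * q + s) \<otimes> h"
    if "g \<in> carrier G" "h \<in> carrier G" for g h k q s
    using that int_pow_pow[of g "int k" q] by (simp add: int_pow_int int_pow_mult m_assoc)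
  \<comment> \<open>The listed solutions carry the exponent -i, hence the residue of -r here and
    that of r for \<open>?j\<close>.\<close>
  let ?i = "nat ((- r) mod int m)"
  have i: "?i < m" "int m * ((- r) div int m) + r = - int ?i"
  proof -
    show "?i < m" using \<open>m > 0\<close> by (simp add: nat_less_iff)
    have "int m * ((- r) div int m) + (- r) mod int m = - r" by (rule mult_div_mod_eq)
    moreover have "int ?i = (- r) mod int m" using \<open>m > 0\<close> by simp
    ultimately show "int m * ((- r) div int m) + r = - int ?i" by linarith
  qed
  show "\<exists>i<m. nielsen (U [^] m) (U [^] r \<otimes> V [^] n) (U [^] m) (U [^] (- int i) \<otimes> V [^] n)"
    using nielsen_right_int_pow[of "U [^] m" "U [^] r \<otimes> V [^] n" "(- r) div int m"] U V i
    by (intro exI[of _ ?i]) (simp add: pow)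
  let ?j = "nat (r mod int n)"
  have j: "?j < n" "int n * (- (r div int n)) + r = int ?j"
  proof -
    show "?j < n" using \<open>n > 0\<close> by (simp add: nat_less_iff)
    have "int n * (r div int n) + r mod int n = r" by (rule mult_div_mod_eq)
    moreover have "int ?j = r mod int n" using \<open>n > 0\<close> by simp
    ultimately show "int n * (- (r div int n)) + r = int ?j" unfolding mult_minus_right by linarith
  qed
  have "nielsen (V [^] r \<otimes> U [^] m) (V [^] n) (V [^] int ?j \<otimes> U [^] m) (V [^] n)"
    using nielsen_left_int_pow[of "V [^] r \<otimes> U [^] m" "V [^] n" "- (r div int n)"] U V j(2)
    by (simp only: pow nat_pow_closed int_pow_closed m_closed)
  then show "\<exists>j<n. nielsen (V [^] r \<otimes> U [^] m) (V [^] n) (V [^] j \<otimes> U [^] m) (V [^] n)"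
    using j(1) by (intro exI[of _ ?j]) (simp add: int_pow_int del: int_nat_eq)
qed

theorem theorem3:
  fixes F :: "('f, 'p) monoid_scheme" and x y :: 'f
    and H :: "('h, 'q) monoid_scheme" and K L :: "'h set" and U V :: 'h and m n :: nat
  assumes "free_basis F {x, y}" and "x \<noteq> y"
    and "free_product H K L"
    and "free_group (H\<lparr>carrier := K\<rparr>)" and "free_group (H\<lparr>carrier := L\<rparr>)"
    and "U \<in> K" and "U \<noteq> \<one>\<^bsub>H\<^esub>" and "\<not> proper_power (H\<lparr>carrier := K\<rparr>) U"
    and "V \<in> L" and "V \<noteq> \<one>\<^bsub>H\<^esub>" and "\<not> proper_power (H\<lparr>carrier := L\<rparr>) V"
    and "m > 0" and "n > 0"
  shows "let T = commutator H (U [^]\<^bsub>H\<^esub> m) (V [^]\<^bsub>H\<^esub> n) in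
    card (stabilizer_classes F x y H T) = m + n - 1 \<and>
    (\<exists>\<phi> \<psi> :: nat \<Rightarrow> 'f \<Rightarrow> 'h.
       (\<forall>i<m. \<phi> i \<in> solutions F x y H T \<and>
              \<phi> i x = U [^]\<^bsub>H\<^esub> m \<and> \<phi> i y = U [^]\<^bsub>H\<^esub> (- int i) \<otimes>\<^bsub>H\<^esub> V [^]\<^bsub>H\<^esub> n) \<and>
       (\<forall>j\<in>{1..<n}. \<psi> j \<in> solutions F x y H T \<and>
              \<psi> j x = V [^]\<^bsub>H\<^esub> j \<otimes>\<^bsub>H\<^esub> U [^]\<^bsub>H\<^esub> m \<and> \<psi> j y = V [^]\<^bsub>H\<^esub> n) \<and>
       stabilizer_classes F x y H T =
         (\<lambda>i. stabilizer_class F x y H T (\<phi> i)) ` {..<m} \<union>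
         (\<lambda>j. stabilizer_class F x y H T (\<psi> j)) ` {1..<n})"
proof -
  interpret F: free_pair F x y using assms(1,2) by unfold_locales
  interpret H: free_prod H K L
    using assms(3) by (simp add: free_prod_def free_prod_axioms_def free_product_def)
  note H = H.is_group and prod = assms(3) and prod' = free_product_swap[OF assms(3)]
  have sub: "subgroup K H" "subgroup L H" using assms(3) by (simp_all add: free_product_def)
  note Upow = free_subgroup_powers[OF H sub(1) assms(4,6-8)]
    and Vpow = free_subgroup_powers[OF H sub(2) assms(5,9-11)]
  have c: "U \<in> carrier H" "V \<in> carrier H" using assms(6,9) sub subgroup.mem_carrier by metis+
  have powK: "U [^]\<^bsub>H\<^esub> (j::int) \<in> K" and powL: "V [^]\<^bsub>H\<^esub> (j::int) \<in> L" for j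
    using H.subgroup_int_pow_closed sub assms(6,9) by simp_all
  define u where "u = U [^]\<^bsub>H\<^esub> m"
  define v where "v = V [^]\<^bsub>H\<^esub> n"
  define T where "T = commutator H u v"
  have uv: "u \<in> carrier H" "v \<in> carrier H" using c by (simp_all add: u_def v_def)
  have uK: "u \<in> K" and vL: "v \<in> L" using powK[of "int m"] powL[of "int n"]
    by (simp_all add: u_def v_def int_pow_int)
  have u2: "u \<otimes>\<^bsub>H\<^esub> u \<noteq> \<one>\<^bsub>H\<^esub>"
  proof
    assume "u \<otimes>\<^bsub>H\<^esub> u = \<one>\<^bsub>H\<^esub>"
    then have "U [^]\<^bsub>H\<^esub> (int (m + m)) = \<one>\<^bsub>H\<^esub>" using c H.nat_pow_mult[of U m m] 
      by (simp add: u_def int_pow_int del: of_nat_add)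
    then show False using Upow(1)[of "int (m + m)"] \<open>m > 0\<close> by simp
  qed
  have v1: "v \<noteq> \<one>\<^bsub>H\<^esub>" and u1: "u \<noteq> \<one>\<^bsub>H\<^esub>"
    using Vpow(1)[of "int n"] Upow(1)[of "int m"] \<open>n > 0\<close> \<open>m > 0\<close> by (auto simp: u_def v_def int_pow_int)
  have commU: "U [^]\<^bsub>H\<^esub> (j::int) \<otimes>\<^bsub>H\<^esub> u = u \<otimes>\<^bsub>H\<^esub> U [^]\<^bsub>H\<^esub> j" for j
    using c H.int_pow_mult[of U j "int m"] H.int_pow_mult[of U "int m" j]
    by (simp add: u_def int_pow_int add.commute)
  have commV: "V [^]\<^bsub>H\<^esub> (j::int) \<otimes>\<^bsub>H\<^esub> v = v \<otimes>\<^bsub>H\<^esub> V [^]\<^bsub>H\<^esub> j" for j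
    using c H.int_pow_mult[of V j "int n"] H.int_pow_mult[of V "int n" j]
    by (simp add: v_def int_pow_int add.commute)
  have sol_iff: "\<phi> \<in> solutions F x y H T \<longleftrightarrow>
      \<phi> \<in> hom F H \<inter> extensional (carrier F) \<and> commutator H (\<phi> x) (\<phi> y) = T" for \<phi>
    by (simp add: solutions_def)
  have "\<exists>f. f \<in> solutions F x y H T \<and> f x = u \<and> f y = U [^]\<^bsub>H\<^esub> (- int i) \<otimes>\<^bsub>H\<^esub> v" for i
  proof -
    have "commutator H u (U [^]\<^bsub>H\<^esub> (- int i) \<otimes>\<^bsub>H\<^esub> v) = T"
      unfolding T_def using H.commutator_mult_right[OF commU] uv c by simp
    moreover obtain f where "f \<in> hom F H \<inter> extensional (carrier F)" "f x = u"
      "f y = U [^]\<^bsub>H\<^esub> (- int i) \<otimes>\<^bsub>H\<^esub> v"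
      using F.hom_exists[OF H uv(1), of "U [^]\<^bsub>H\<^esub> (- int i) \<otimes>\<^bsub>H\<^esub> v"] uv c by auto
    ultimately show ?thesis by (intro exI[of _ f]) (simp add: sol_iff)
  qed
  then obtain \<phi> :: "nat \<Rightarrow> 'f \<Rightarrow> 'h" where \<phi>: "\<And>i. \<phi> i \<in> solutions F x y H T" "\<And>i. \<phi> i x = u"
    "\<And>i. \<phi> i y = U [^]\<^bsub>H\<^esub> (- int i) \<otimes>\<^bsub>H\<^esub> v" by metis
  have "\<exists>f. f \<in> solutions F x y H T \<and> f x = V [^]\<^bsub>H\<^esub> j \<otimes>\<^bsub>H\<^esub> u \<and> f y = v" for j :: nat
  proof -
    have "commutator H (V [^]\<^bsub>H\<^esub> j \<otimes>\<^bsub>H\<^esub> u) v = T"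
      unfolding T_def using H.commutator_mult_left[OF commV[of "int j"]] uv c by (simp add: int_pow_int)
    moreover obtain f where "f \<in> hom F H \<inter> extensional (carrier F)" "f y = v"
      "f x = V [^]\<^bsub>H\<^esub> j \<otimes>\<^bsub>H\<^esub> u"
      using F.hom_exists[OF H _ uv(2), of "V [^]\<^bsub>H\<^esub> j \<otimes>\<^bsub>H\<^esub> u"] uv c by auto
    ultimately show ?thesis by (intro exI[of _ f]) (simp add: sol_iff)
  qed
  then obtain \<psi> :: "nat \<Rightarrow> 'f \<Rightarrow> 'h" where \<psi>: "\<And>j. \<psi> j \<in> solutions F x y H T"
    "\<And>j. \<psi> j x = V [^]\<^bsub>H\<^esub> j \<otimes>\<^bsub>H\<^esub> u" "\<And>j. \<psi> j y = v" by metis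
  let ?rel = "stabilizer_rel F x y H T" and ?cl = "stabilizer_class F x y H T"
  have equiv: "equiv (solutions F x y H T) ?rel"
    using equiv_stabilizer_rel[OF F.F.is_group F.xy] .
  have cl_eq: "?cl f = ?cl g" if "(f, g) \<in> ?rel" for f g
    unfolding stabilizer_class_def using equiv_class_eq[OF equiv that] .
  have cl_eqD: "generate H {f x, f y} = generate H {g x, g y}"
    if "?cl f = ?cl g" "g \<in> solutions F x y H T" for f g
    using F.stabilizer_rel_generate[OF H] eq_equiv_class[OF _ equiv that(2)] that(1)
    unfolding stabilizer_class_def by blast

  \<comment> \<open>Every solution lies in a listed class\<close>
  have cover: "(\<exists>i<m. ?cl f = ?cl (\<phi> i)) \<or> (\<exists>j\<in>{1..<n}. ?cl f = ?cl (\<psi> j))"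
    if f: "f \<in> solutions F x y H T" for f
  proof -
    have fh: "f \<in> hom F H" "commutator H (f x) (f y) = T" using f by (simp_all add: sol_iff)
    then have fc: "f x \<in> carrier H" "f y \<in> carrier H" using F.xy by (auto simp: hom_def)
    have "(\<exists>z\<in>K. z \<otimes>\<^bsub>H\<^esub> u = u \<otimes>\<^bsub>H\<^esub> z \<and> H.nielsen (f x) (f y) u (z \<otimes>\<^bsub>H\<^esub> v)) \<or>
        (\<exists>z\<in>L. z \<otimes>\<^bsub>H\<^esub> v = v \<otimes>\<^bsub>H\<^esub> z \<and> H.nielsen (f x) (f y) (z \<otimes>\<^bsub>H\<^esub> u) v)"
      using H.solutions_nielsen[OF uK u2 vL v1 fc] fh(2) by (simp add: T_def)
    then consider i where "i < m" "H.nielsen (f x) (f y) u (U [^]\<^bsub>H\<^esub> (- int i) \<otimes>\<^bsub>H\<^esub> v)"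
      | j where "j < n" "H.nielsen (f x) (f y) (V [^]\<^bsub>H\<^esub> j \<otimes>\<^bsub>H\<^esub> u) v"
    proof (elim disjE bexE conjE)
      fix z assume z: "z \<in> K" "z \<otimes>\<^bsub>H\<^esub> u = u \<otimes>\<^bsub>H\<^esub> z" "H.nielsen (f x) (f y) u (z \<otimes>\<^bsub>H\<^esub> v)"
      then obtain r :: int where "z = U [^]\<^bsub>H\<^esub> r" using Upow(2)[of z m] \<open>m > 0\<close> by (auto simp: u_def)
      then show thesis using that(1) H.nielsen_trans[OF _ z(3)]
          H.nielsen_reduce_exponent(1)[OF c assms(12,13), of r] by (auto simp: u_def v_def)
    next
      fix z assume z: "z \<in> L" "z \<otimes>\<^bsub>H\<^esub> v = v \<otimes>\<^bsub>H\<^esub> z" "H.nielsen (f x) (f y) (z \<otimes>\<^bsub>H\<^esub> u) v"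
      then obtain r :: int where "z = V [^]\<^bsub>H\<^esub> r" using Vpow(2)[of z n] \<open>n > 0\<close> by (auto simp: v_def)
      then show thesis using that(2) H.nielsen_trans[OF _ z(3)]
          H.nielsen_reduce_exponent(2)[OF c assms(12,13), of r] by (auto simp: u_def v_def)
    qed
    then show ?thesis
    proof cases
      case (1 i)
      then have "(f, \<phi> i) \<in> ?rel" using F.stabilizer_relI[OF H f \<phi>(1)] \<phi>(2,3) by simp
      then show ?thesis using cl_eq 1(1) by blast
    next
      case (2 j)
      show ?thesis
      proof (cases "j = 0")
        case True
        \<comment> \<open>The pairs for j = 0 and i = 0 coincide, which is why the second family
          starts at 1.\<close>
        then have "(f, \<phi> 0) \<in> ?rel"
          using F.stabilizer_relI[OF H f \<phi>(1)[of 0]] \<phi>(2,3)[of 0] 2 uv by simp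
        then show ?thesis using cl_eq \<open>m > 0\<close> by blast
      next
        case False
        have "(f, \<psi> j) \<in> ?rel" using F.stabilizer_relI[OF H f \<psi>(1)] \<psi>(2,3) 2 by simp
        then show ?thesis using cl_eq 2(1) False by (metis atLeastLessThan_iff less_one not_le)
      qed
    qed
  qed
  have classes: "stabilizer_classes F x y H T = (\<lambda>i. ?cl (\<phi> i)) ` {..<m} \<union> (\<lambda>j. ?cl (\<psi> j)) ` {1..<n}"
  proof
    show "stabilizer_classes F x y H T \<subseteq> (\<lambda>i. ?cl (\<phi> i)) ` {..<m} \<union> (\<lambda>j. ?cl (\<psi> j)) ` {1..<n}"
    proof
      fix X assume "X \<in> stabilizer_classes F x y H T"
      then obtain f where "f \<in> solutions F x y H T" "X = ?cl f"
        unfolding stabilizer_classes_def stabilizer_class_def by (rule quotientE)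
      then show "X \<in> (\<lambda>i. ?cl (\<phi> i)) ` {..<m} \<union> (\<lambda>j. ?cl (\<psi> j)) ` {1..<n}" using cover[of f] by auto
    qed
    show "(\<lambda>i. ?cl (\<phi> i)) ` {..<m} \<union> (\<lambda>j. ?cl (\<psi> j)) ` {1..<n} \<subseteq> stabilizer_classes F x y H T"
      unfolding stabilizer_classes_def stabilizer_class_def using \<phi>(1) \<psi>(1) by (auto intro: quotientI)
  qed

  \<comment> \<open>The listed classes are pairwise distinct\<close>
  have sepU: "int m dvd d" if "U [^]\<^bsub>H\<^esub> (d::int) \<in> generate H {u, U [^]\<^bsub>H\<^esub> (- i) \<otimes>\<^bsub>H\<^esub> v}" for d i :: int
    using power_in_generate[OF prod assms(6,9) Upow(1) _ that[unfolded u_def v_def]] v1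
    by (simp add: v_def)
  have sepV: "int n dvd d" if "V [^]\<^bsub>H\<^esub> (d::int) \<in> generate H {v, V [^]\<^bsub>H\<^esub> (- i) \<otimes>\<^bsub>H\<^esub> u}" for d i :: int
    using power_in_generate[OF prod' assms(9,6) Vpow(1) _ that[unfolded u_def v_def]] u1
    by (simp add: u_def)
  \<comment> \<open>Reduces comparisons of images to membership of a single power, the question that
    \<open>power_in_generate\<close> decides.\<close>
  have diff: "g [^]\<^bsub>H\<^esub> (i - k) \<in> generate H X"
    if "g [^]\<^bsub>H\<^esub> i \<otimes>\<^bsub>H\<^esub> h \<in> generate H X" "g [^]\<^bsub>H\<^esub> k \<otimes>\<^bsub>H\<^esub> h \<in> generate H X"
      "g \<in> carrier H" "h \<in> carrier H" "X \<subseteq> carrier H" for g h X and i k :: int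
  proof -
    have "(g [^]\<^bsub>H\<^esub> i \<otimes>\<^bsub>H\<^esub> h) \<otimes>\<^bsub>H\<^esub> inv\<^bsub>H\<^esub> (g [^]\<^bsub>H\<^esub> k \<otimes>\<^bsub>H\<^esub> h) = g [^]\<^bsub>H\<^esub> (i - k)"
      using that by (simp add: H.inv_mult_group H.m_assoc H.int_pow_diff)
    then show ?thesis using generate.eng[OF that(1) H.generate_m_inv_closed[OF that(5,2)]] by simp
  qed
  have dvd_small: "i = k" if "int l dvd int i - int k" "i < l" "k < l" for i k l :: nat
    using that by (metis mod_eq_dvd_iff mod_less nat_mod_eq_iff of_nat_eq_iff of_nat_mod)
  have inj\<phi>: "i = k" if "?cl (\<phi> i) = ?cl (\<phi> k)" "i < m" "k < m" for i k
  proof -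
    let ?X = "{u, U [^]\<^bsub>H\<^esub> (- int i) \<otimes>\<^bsub>H\<^esub> v}"
    have X: "?X \<subseteq> carrier H" using uv c by simp
    have "generate H ?X = generate H {u, U [^]\<^bsub>H\<^esub> (- int k) \<otimes>\<^bsub>H\<^esub> v}"
      using cl_eqD[OF that(1) \<phi>(1)] \<phi>(2,3) by simp
    then have "U [^]\<^bsub>H\<^esub> (- int k) \<otimes>\<^bsub>H\<^esub> v \<in> generate H ?X" by (auto intro: generate.incl)
    then have "U [^]\<^bsub>H\<^esub> (- int k - - int i) \<in> generate H ?X"
      using c uv X by (intro diff[of _ _ v]) (auto intro: generate.incl)
    then have "int m dvd int i - int k" using sepU by simp
    then show ?thesis using dvd_small that by blast
  qed
  have sepV': "int n dvd d" if "V [^]\<^bsub>H\<^esub> (d::int) \<in> generate H {V [^]\<^bsub>H\<^esub> (j::nat) \<otimes>\<^bsub>H\<^esub> u, v}" for d j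
    using sepV[of d "- int j"] that by (simp add: int_pow_int insert_commute)
  have inj\<psi>: "j = k" if "?cl (\<psi> j) = ?cl (\<psi> k)" "j < n" "k < n" for j k
  proof -
    let ?X = "{V [^]\<^bsub>H\<^esub> j \<otimes>\<^bsub>H\<^esub> u, v}"
    have X: "?X \<subseteq> carrier H" using uv c by simp
    have "generate H ?X = generate H {V [^]\<^bsub>H\<^esub> k \<otimes>\<^bsub>H\<^esub> u, v}"
      using cl_eqD[OF that(1) \<psi>(1)] \<psi>(2,3) by simp
    then have "V [^]\<^bsub>H\<^esub> k \<otimes>\<^bsub>H\<^esub> u \<in> generate H ?X" by (auto intro: generate.incl)
    then have "V [^]\<^bsub>H\<^esub> (int j - int k) \<in> generate H ?X"
      using c uv X by (intro diff[of _ _ u]) (auto intro: generate.incl simp: int_pow_int)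
    then show ?thesis using sepV' dvd_small that by blast
  qed
  \<comment> \<open>A common image would contain u and v, hence U^i by its first description and V^j
    by its second. Divisibility by m and by n then forces i = 0 and j = 0.\<close>
  have disj: "?cl (\<phi> i) \<noteq> ?cl (\<psi> j)" if "i < m" "1 \<le> j" "j < n" for i j
  proof
    assume "?cl (\<phi> i) = ?cl (\<psi> j)"
    then have eq: "generate H {u, U [^]\<^bsub>H\<^esub> (- int i) \<otimes>\<^bsub>H\<^esub> v} = generate H {V [^]\<^bsub>H\<^esub> j \<otimes>\<^bsub>H\<^esub> u, v}"
      using cl_eqD[OF _ \<psi>(1)] \<phi>(2,3) \<psi>(2,3) by metis
    let ?X = "{u, U [^]\<^bsub>H\<^esub> (- int i) \<otimes>\<^bsub>H\<^esub> v}"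
    have X: "?X \<subseteq> carrier H" using uv c by simp
    have v: "v \<in> generate H ?X" unfolding eq by (auto intro: generate.incl)
    have "U [^]\<^bsub>H\<^esub> (0 - - int i) \<in> generate H ?X"
      using c uv X v by (intro diff[of _ _ v]) (auto intro: generate.incl)
    then have "int m dvd int i - int 0" using sepU[of "0 - - int i" "int i"] by simp
    then have "i = 0" using dvd_small \<open>i < m\<close> \<open>m > 0\<close> by blast
    have "u \<in> generate H {V [^]\<^bsub>H\<^esub> j \<otimes>\<^bsub>H\<^esub> u, v}" unfolding eq[symmetric] by (auto intro: generate.incl)
    then have "V [^]\<^bsub>H\<^esub> (int j - int 0) \<in> generate H {V [^]\<^bsub>H\<^esub> j \<otimes>\<^bsub>H\<^esub> u, v}"
      using c uv by (intro diff[of _ _ u]) (auto intro: generate.incl simp: int_pow_int)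
    then have "int n dvd int j - int 0" by (rule sepV')
    then have "j = 0" using dvd_small that \<open>n > 0\<close> by blast
    then show False using \<open>1 \<le> j\<close> by simp
  qed
  have "inj_on (\<lambda>i. ?cl (\<phi> i)) {..<m}" "inj_on (\<lambda>j. ?cl (\<psi> j)) {1..<n}"
    using inj\<phi> inj\<psi> by (auto intro!: inj_onI)
  then have "card (stabilizer_classes F x y H T) = m + (n - 1)"
    unfolding classes using disj by (subst card_Un_disjoint) (auto simp: card_image)
  then have card: "card (stabilizer_classes F x y H T) = m + n - 1" using \<open>n > 0\<close> by simp
  show ?thesis unfolding Let_def u_def[symmetric] v_def[symmetric] T_def[symmetric]
    using card classes \<phi> \<psi> by (intro conjI exI[of _ \<phi>] exI[of _ \<psi>]) auto
qed

end
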